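(* Let $n\ge 1$ and let $u$ be a convex Alexandrov solution of $\det D^2u\ge 1$ in the unit ball $B_1\subset\mathbb{R}^n$. Let $\Sigma\subset B_1$ be the set of points at which $u$ is not strictly convex. Then $\mathcal{H}^{n-1}(\Sigma)=0$.
   Context: For a convex function $v$ on an open set $\Omega\subset\mathbb{R}^n$, $p\in\mathbb{R}^n$ is a subgradient of $v$ at $x$ if $v(y)\ge v(x)+p\cdot(y-x)$ for all $y\in\Omega$; $\partial v(x)$ denotes the set of subgradients and $\partial v(A)=\bigcup_{x\in A}\partial v(x)$. The Monge–Ampère measure of $v$ is the Borel measure $Mv(A)=|\partial v(A)|$ (Lebesgue measure). $v$ is an Alexandrov solution of $\det D^2v\ge 1$ if $Mv(A)\ge |A|$ for all Borel $A\subset\Omega$. A convex function $u$ is strictly convex at $x_0$ if there is a supporting affine function $L_{x_0}$ at $x_0$ (i.e. $L_{x_0}(y)=u(x_0)+p\cdot(y-x_0)$ with $p\in\partial u(x_0)$) such that $\{u=L_{x_0}\}=\{x_0\}$. $\mathcal{H}^{n-1}$ is the $(n-1)$-dimensional Hausdorff measure. *)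

theory Defs
  imports "HOL-Analysis.Analysis"
begin

definition subgradient :: "'a::euclidean_space set \<Rightarrow> ('a \<Rightarrow> real) \<Rightarrow> 'a \<Rightarrow> 'a set" where
  "subgradient \<Omega> v x = {p. \<forall>y\<in>\<Omega>. v y \<ge> v x + p \<bullet> (y - x)}"

definition subgradient_image :: "'a::euclidean_space set \<Rightarrow> ('a \<Rightarrow> real) \<Rightarrow> 'a set \<Rightarrow> 'a set" where
  "subgradient_image \<Omega> v A = (\<Union>x\<in>A. subgradient \<Omega> v x)"

text \<open>Alexandrov solution of det D^2 v >= 1 in Omega: the Monge-Ampere measure
  Mv(A) = |subgradient image of A| (a Borel measure) dominates Lebesgue measure.\<close>
definition alexandrov_det_ge_1 :: "'a::euclidean_space set \<Rightarrow> ('a \<Rightarrow> real) \<Rightarrow> bool" where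
  "alexandrov_det_ge_1 \<Omega> v \<longleftrightarrow>
     (\<forall>A\<in>sets borel. A \<subseteq> \<Omega> \<longrightarrow>
        subgradient_image \<Omega> v A \<in> sets lebesgue \<and>
        emeasure lebesgue A \<le> emeasure lebesgue (subgradient_image \<Omega> v A))"

definition strictly_convex_at :: "'a::euclidean_space set \<Rightarrow> ('a \<Rightarrow> real) \<Rightarrow> 'a \<Rightarrow> bool" where
  "strictly_convex_at \<Omega> u x0 \<longleftrightarrow>
     (\<exists>p\<in>subgradient \<Omega> u x0. {y\<in>\<Omega>. u y = u x0 + p \<bullet> (y - x0)} = {x0})"

text \<open>s-dimensional Hausdorff measure (s a natural number), standard normalisation
  omega_s (diam/2)^s, via countable covers by bounded sets of diameter at most delta.
  Empty sets contribute 0 (so that H^0 is counting measure).\<close>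
definition hausdorff_const :: "nat \<Rightarrow> real" where
  "hausdorff_const s = pi powr (real s / 2) / Gamma (real s / 2 + 1)"

definition hausdorff_pre :: "nat \<Rightarrow> real \<Rightarrow> 'a::metric_space set \<Rightarrow> ennreal" where
  "hausdorff_pre s \<delta> E =
     (INF C \<in> {C :: nat \<Rightarrow> 'a set. E \<subseteq> (\<Union>i. C i) \<and> (\<forall>i. bounded (C i) \<and> diameter (C i) \<le> \<delta>)}.
        (\<Sum>i. (if C i = {} then 0 else ennreal (hausdorff_const s * (diameter (C i) / 2) ^ s))))"

definition hausdorff_measure :: "nat \<Rightarrow> 'a::metric_space set \<Rightarrow> ennreal" where
  "hausdorff_measure s E = (SUP \<delta> \<in> {0<..}. hausdorff_pre s \<delta> E)"

end

theory Submission
  imports Defs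
begin

text \<open>
  Put \<open>v = u + |x|\<^sup>2/2\<close> and let \<open>\<mu>\<close> be its Monge-Ampere measure, which is locally finite.  A section of
  \<open>v\<close> of height \<open>h\<close> lies in a ball of radius about \<open>\<surd>h\<close>.  If \<open>u\<close> agrees with the supporting plane
  \<open>L\<close> at \<open>x\<close> along a segment of length \<open>\<tau>\<close>, then \<open>{u < L + h}\<close> contains about \<open>\<tau>/\<surd>h\<close> disjoint
  half-size copies of the section \<open>S\<^sub>h\<close> of \<open>v\<close> at \<open>x\<close>, while \<open>det D\<^sup>2u \<ge> 1\<close> bounds its volume by
  \<open>C h\<^bsup>n/2\<^esup>\<close>; hence \<open>|S\<^sub>h| \<le> C h\<^bsup>(n+1)/2\<^esup>/\<tau>\<close>.  The polar body of \<open>S\<^sub>h\<close> then shows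
  that \<open>\<mu>\<close> gives the surrounding ball mass at least \<open>c \<tau> h\<^bsup>(n-1)/2\<^esup>\<close>.

  This alone only yields finite \<open>(n-1)\<close>-dimensional measure.  The gain comes from choosing the slope
  of \<open>L\<close> to be a subgradient of maximal norm: then \<open>S\<^sub>h\<close> contains balls of radius \<open>R h\<close> for every
  \<open>R\<close>, once \<open>h\<close> is small, so it is covered by balls of that radius at cost
  \<open>|S\<^sub>h|/(R h) \<le> C h\<^bsup>(n-1)/2\<^esup>/(R \<tau>)\<close>.  In a ball of radius \<open>r = \<surd>h\<close> whose \<open>\<mu>\<close>-mass is at most
  \<open>M r\<^bsup>n-1\<^esup>\<close>, boundedly many sections suffice to cover the singular points, because two polar
  bodies that overlap in a fixed proportion have comparable sections.  The remaining balls number at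
  most \<open>C/(M r\<^bsup>n-1\<^esup>)\<close>.  Letting first \<open>R\<close> and then \<open>M\<close> tend to infinity gives measure zero.
\<close>

section \<open>Volumes of convex bodies and their polars\<close>

text \<open>Failure of strict convexity means that every supporting plane touches \<open>u\<close>
  again, so the slope at a singular point may be chosen freely. A choice is needed: for a slope
  interior to the set of subgradients, a section of height h contains only balls of radius at most a
  constant times h. The term |x|^2/2 does more than confine sections. It makes each slope of
  \<open>v\<close> belong to a single point, so disjoint sets have disjoint images. No Borel measure
  is constructed: the mass of a closed set is the Lebesgue measure of its compact image, and
  counting the sets that contain the point of a slope replaces additivity. The scale below which
  sections contain large balls varies from point to point. The covering estimate therefore runs on
  sets with a common threshold, and it bounds the premeasure of a piece by a small multiple of the
  mass of any neighbourhood of that piece, hence of the piece itself if it is compact. This locality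
  is what allows countably many pieces to be added up against the finite mass of one ball. Constants
  are fixed in the order \<open>\<eta>\<close>, \<open>M\<close>, then \<open>N\<close> and
  \<open>L\<close>, and last \<open>R\<close>; none of them depends on the scale.\<close>

lemma span_differences_eq_UNIV:
  fixes S :: "'a::euclidean_space set"
  assumes "interior S \<noteq> {}"
  shows "span ((\<lambda>y. y - x) ` S) = UNIV"
proof -
  obtain c e where e: "e > 0" "ball c e \<subseteq> S"
    using assms by (metis ex_in_conv mem_interior)
  have "w \<in> span ((\<lambda>y. y - x) ` S)" for w
  proof -
    define d where "d = e / 2 / (norm w + 1)"
    have d: "d > 0" using e by (simp add: d_def add_nonneg_pos)
    have "d * norm w < d * (norm w + 1)" using d by simp
    also have "\<dots> = e / 2" by (simp add: d_def field_simps add_nonneg_eq_0_iff)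
    finally have "d * norm w < e" using e by linarith
    then have "c + d *\<^sub>R w \<in> S" "c \<in> S" using e d by (auto simp: subset_iff dist_norm)
    then have "(c + d *\<^sub>R w - x) - (c - x) \<in> span ((\<lambda>y. y - x) ` S)"
      by (intro span_diff span_base) auto
    then have "d *\<^sub>R w \<in> span ((\<lambda>y. y - x) ` S)" by simp
    from span_scale[OF this, of "1/d"] show ?thesis using d by simp
  qed
  then show ?thesis by auto
qed

text \<open>The rows of \<open>A\<close> are edges from \<open>x\<close> to points of
  \<open>S\<close>; compactness lets the volume |det A| attain a maximum.\<close>

lemma compact_row_matrices:
  fixes S :: "(real^'n) set"
  assumes "compact S"
  shows "compact {A::real^'n^'n. \<forall>i. x + A $ i \<in> S}"
proof -
  have "closed {A::real^'n^'n. \<forall>i. x + A $ i \<in> S}"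
  proof -
    have "closed ((\<lambda>A::real^'n^'n. x + A $ i) -` S)" for i
      using assms by (intro closed_vimage continuous_intros compact_imp_closed)
    then have "closed (\<Inter>i. (\<lambda>A::real^'n^'n. x + A $ i) -` S)" by blast
    then show ?thesis by (simp add: vimage_def Collect_all_eq)
  qed
  moreover have "bounded {A::real^'n^'n. \<forall>i. x + A $ i \<in> S}"
  proof -
    obtain b where b: "\<And>y. y \<in> S \<Longrightarrow> norm y \<le> b"
      using assms compact_imp_bounded bounded_iff by metis
    show ?thesis
    proof (rule boundedI)
      fix A :: "real^'n^'n" assume A: "A \<in> {A. \<forall>i. x + A $ i \<in> S}"
      have "norm A \<le> (\<Sum>i\<in>UNIV. norm (A $ i))"
        unfolding norm_vec_def by (rule L2_set_le_sum) simp
      also have "\<dots> \<le> (\<Sum>i\<in>(UNIV::'n set). b + norm x)"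
      proof (rule sum_mono)
        fix i
        have "A $ i = (x + A $ i) - x" by simp
        then have "norm (A $ i) \<le> norm (x + A $ i) + norm x" by (metis norm_triangle_ineq4)
        then show "norm (A $ i) \<le> b + norm x" using A b[of "x + A $ i"] by auto
      qed
      finally show "norm A \<le> (\<Sum>i\<in>(UNIV::'n set). b + norm x)" .
    qed
  qed
  ultimately show ?thesis by (simp add: compact_eq_bounded_closed)
qed

lemma exists_row_matrix_det_nonzero:
  fixes S :: "(real^'n) set"
  assumes "interior S \<noteq> {}"
  obtains A :: "real^'n^'n" where "det A \<noteq> 0" "\<And>i. x + A $ i \<in> S"
proof -
  let ?D = "(\<lambda>y. y - x) ` S"
  obtain B where B: "B \<subseteq> ?D" "independent B" "?D \<subseteq> span B"
    by (meson maximal_independent_subset)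
  have spB: "span B = UNIV"
    using span_differences_eq_UNIV[OF assms, of x] B
    by (metis UNIV_eq_I UNIV_I span_mono span_span subsetD)
  have "card B = CARD('n)"
    using dim_eq_card_independent[OF B(2)] spB by (metis dim_UNIV dim_span DIM_cart DIM_real mult_1_right mult.commute)
  moreover have "finite B" using B(2) by (rule independent_imp_finite)
  ultimately obtain f :: "'n \<Rightarrow> real^'n" where f: "bij_betw f UNIV B"
    by (metis finite bij_betw_iff_card)
  define A :: "real^'n^'n" where "A = (\<chi> i. f i)"
  have "row i A = f i" for i by (simp add: row_def A_def vec_eq_iff)
  then have "rows A = B" using f by (auto simp: rows_def bij_betw_def)
  then have "det A \<noteq> 0"
    using spB matrix_left_invertible_span_rows[of A] invertible_det_nz[of A]
    by (simp add: invertible_left_inverse)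
  moreover have "x + A $ i \<in> S" for i
  proof -
    have "f i \<in> ?D" using f B(1) by (auto simp: bij_betw_def)
    then show ?thesis by (auto simp: A_def)
  qed
  ultimately show ?thesis using that by blast
qed

text \<open>Take \<open>A\<close> with |det A| maximal. Replacing row \<open>k\<close> by
  \<open>y - x\<close> multiplies the determinant by the coordinate \<open>t $ k\<close> (Cramer),
  and the new matrix is still a competitor, so no coordinate exceeds 1 in absolute value.\<close>

lemma maximal_parallelepiped:
  fixes S :: "(real^'n) set"
  assumes S: "compact S" "interior S \<noteq> {}"
  obtains A :: "real^'n^'n" where "det A \<noteq> 0" "\<And>i. x + A $ i \<in> S"
    "\<And>y. y \<in> S \<Longrightarrow> \<exists>t. y = x + transpose A *v t \<and> (\<forall>i. \<bar>t $ i\<bar> \<le> 1)"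
proof -
  let ?K = "{A::real^'n^'n. \<forall>i. x + A $ i \<in> S}"
  obtain A0 :: "real^'n^'n" where A0: "det A0 \<noteq> 0" "\<And>i. x + A0 $ i \<in> S"
    using exists_row_matrix_det_nonzero[OF S(2)] by blast
  have "continuous_on ?K (\<lambda>A. \<bar>det A\<bar>)"
    unfolding det_def by (intro continuous_intros)
  moreover have "?K \<noteq> {}" using A0 by blast
  ultimately obtain A where A: "A \<in> ?K" "\<And>A'. A' \<in> ?K \<Longrightarrow> \<bar>det A'\<bar> \<le> \<bar>det A\<bar>"
    using continuous_attains_sup[OF compact_row_matrices[OF S(1), of x], of "\<lambda>A. \<bar>det A\<bar>"] by blast
  have dA: "det A \<noteq> 0" using A(2)[of A0] A0 by auto
  have "\<exists>t. y = x + transpose A *v t \<and> (\<forall>i. \<bar>t $ i\<bar> \<le> 1)" if y: "y \<in> S" for y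
  proof -
    have "invertible (transpose A)" using dA by (simp add: invertible_det_nz)
    then obtain B where "transpose A ** B = mat 1" by (auto simp: invertible_def)
    then have "transpose A *v (B *v (y - x)) = y - x"
      by (simp add: matrix_vector_mul_assoc)
    then obtain t where t: "transpose A *v t = y - x" by blast
    have "\<bar>t $ k\<bar> \<le> 1" for k
    proof -
      let ?A' = "(\<chi> i. if i = k then y - x else row i A) :: real^'n^'n"
      have "(\<Sum>i\<in>UNIV. t $ i *s row i A) = y - x"
        using t by (simp add: matrix_mult_sum)
      then have "det ?A' = t $ k * det A" using cramer_lemma_transpose[of k t A] by (simp only:)
      moreover have "?A' \<in> ?K" using A(1) y by (auto simp: row_def)
      ultimately have "\<bar>t $ k\<bar> * \<bar>det A\<bar> \<le> 1 * \<bar>det A\<bar>" using A(2)[of ?A'] by (simp add: abs_mult)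
      then show ?thesis using dA by (metis mult_le_cancel_right abs_ge_zero abs_eq_0 not_le order.strict_iff_order)
    qed
    then show ?thesis using t by (intro exI[of _ t]) simp
  qed
  then show ?thesis using that[OF dA] A(1) by blast
qed

section \<open>Product of the volumes of a convex body and its polar\<close>

lemma measure_matrix_image:
  fixes A :: "real^('n::{finite,wellorder})^('n::{finite,wellorder})"
  assumes "S \<in> lmeasurable"
  shows "(\<lambda>t. x + A *v t) ` S \<in> lmeasurable"
    "measure lebesgue ((\<lambda>t. x + A *v t) ` S) = \<bar>det A\<bar> * measure lebesgue S"
proof -
  have eq: "(\<lambda>t. x + A *v t) ` S = (+) x ` ((*v) A ` S)" by (simp add: image_image)
  have "linear ((*v) A)" by simp
  then show "(\<lambda>t. x + A *v t) ` S \<in> lmeasurable"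
    "measure lebesgue ((\<lambda>t. x + A *v t) ` S) = \<bar>det A\<bar> * measure lebesgue S"
    unfolding eq using measurable_linear_image[of "(*v) A" S] measure_linear_image[of "(*v) A" S] assms
    by (auto simp: measurable_translation measure_translation)
qed

lemma measure_cbox_cart:
  fixes a b :: "real"
  assumes "a \<le> b"
  shows "measure lborel (cbox (\<chi> i. a) (\<chi> i. b) :: (real^'n) set) = (b - a) ^ CARD('n)"
proof -
  have "cbox (\<chi> i. a) (\<chi> i. b) \<noteq> ({}::(real^'n) set)"
    using assms by (auto simp: interval_eq_empty_cart)
  then show ?thesis by (simp add: content_cbox_cart)
qed

text \<open>The maximal matrix \<open>A\<close> squeezes \<open>S\<close> between the simplex with
  vertices \<open>x\<close>, \<open>x + A $ i\<close> and the parallelepiped with coordinates in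
  [-1,1]. Hence the volume of \<open>S\<close> is |det A| and that of a polar is 1 / |det A|, up to
  factors depending on the dimension. The upper bound is a crude Blaschke-Santalo inequality and
  needs a centre \<open>z\<close> well inside \<open>S\<close>; the lower bound uses the symmetric
  polar and allows any point \<open>x\<close> of \<open>S\<close>.\<close>

lemma polar_product_bounds_cart:
  fixes S :: "(real^('n::{finite,wellorder})) set"
  notes transpose_matrix_vector [simp del]
  assumes S: "compact S" "convex S" "interior S \<noteq> {}" and x: "x \<in> S"
  shows "\<exists>z\<in>S. measure lebesgue S * measure lebesgue {s. \<forall>y\<in>S. s \<bullet> (y - z) \<le> 1} \<le> (8 * CARD('n)) ^ CARD('n)
      \<and> bounded {s. \<forall>y\<in>S. s \<bullet> (y - z) \<le> 1}"
    and "measure lebesgue S * measure lebesgue {s. \<forall>y\<in>S. \<bar>s \<bullet> (y - x)\<bar> \<le> 1} \<ge> (2 / CARD('n)^2) ^ CARD('n)"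
proof -
  let ?n = "real CARD('n)"
  have n: "?n \<ge> 1" by (simp add: Suc_leI)
  obtain A :: "((real, 'n) vec, 'n) vec" where A: "det A \<noteq> 0" "\<And>i. x + A $ i \<in> S"
    "\<And>y. y \<in> S \<Longrightarrow> \<exists>t. y = x + transpose A *v t \<and> (\<forall>i. \<bar>t $ i\<bar> \<le> 1)"
    using maximal_parallelepiped[OF S(1,3)] by blast
  have SL: "S \<in> lmeasurable" using S by (simp add: lmeasurable_compact)
  obtain B where B: "A ** B = mat 1" "B ** A = mat 1"
    using A(1) by (metis invertible_det_nz invertible_def)
  have detB: "det B = 1 / det A"
    using arg_cong[OF B(1), of det] A(1) by (simp add: det_mul field_simps)
  have AB: "A *v (B *v t) = t" "B *v (A *v t) = t" for t
    using B by (simp_all add: matrix_vector_mul_assoc)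
  have inner: "s \<bullet> (transpose A *v t) = (A *v s) \<bullet> t" for s t
    by (simp add: dot_lmul_matrix matrix_vector_mult_def inner_vec_def transpose_def sum_distrib_left sum_distrib_right)
       (subst sum.swap, simp add: mult_ac)
  have inS: "x + transpose A *v t \<in> S" if "\<And>i. t $ i \<ge> 0" "(\<Sum>i\<in>UNIV. t $ i) \<le> 1" for t
  proof -
    have eq: "x + transpose A *v t = (1 - (\<Sum>i\<in>UNIV. t $ i)) *\<^sub>R x + (\<Sum>i\<in>UNIV. t $ i *\<^sub>R (x + A $ i))"
    proof -
      have "transpose A *v t = (\<Sum>i\<in>UNIV. t $ i *\<^sub>R A $ i)"
        by (simp add: matrix_mult_sum row_def scalar_mult_eq_scaleR)
      then show ?thesis
        by (simp add: algebra_simps sum.distrib scaleR_sum_left)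
    qed
    define s where "s = (\<Sum>i\<in>UNIV. t $ i)"
    show ?thesis
    proof (cases "s = 0")
      case True
      then have "t $ i = 0" for i
        using that(1) sum_nonneg_eq_0_iff[of UNIV "\<lambda>i. t $ i"] by (auto simp: s_def)
      then have "t = 0" by (simp add: vec_eq_iff)
      then show ?thesis using x by simp
    next
      case False
      then have sp: "s > 0" using that(1) by (simp add: s_def sum_nonneg order.not_eq_order_implies_strict)
      have "(\<Sum>i\<in>UNIV. (t $ i / s) *\<^sub>R (x + A $ i)) \<in> S"
      proof (rule convex_sum[OF _ S(2)])
        show "(\<Sum>i\<in>UNIV. t $ i / s) = 1" using sp by (simp add: s_def flip: sum_divide_distrib)
        show "0 \<le> t $ i / s" for i using that(1) sp by simp
      qed (use A(2) in auto)
      then have "(1 - s) *\<^sub>R x + s *\<^sub>R (\<Sum>i\<in>UNIV. (t $ i / s) *\<^sub>R (x + A $ i)) \<in> S"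
        using S(2) x sp that(2) by (intro convexD) (auto simp: s_def)
      also have "s *\<^sub>R (\<Sum>i\<in>UNIV. (t $ i / s) *\<^sub>R (x + A $ i)) = (\<Sum>i\<in>UNIV. t $ i *\<^sub>R (x + A $ i))"
        using sp by (simp add: scaleR_sum_right)
      finally show ?thesis by (simp add: eq s_def)
    qed
  qed
  have upper: "measure lebesgue S \<le> \<bar>det A\<bar> * 2 ^ CARD('n)"
  proof -
    let ?C = "cbox (\<chi> i. -1) (\<chi> i. 1) :: ((real, 'n) vec) set"
    have "S \<subseteq> (\<lambda>t. x + transpose A *v t) ` ?C"
      using A(3) by (fastforce simp: mem_box_cart abs_le_iff)
    then have "measure lebesgue S \<le> measure lebesgue ((\<lambda>t. x + transpose A *v t) ` ?C)"
      using SL by (intro measure_mono_fmeasurable measure_matrix_image) auto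
    also have "\<dots> = \<bar>det A\<bar> * 2 ^ CARD('n)"
      by (subst measure_matrix_image) (simp_all add: measure_cbox_cart)
    finally show ?thesis .
  qed
  have lower: "measure lebesgue S \<ge> \<bar>det A\<bar> * (1 / ?n) ^ CARD('n)"
  proof -
    let ?C = "cbox (\<chi> i. 0) (\<chi> i. 1/?n) :: ((real, 'n) vec) set"
    have "(\<lambda>t. x + transpose A *v t) ` ?C \<subseteq> S"
    proof (clarify, rule inS)
      fix t :: "(real, 'n) vec" assume t: "t \<in> ?C"
      then show "0 \<le> t $ i" for i by (simp add: mem_box_cart)
      have "(\<Sum>i\<in>UNIV. t $ i) \<le> (\<Sum>i\<in>(UNIV::'n set). 1/?n)"
        using t by (intro sum_mono) (simp add: mem_box_cart)
      then show "(\<Sum>i\<in>UNIV. t $ i) \<le> 1" using n by simp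
    qed
    then have "measure lebesgue ((\<lambda>t. x + transpose A *v t) ` ?C) \<le> measure lebesgue S"
      using SL by (intro measure_mono_fmeasurable fmeasurableD measure_matrix_image) auto
    moreover have "measure lebesgue ((\<lambda>t. x + transpose A *v t) ` ?C) = \<bar>det A\<bar> * (1 / ?n) ^ CARD('n)"
      by (subst measure_matrix_image) (simp_all add: measure_cbox_cart)
    ultimately show ?thesis by simp
  qed
  \<comment> \<open>The coordinates of \<open>b\<close> sum to 1/2, so changing one of them by
    1/(2n) in either direction stays inside the simplex. This room around \<open>z\<close> is what
    bounds the polar.\<close>
  define b :: "(real, 'n) vec" where "b = (\<chi> i. 1 / (2 * ?n))"
  define z where "z = x + transpose A *v b"
  have z: "z \<in> S" unfolding z_def using n by (intro inS) (auto simp: b_def)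
  let ?Q = "{s. \<forall>y\<in>S. s \<bullet> (y - z) \<le> 1}"
  let ?C = "cbox (\<chi> i. - (2 * ?n)) (\<chi> i. 2 * ?n) :: ((real, 'n) vec) set"
  have Qsub: "?Q \<subseteq> (\<lambda>t. 0 + B *v t) ` ?C"
  proof
    fix s assume s: "s \<in> ?Q"
    have "\<bar>(A *v s) $ i\<bar> \<le> 2 * ?n" for i
    proof -
      \<comment> \<open>Testing \<open>s\<close> at \<open>z\<close> plus or minus 1/(2n) times row
        \<open>i\<close> bounds coordinate \<open>i\<close> of \<open>A *v s\<close> by 2n.\<close>
      have *: "\<sigma> * (A *v s) $ i * (1 / (2 * ?n)) \<le> 1" if \<sigma>: "\<sigma> = 1 \<or> \<sigma> = -1" for \<sigma> :: real
      proof -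
        define t where "t = b + (\<sigma> / (2 * ?n)) *\<^sub>R axis i 1"
        have "x + transpose A *v t \<in> S"
        proof (rule inS)
          show "0 \<le> t $ j" for j using \<sigma> n by (auto simp: t_def b_def axis_def)
          have "(\<Sum>j\<in>UNIV. t $ j) = (\<Sum>j\<in>(UNIV::'n set). 1 / (2 * ?n)) + (\<Sum>j\<in>UNIV. \<sigma> / (2*?n) * axis i 1 $ j)"
            by (simp add: t_def b_def sum.distrib)
          also have "(\<Sum>j\<in>UNIV. \<sigma> / (2*?n) * axis i 1 $ j) = \<sigma> / (2 * ?n)"
            by (subst sum_distrib_left[symmetric]) (simp add: axis_def)
          also have "(\<Sum>j\<in>(UNIV::'n set). 1 / (2 * ?n)) = 1 / 2" using n by simp
          finally have "(\<Sum>j\<in>UNIV. t $ j) = 1 / 2 + \<sigma> / (2 * ?n)" .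
          moreover have "\<sigma> / (2 * ?n) \<le> 1 / 2" using \<sigma> n by (auto simp: field_simps)
          ultimately show "(\<Sum>j\<in>UNIV. t $ j) \<le> 1" by linarith
        qed
        then have "s \<bullet> (x + transpose A *v t - z) \<le> 1" using s by blast
        also have "x + transpose A *v t - z = transpose A *v ((\<sigma> / (2 * ?n)) *\<^sub>R axis i 1)"
          by (simp add: z_def t_def matrix_vector_mult_add_rdistrib matrix_vector_right_distrib)
        finally show ?thesis by (simp add: inner inner_axis)
      qed
      show ?thesis using *[of 1] *[of "-1"] n by (simp add: field_simps abs_le_iff)
    qed
    then have "A *v s \<in> ?C" by (simp add: mem_box_cart abs_le_iff minus_le_iff)
    then show "s \<in> (\<lambda>t. 0 + B *v t) ` ?C" using AB(2)[of s] by (intro image_eqI[of _ _ "A *v s"]) auto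
  qed
  have "bounded ((\<lambda>t. 0 + B *v t) ` ?C)"
    by (intro compact_imp_bounded compact_continuous_image continuous_intros compact_cbox)
  then have bQ: "bounded ?Q" using Qsub bounded_subset by blast
  have "convex ?Q"
  proof -
    have "?Q = (\<Inter>y\<in>S. {s. (y - z) \<bullet> s \<le> 1})" by (auto simp: inner_commute)
    then show ?thesis by (simp add: convex_INT convex_halfspace_le)
  qed
  then have "?Q \<in> lmeasurable" using bQ by (simp add: measurable_convex)
  then have "measure lebesgue ?Q \<le> measure lebesgue ((\<lambda>t. 0 + B *v t) ` ?C)"
    using Qsub by (intro measure_mono_fmeasurable measure_matrix_image) auto
  also have "\<dots> = (4 * ?n) ^ CARD('n) / \<bar>det A\<bar>"
    by (subst measure_matrix_image) (simp_all add: measure_cbox_cart detB n)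
  finally have "measure lebesgue S * measure lebesgue ?Q \<le> (\<bar>det A\<bar> * 2 ^ CARD('n)) * ((4 * ?n) ^ CARD('n) / \<bar>det A\<bar>)"
    using upper by (intro mult_mono) auto
  also have "\<dots> = (2 * (4 * ?n)) ^ CARD('n)"
    unfolding power_mult_distrib[of 2 "4 * ?n"] using A(1) by (simp del: power_mult_distrib)
  also have "2 * (4 * ?n) = 8 * ?n" by simp
  finally show "\<exists>z\<in>S. measure lebesgue S * measure lebesgue {s. \<forall>y\<in>S. s \<bullet> (y - z) \<le> 1} \<le> (8 * CARD('n)) ^ CARD('n)
      \<and> bounded {s. \<forall>y\<in>S. s \<bullet> (y - z) \<le> 1}"
    using z bQ by (intro bexI[of _ z]) auto

  let ?P = "{s. \<forall>y\<in>S. \<bar>s \<bullet> (y - x)\<bar> \<le> 1}"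
  let ?C = "cbox (\<chi> i. - (1 / ?n)) (\<chi> i. 1 / ?n) :: ((real, 'n) vec) set"
  \<comment> \<open>In the coordinates of the outer parallelepiped the product becomes
    \<open>t \<bullet> w\<close> with |w_i| at most 1, so entries of size 1/n suffice.\<close>
  have Psub: "(\<lambda>t. 0 + B *v t) ` ?C \<subseteq> ?P"
  proof clarify
    fix t y assume t: "t \<in> ?C" and y: "y \<in> S"
    obtain w where w: "y = x + transpose A *v w" "\<And>i. \<bar>w $ i\<bar> \<le> 1" using A(3)[OF y] by blast
    have "(0 + B *v t) \<bullet> (y - x) = t \<bullet> w" by (simp add: w(1) inner AB)
    also have "\<bar>t \<bullet> w\<bar> \<le> (\<Sum>i\<in>UNIV. \<bar>t $ i * w $ i\<bar>)" by (simp add: inner_vec_def)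
    also have "\<dots> \<le> (\<Sum>i\<in>(UNIV::'n set). (1 / ?n) * 1)"
    proof (rule sum_mono)
      fix i
      have "\<bar>t $ i\<bar> \<le> 1 / ?n" using t by (auto simp: mem_box_cart abs_le_iff minus_le_iff)
      then show "\<bar>t $ i * w $ i\<bar> \<le> (1 / ?n) * 1" unfolding abs_mult using w(2) by (intro mult_mono) auto
    qed
    finally show "\<bar>(0 + B *v t) \<bullet> (y - x)\<bar> \<le> 1" using n by simp
  qed
  have "convex ?P"
  proof -
    have "?P = (\<Inter>y\<in>S. {s. (y - x) \<bullet> s \<le> 1} \<inter> {s. (y - x) \<bullet> s \<ge> -1})" by (auto simp: inner_commute abs_le_iff)
    then show ?thesis by (simp add: convex_INT convex_Int convex_halfspace_le convex_halfspace_ge)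
  qed
  moreover have "bounded ?P"
  proof -
    have "\<bar>(A *v s) $ i\<bar> \<le> 1" if "s \<in> ?P" for s i
    proof -
      have "\<bar>s \<bullet> (x + A $ i - x)\<bar> \<le> 1" using that A(2) by blast
      then show ?thesis by (simp add: matrix_vector_mul_component inner_commute)
    qed
    then have "A *v s \<in> cbox (\<chi> i. - 1) (\<chi> i. 1)" if "s \<in> ?P" for s
      using that by (simp only: mem_box_cart abs_le_iff minus_le_iff) simp
    then have "?P \<subseteq> (\<lambda>t. 0 + B *v t) ` cbox (\<chi> i. - 1) (\<chi> i. 1)"
      using AB(2) by (metis (no_types, lifting) add_0 image_eqI subsetI)
    moreover have "bounded ((\<lambda>t. 0 + B *v t) ` cbox (\<chi> i. - 1) (\<chi> i. 1))"
      by (intro compact_imp_bounded compact_continuous_image continuous_intros compact_cbox)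
    ultimately show ?thesis using bounded_subset by blast
  qed
  ultimately have "?P \<in> lmeasurable" by (simp add: measurable_convex)
  then have "measure lebesgue ((\<lambda>t. 0 + B *v t) ` ?C) \<le> measure lebesgue ?P"
    using Psub by (intro measure_mono_fmeasurable fmeasurableD measure_matrix_image) auto
  moreover have "measure lebesgue ((\<lambda>t. 0 + B *v t) ` ?C) = (2 / ?n) ^ CARD('n) / \<bar>det A\<bar>"
    by (subst measure_matrix_image) (simp_all add: measure_cbox_cart detB)
  ultimately have "(\<bar>det A\<bar> * (1 / ?n) ^ CARD('n)) * ((2 / ?n) ^ CARD('n) / \<bar>det A\<bar>) \<le> measure lebesgue S * measure lebesgue ?P"
    using lower by (intro mult_mono) auto
  also have "(\<bar>det A\<bar> * (1 / ?n) ^ CARD('n)) * ((2 / ?n) ^ CARD('n) / \<bar>det A\<bar>) = ((1 / ?n) * (2 / ?n)) ^ CARD('n)"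
    unfolding power_mult_distrib[of "1 / ?n" "2 / ?n"] using A(1) by simp
  also have "(1 / ?n) * (2 / ?n) = 2 / ?n\<^sup>2" by (simp add: power2_eq_square)
  finally show "measure lebesgue S * measure lebesgue ?P \<ge> (2 / CARD('n)^2) ^ CARD('n)"
    by simp
qed

text \<open>The library relates determinants to Lebesgue measure only for vectors over a finite well-ordered
  index type; this type makes every Euclidean space isometric to such a vector space.\<close>
typedef (overloaded) 'a coord_index = "{..<DIM('a::euclidean_space)}"
  by (rule exI[of _ 0]) simp

instance coord_index :: (euclidean_space) finite
proof
  have "(UNIV :: 'a coord_index set) = Abs_coord_index ` {..<DIM('a)}"
    by (metis type_definition.Abs_image type_definition_coord_index)
  then show "finite (UNIV :: 'a coord_index set)" by (metis finite_imageI finite_lessThan)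
qed

instantiation coord_index :: (euclidean_space) wellorder
begin

definition less_eq_coord_index :: "'a coord_index \<Rightarrow> 'a coord_index \<Rightarrow> bool" where
  "less_eq_coord_index i j \<longleftrightarrow> Rep_coord_index i \<le> Rep_coord_index j"

definition less_coord_index :: "'a coord_index \<Rightarrow> 'a coord_index \<Rightarrow> bool" where
  "less_coord_index i j \<longleftrightarrow> Rep_coord_index i < Rep_coord_index j"

instance
proof
  fix P :: "'a coord_index \<Rightarrow> bool" and a
  assume *: "\<And>i. (\<And>j. j < i \<Longrightarrow> P j) \<Longrightarrow> P i"
  show "P a"
  proof (induction "Rep_coord_index a" arbitrary: a rule: less_induct)
    case less
    show ?case by (rule *) (simp add: less less_coord_index_def)
  qed
qed (auto simp: less_eq_coord_index_def less_coord_index_def Rep_coord_index_inject)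

end

lemma CARD_coord_index: "CARD('a::euclidean_space coord_index) = DIM('a)"
  using type_definition.card[OF type_definition_coord_index] by simp

section \<open>Isometry between a Euclidean space and its coordinate vectors\<close>

definition basis_at :: "'a::euclidean_space coord_index \<Rightarrow> 'a" where
  "basis_at = (SOME f. bij_betw f UNIV Basis)"

lemma bij_basis_at: "bij_betw (basis_at :: 'a::euclidean_space coord_index \<Rightarrow> 'a) UNIV Basis"
proof -
  have "\<exists>f. bij_betw f (UNIV :: 'a coord_index set) (Basis :: 'a set)"
    by (intro finite_same_card_bij) (auto simp: CARD_coord_index)
  then show ?thesis unfolding basis_at_def by (rule someI_ex)
qed

definition to_cart :: "'a::euclidean_space \<Rightarrow> (real, 'a coord_index) vec" where
  "to_cart x = (\<chi> i. x \<bullet> basis_at i)"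

definition of_cart :: "(real, 'a coord_index) vec \<Rightarrow> 'a::euclidean_space" where
  "of_cart y = (\<Sum>i\<in>UNIV. y $ i *\<^sub>R basis_at i)"

lemma basis_at_in_Basis [simp]: "basis_at i \<in> Basis"
  using bij_basis_at by (auto simp: bij_betw_def)

lemma basis_at_inner: "basis_at i \<bullet> basis_at j = (if i = j then 1 else 0)"
  using bij_basis_at by (auto simp: inner_Basis bij_betw_def dest: injD)

lemma sum_basis_at: "(\<Sum>i\<in>UNIV. f (basis_at i)) = (\<Sum>b\<in>Basis. f b)"
  using sum.reindex_bij_betw[OF bij_basis_at] .

lemma prod_basis_at: "(\<Prod>i\<in>UNIV. f (basis_at i)) = (\<Prod>b\<in>Basis. f b)"
  using prod.reindex_bij_betw[OF bij_basis_at] .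

lemma of_cart_to_cart [simp]: "of_cart (to_cart x) = x"
  unfolding of_cart_def to_cart_def
  using sum_basis_at[of "\<lambda>b. (x \<bullet> b) *\<^sub>R b"] by (simp add: euclidean_representation)

lemma to_cart_of_cart [simp]: "to_cart (of_cart y) = y"
  by (simp add: of_cart_def to_cart_def vec_eq_iff inner_sum_left basis_at_inner if_distrib cong: if_cong)

lemma linear_to_cart: "linear to_cart"
  by (rule linearI) (simp_all add: to_cart_def vec_eq_iff inner_add_left)

lemma linear_of_cart: "linear of_cart"
  by (rule linearI) (simp_all add: of_cart_def algebra_simps sum.distrib scaleR_sum_right)

lemma inner_to_cart: "to_cart x \<bullet> to_cart y = x \<bullet> y"
  using sum_basis_at[of "\<lambda>b. (x \<bullet> b) * (y \<bullet> b)"]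
  by (simp add: inner_vec_def to_cart_def euclidean_inner[of x y])

lemma continuous_on_to_cart: "continuous_on S to_cart"
  by (intro linear_continuous_on) (simp add: linear_conv_bounded_linear[symmetric] linear_to_cart)

lemma continuous_on_of_cart: "continuous_on S of_cart"
  by (intro linear_continuous_on) (simp add: linear_conv_bounded_linear[symmetric] linear_of_cart)

lemma to_cart_image_eq_vimage: "to_cart ` S = of_cart -` S"
  by (auto simp: image_iff) (metis to_cart_of_cart)

text \<open>Coordinates with respect to an orthonormal basis pull boxes back to boxes with the same
  side lengths, and Lebesgue measure is determined by its values on boxes.\<close>

lemma distr_to_cart: "distr lborel borel to_cart = (lborel :: (real, 'a::euclidean_space coord_index) vec measure)"
proof (rule lborel_eqI[symmetric])
  fix l u :: "(real, 'a coord_index) vec"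
  assume le: "\<And>b. b \<in> Basis \<Longrightarrow> l \<bullet> b \<le> u \<bullet> b"
  have le': "l $ i \<le> u $ i" for i using le[of "axis i 1"] by (simp add: inner_axis)
  have comp: "of_cart y \<bullet> basis_at i = y $ i" for y :: "(real, 'a coord_index) vec" and i
    using arg_cong[OF to_cart_of_cart[of y], of "\<lambda>v. v $ i"] by (simp add: to_cart_def)
  have [measurable]: "to_cart \<in> borel_measurable (borel :: 'a measure)"
    by (intro borel_measurable_continuous_onI continuous_on_to_cart)
  have ball: "(\<forall>b\<in>Basis. Q b) \<longleftrightarrow> (\<forall>i. Q (basis_at i))" for Q :: "'a \<Rightarrow> bool"
    using bij_basis_at[where 'a='a] unfolding bij_betw_def by (metis UNIV_I imageE image_eqI)
  have "y \<in> box (of_cart l) (of_cart u) \<longleftrightarrow> to_cart y \<in> box l u" for y :: 'a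
    unfolding mem_box_cart mem_box(1)[of y] ball comp by (simp add: to_cart_def)
  then have "to_cart -` box l u = box (of_cart l) (of_cart u)" by blast
  then have "emeasure (distr lborel borel to_cart) (box l u) = emeasure lborel (box (of_cart l) (of_cart u))"
    by (subst emeasure_distr) auto
  also have "\<dots> = (\<Prod>b\<in>Basis. (of_cart u - of_cart l) \<bullet> b)"
  proof (intro emeasure_lborel_box)
    fix b :: 'a assume "b \<in> Basis"
    then obtain i where "b = basis_at i" using bij_basis_at[where 'a='a] by (auto simp: bij_betw_def)
    then show "of_cart l \<bullet> b \<le> of_cart u \<bullet> b" using le' by (simp add: comp)
  qed
  also have "(\<Prod>b\<in>Basis. (of_cart u - of_cart l) \<bullet> b) = (\<Prod>i\<in>UNIV. (u - l) $ i)"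
    by (subst prod_basis_at[symmetric]) (simp add: inner_diff_left comp)
  also have "\<dots> = (\<Prod>b\<in>Basis. (u - l) \<bullet> b)"
    by (simp add: prod.reindex inj_on_def axis_eq_axis Basis_vec_def cart_eq_inner_axis
        UNION_singleton_eq_range)
  finally show "emeasure (distr lborel borel to_cart) (box l u) = (\<Prod>b\<in>Basis. (u - l) \<bullet> b)" .
qed simp

lemma measure_to_cart_image:
  assumes "S \<in> sets borel"
  shows "measure lebesgue (to_cart ` S) = measure lebesgue S"
proof -
  have [measurable]: "to_cart \<in> borel_measurable (borel :: 'a measure)"
    by (intro borel_measurable_continuous_onI continuous_on_to_cart)
  have "of_cart -` S \<inter> space borel \<in> sets (borel :: (real, 'a coord_index) vec measure)"
    by (intro measurable_sets[OF _ assms] borel_measurable_continuous_onI continuous_on_of_cart)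
  then have B: "to_cart ` S \<in> sets borel" by (simp add: to_cart_image_eq_vimage)
  have "measure (distr lborel borel to_cart) (to_cart ` S) = measure lborel (to_cart -` (to_cart ` S) \<inter> space lborel)"
    using B by (intro measure_distr) auto
  also have "to_cart -` (to_cart ` S) \<inter> space lborel = S"
    by (simp add: inj_vimage_image_eq inj_on_inverseI[where g = of_cart])
  finally show ?thesis using B assms by (simp add: distr_to_cart)
qed

text \<open>\<open>to_cart\<close> preserves inner products, so it carries polars to polars, and it
  preserves volumes.\<close>

lemma polar_product_bounds:
  fixes S :: "'a::euclidean_space set"
  assumes S: "compact S" "convex S" "interior S \<noteq> {}" and x: "x \<in> S"
  shows "\<exists>z\<in>S. measure lebesgue S * measure lebesgue {s. \<forall>y\<in>S. s \<bullet> (y - z) \<le> 1} \<le> (8 * DIM('a)) ^ DIM('a)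
      \<and> bounded {s. \<forall>y\<in>S. s \<bullet> (y - z) \<le> 1}"
    and "measure lebesgue S * measure lebesgue {s. \<forall>y\<in>S. \<bar>s \<bullet> (y - x)\<bar> \<le> 1} \<ge> (2 / DIM('a)^2) ^ DIM('a)"
proof -
  let ?S = "to_cart ` S"
  have cS: "compact ?S" by (intro compact_continuous_image continuous_on_to_cart S)
  have vS: "convex ?S" by (intro convex_linear_image linear_to_cart S)
  have iS: "interior ?S \<noteq> {}"
  proof -
    have "open (of_cart -` interior S)"
      by (intro open_vimage open_interior) (simp add: continuous_on_of_cart)
    moreover have "of_cart -` interior S \<subseteq> ?S"
      using interior_subset by (auto simp: to_cart_image_eq_vimage)
    moreover have "of_cart -` interior S \<noteq> {}"
      using S(3) by (metis ex_in_conv of_cart_to_cart vimageI2)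
    ultimately show ?thesis by (metis interior_maximal subset_empty)
  qed
  have mS: "measure lebesgue ?S = measure lebesgue S"
    using S(1) by (intro measure_to_cart_image borel_compact)
  have inn: "s \<bullet> (to_cart y - to_cart z) = of_cart s \<bullet> (y - z)" for s y z
    using inner_to_cart[of "of_cart s" "y - z"] by (simp add: linear_diff[OF linear_to_cart])
  have pol: "{s. \<forall>y\<in>?S. s \<bullet> (y - to_cart z) \<le> 1} = to_cart ` {s. \<forall>y\<in>S. s \<bullet> (y - z) \<le> 1}" for z
    by (auto simp: to_cart_image_eq_vimage[of "Collect _"] inn)
  have pol2: "{s. \<forall>y\<in>?S. \<bar>s \<bullet> (y - to_cart z)\<bar> \<le> 1} = to_cart ` {s. \<forall>y\<in>S. \<bar>s \<bullet> (y - z)\<bar> \<le> 1}" for z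
    by (auto simp: to_cart_image_eq_vimage[of "Collect _"] inn)
  have cl: "closed {s. \<forall>y\<in>S. s \<bullet> (y - z) \<le> 1}" for z
  proof -
    have "{s. \<forall>y\<in>S. s \<bullet> (y - z) \<le> 1} = (\<Inter>y\<in>S. {s. (y - z) \<bullet> s \<le> 1})" by (auto simp: inner_commute)
    then show ?thesis by (simp add: closed_INT closed_halfspace_le)
  qed
  have cl2: "closed {s. \<forall>y\<in>S. \<bar>s \<bullet> (y - z)\<bar> \<le> 1}" for z
  proof -
    have "{s. \<forall>y\<in>S. \<bar>s \<bullet> (y - z)\<bar> \<le> 1} = (\<Inter>y\<in>S. {s. (y - z) \<bullet> s \<le> 1} \<inter> {s. (y - z) \<bullet> s \<ge> -1})"
      by (auto simp: inner_commute abs_le_iff)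
    then show ?thesis by (simp add: closed_INT closed_Int closed_halfspace_le closed_halfspace_ge)
  qed
  obtain z where z: "z \<in> S"
    "measure lebesgue ?S * measure lebesgue {s. \<forall>y\<in>?S. s \<bullet> (y - to_cart z) \<le> 1} \<le> (8 * DIM('a)) ^ DIM('a)"
    "bounded {s. \<forall>y\<in>?S. s \<bullet> (y - to_cart z) \<le> 1}"
    using polar_product_bounds_cart(1)[OF cS vS iS, of "to_cart x"] x unfolding CARD_coord_index by blast
  have "bounded (of_cart ` {s. \<forall>y\<in>?S. s \<bullet> (y - to_cart z) \<le> 1})"
    using z(3) by (intro bounded_linear_image) (simp_all add: linear_conv_bounded_linear[symmetric] linear_of_cart)
  then have "bounded {s. \<forall>y\<in>S. s \<bullet> (y - z) \<le> 1}"
    unfolding pol by (simp add: image_image)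
  then show "\<exists>z\<in>S. measure lebesgue S * measure lebesgue {s. \<forall>y\<in>S. s \<bullet> (y - z) \<le> 1} \<le> (8 * DIM('a)) ^ DIM('a)
      \<and> bounded {s. \<forall>y\<in>S. s \<bullet> (y - z) \<le> 1}"
    using z(1,2) cl[of z] unfolding pol mS by (intro bexI[of _ z]) (simp_all add: measure_to_cart_image borel_closed)
  show "measure lebesgue S * measure lebesgue {s. \<forall>y\<in>S. \<bar>s \<bullet> (y - x)\<bar> \<le> 1} \<ge> (2 / DIM('a)^2) ^ DIM('a)"
    using polar_product_bounds_cart(2)[OF cS vS iS, of "to_cart x"] x cl2[of x]
    unfolding pol2 mS CARD_coord_index by (simp add: measure_to_cart_image borel_closed)
qed

section \<open>Packing, covering and Hausdorff premeasures\<close>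

text \<open>If \<open>t\<close> is far from the thin set \<open>O'\<close> in the direction
  \<open>a\<close>, homotheties with centre \<open>t\<close> and ratios between 1/2 and 1 carry
  \<open>O'\<close> to many disjoint copies inside \<open>C\<close>. The lemma serves twice: for a
  section and the far end of its contact segment, and for the overlap of two polar bodies.\<close>

lemma width_measure_le:
  fixes C O' :: "'a::euclidean_space set"
  assumes C: "convex C" "C \<in> lmeasurable" and O: "compact O'" "O' \<subseteq> C" and w: "w > 0"
    and width: "\<And>s s'. s \<in> O' \<Longrightarrow> s' \<in> O' \<Longrightarrow> a \<bullet> (s - s') \<le> w"
    and t: "t \<in> C" and q: "q \<in> O'"
  shows "\<bar>a \<bullet> (t - q)\<bar> * measure lebesgue O' \<le> 6 * 2 ^ DIM('a) * w * measure lebesgue C"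
proof (cases "a \<bullet> (t - q) = 0")
  case True
  then show ?thesis using w by simp
next
  case False
  define D where "D = \<bar>a \<bullet> (t - q)\<bar>"
  have D: "D > 0" using False by (simp add: D_def)
  \<comment> \<open>The map with parameter \<open>\<theta> k\<close> shifts \<open>q\<close> by
    \<open>3 * w * k\<close> along \<open>a\<close>, and each copy reaches at most \<open>w\<close>
    from its image of \<open>q\<close>, so shifts differing by \<open>3 * w\<close> give disjoint
    copies. \<open>m\<close> is the last index with \<open>\<theta> m\<close> at most 1/2.\<close>
  define m where "m = nat \<lfloor>D / (6 * w)\<rfloor>"
  define \<theta> where "\<theta> k = 3 * w * real k / D" for k
  define H where "H k = (\<lambda>s. (1 - \<theta> k) *\<^sub>R s + \<theta> k *\<^sub>R t) ` O'" for k
  have m: "real m \<le> D / (6 * w)" "D / (6 * w) \<le> real m + 1"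
    using D w by (auto simp: m_def of_nat_floor intro: less_imp_le)
  have th: "0 \<le> \<theta> k" "\<theta> k \<le> 1/2" if "k \<le> m" for k
  proof -
    show "0 \<le> \<theta> k" using D w by (simp add: \<theta>_def)
    have "real k \<le> D / (6 * w)" using that m(1) by linarith
    then show "\<theta> k \<le> 1/2" using D w by (simp add: \<theta>_def field_simps)
  qed
  have cH: "compact (H k)" for k unfolding H_def
    by (intro compact_continuous_image continuous_intros O)
  have subH: "H k \<subseteq> C" if "k \<le> m" for k
    using th[OF that] O(2) t C(1) by (auto simp: H_def intro!: convexD)
  have mH: "measure lebesgue (H k) \<ge> (1/2) ^ DIM('a) * measure lebesgue O'" if "k \<le> m" for k
  proof -
    have "measure lebesgue (H k) = \<bar>1 - \<theta> k\<bar> ^ DIM('a) * measure lebesgue O'"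
      unfolding H_def by (rule measure_lebesgue_affine)
    also have "\<dots> \<ge> (1/2) ^ DIM('a) * measure lebesgue O'"
      using th[OF that] by (intro mult_right_mono power_mono) auto
    finally show ?thesis .
  qed
  have disj: "disjnt (H i) (H j)" if ij: "i \<le> m" "j \<le> m" "i < j" for i j
  proof (rule ccontr)
    assume "\<not> disjnt (H i) (H j)"
    then obtain y where "y \<in> H i" "y \<in> H j" by (auto simp: disjnt_def)
    then obtain s s' where s: "s \<in> O'" "s' \<in> O'" "y = (1 - \<theta> i) *\<^sub>R s + \<theta> i *\<^sub>R t" "y = (1 - \<theta> j) *\<^sub>R s' + \<theta> j *\<^sub>R t"
      by (auto simp: H_def)
    have dif: "(1 - \<theta> i) *\<^sub>R (s - q) - (1 - \<theta> j) *\<^sub>R (s' - q) = (\<theta> j - \<theta> i) *\<^sub>R (t - q)"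
      using s(3,4) by (simp add: algebra_simps)
    have "(1 - \<theta> i) * (a \<bullet> (s - q)) - (1 - \<theta> j) * (a \<bullet> (s' - q)) = (\<theta> j - \<theta> i) * (a \<bullet> (t - q))"
      using arg_cong[OF dif, of "\<lambda>v. a \<bullet> v"] by (simp only: inner_diff_right[of a "_ *\<^sub>R _"] inner_scaleR_right)
    then have "\<bar>(\<theta> j - \<theta> i) * (a \<bullet> (t - q))\<bar> \<le> \<bar>(1 - \<theta> i) * (a \<bullet> (s - q))\<bar> + \<bar>(1 - \<theta> j) * (a \<bullet> (s' - q))\<bar>"
      by linarith
    also have "\<dots> \<le> 1 * w + 1 * w"
    proof -
      have "\<bar>a \<bullet> (s - q)\<bar> \<le> w" "\<bar>a \<bullet> (s' - q)\<bar> \<le> w"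
        using width[OF s(1) q] width[OF q s(1)] width[OF s(2) q] width[OF q s(2)]
        by (auto simp: abs_le_iff inner_diff_right)
      then show ?thesis unfolding abs_mult using th[of i] th[of j] ij w
        by (intro add_mono mult_mono) auto
    qed
    finally have "\<bar>\<theta> j - \<theta> i\<bar> * D \<le> 2 * w" by (simp add: abs_mult D_def)
    moreover have "(\<theta> j - \<theta> i) * D = 3 * w * (real j - real i)"
      using D by (simp add: \<theta>_def field_simps)
    moreover have "3 * w * 1 \<le> 3 * w * (real j - real i)"
      using ij w by (intro mult_left_mono) auto
    moreover have "(\<theta> j - \<theta> i) * D \<le> \<bar>\<theta> j - \<theta> i\<bar> * D" using D by (intro mult_right_mono) auto
    ultimately show False using w by linarith
  qed
  have "(real m + 1) * ((1/2) ^ DIM('a) * measure lebesgue O') \<le> (\<Sum>k\<in>{..m}. measure lebesgue (H k))"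
    using sum_mono[of "{..m}" "\<lambda>k. (1/2) ^ DIM('a) * measure lebesgue O'" "\<lambda>k. measure lebesgue (H k)"] mH
    by (simp add: add.commute)
  also have "\<dots> = measure lebesgue (\<Union>k\<in>{..m}. H k)"
  proof (rule measure_UNION'[symmetric])
    show "pairwise (\<lambda>i j. disjnt (H i) (H j)) {..m}"
      unfolding pairwise_def using disj by (metis atMost_iff disjnt_sym linorder_neqE_nat)
  qed (auto simp: cH lmeasurable_compact)
  also have "\<dots> \<le> measure lebesgue C"
    using subH C cH by (intro measure_mono_fmeasurable) (auto intro!: sets.finite_UN fmeasurableD lmeasurable_compact)
  finally have *: "(real m + 1) * ((1/2) ^ DIM('a) * measure lebesgue O') \<le> measure lebesgue C" .
  have "D / (6 * w) * ((1/2) ^ DIM('a) * measure lebesgue O') \<le> (real m + 1) * ((1/2) ^ DIM('a) * measure lebesgue O')"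
    using m(2) by (intro mult_right_mono) auto
  with * have "D / (6 * w) * ((1/2) ^ DIM('a) * measure lebesgue O') \<le> measure lebesgue C" by linarith
  then have "D * measure lebesgue O' \<le> 6 * 2 ^ DIM('a) * w * measure lebesgue C"
    using w by (simp add: field_simps)
  then show ?thesis by (simp add: D_def)
qed

text \<open>Integrate the function that counts the sets containing a given point.\<close>

lemma sum_measure_le_overlap:
  assumes I: "finite I" and D: "\<And>i. i \<in> I \<Longrightarrow> D i \<in> fmeasurable M" "\<And>i. i \<in> I \<Longrightarrow> D i \<subseteq> Z"
    and Z: "Z \<in> fmeasurable M" and K: "\<And>s. s \<in> Z \<Longrightarrow> real (card {i\<in>I. s \<in> D i}) \<le> K"
  shows "(\<Sum>i\<in>I. measure M (D i)) \<le> K * measure M Z"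
proof -
  have int: "integrable M (indicator (D i) :: _ \<Rightarrow> real)" if "i \<in> I" for i
    using D(1)[OF that] by (simp add: integrable_indicator_iff fmeasurable_def)
  have intZ: "integrable M (indicator Z :: _ \<Rightarrow> real)"
    using Z by (simp add: integrable_indicator_iff fmeasurable_def)
  have "(\<Sum>i\<in>I. measure M (D i)) = (\<Sum>i\<in>I. integral\<^sup>L M (indicator (D i)))"
    using D(1) fmeasurableD sets.sets_into_space by (intro sum.cong) (auto simp: Int_absorb2)
  also have "\<dots> = integral\<^sup>L M (\<lambda>s. \<Sum>i\<in>I. indicator (D i) s)"
    using int by (subst Bochner_Integration.integral_sum) auto
  also have "\<dots> \<le> integral\<^sup>L M (\<lambda>s. K * indicator Z s)"
  proof (rule integral_mono)
    fix s
    have "(\<Sum>i\<in>I. indicator (D i) s :: real) = real (card {i\<in>I. s \<in> D i})"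
      using I by (simp add: indicator_def sum.If_cases Int_def)
    also have "\<dots> \<le> K * indicator Z s"
    proof (cases "s \<in> Z")
      case False
      then have *: "{i\<in>I. s \<in> D i} = {}" using D(2) by blast
      show ?thesis unfolding * using False by simp
    qed (use K in auto)
    finally show "(\<Sum>i\<in>I. indicator (D i) s :: real) \<le> K * indicator Z s" .
  qed (use int intZ in auto)
  also have "\<dots> = K * measure M Z"
    using Z fmeasurableD sets.sets_into_space by (auto simp: Int_absorb2)
  finally show ?thesis .
qed

text \<open>Add the sets one at a time: each new one meets the union of the earlier ones in measure
  at most \<open>card X * k\<close>, so it contributes at least \<open>c / 2\<close>.\<close>

lemma card_le_of_small_overlaps:
  assumes X: "finite X" and P: "\<And>x. x \<in> X \<Longrightarrow> P x \<in> fmeasurable M" "\<And>x. x \<in> X \<Longrightarrow> P x \<subseteq> Z"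
    and Z: "Z \<in> fmeasurable M" and c: "\<And>x. x \<in> X \<Longrightarrow> c \<le> measure M (P x)"
    and ov: "\<And>x y. x \<in> X \<Longrightarrow> y \<in> X \<Longrightarrow> x \<noteq> y \<Longrightarrow> measure M (P x \<inter> P y) \<le> k"
    and k: "0 \<le> k" "real (card X) * k \<le> c / 2"
  shows "real (card X) * (c / 2) \<le> measure M Z"
proof -
  have "real (card F) * (c / 2) \<le> measure M (\<Union>x\<in>F. P x)" if "F \<subseteq> X" for F
    using finite_subset[OF that X] that
  proof (induction F rule: finite_induct)
    case (insert y F)
    let ?U = "\<Union>x\<in>F. P x"
    have U: "?U \<in> fmeasurable M" using insert P by (intro fmeasurable.finite_UN) auto
    have y: "P y \<in> fmeasurable M" using insert P by auto
    have "measure M (P y \<inter> ?U) \<le> (\<Sum>x\<in>F. measure M (P y \<inter> P x))"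
    proof -
      have "P y \<inter> ?U = (\<Union>x\<in>F. P y \<inter> P x)" by blast
      moreover have "P y \<inter> P x \<in> sets M" if "x \<in> F" for x
        using insert.prems P(1)[of x] P(1)[of y] that by blast
      ultimately show ?thesis using measure_UNION_le[OF insert.hyps(1), of "\<lambda>x. P y \<inter> P x" M] by metis
    qed
    also have "\<dots> \<le> (\<Sum>x\<in>F. k)" using insert by (intro sum_mono ov) auto
    also have "\<dots> \<le> real (card X) * k"
      using k(1) insert X by (auto intro!: mult_right_mono card_mono)
    also have "\<dots> \<le> c / 2" by (rule k)
    finally have *: "measure M (P y \<inter> ?U) \<le> c / 2" .
    have "measure M (P y \<union> ?U) = measure M (P y) + measure M ?U - measure M (P y \<inter> ?U)"
      using y U by (simp add: measure_Un3)
    then have "measure M (P y \<union> ?U) \<ge> c / 2 + real (card F) * (c / 2)"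
      using * c[of y] insert by auto
    then show ?case using insert by (simp add: algebra_simps)
  qed simp
  from this[of X] have "real (card X) * (c / 2) \<le> measure M (\<Union>x\<in>X. P x)" by simp
  also have "\<dots> \<le> measure M Z"
    using P Z X by (intro measure_mono_fmeasurable) auto
  finally show ?thesis .
qed

text \<open>A family of largest cardinality cannot be extended. The relation is distance for
  separated points, and small overlap for polar bodies.\<close>

lemma maximal_pairwise_subset:
  assumes sym: "\<And>x y. R x y \<Longrightarrow> R y x"
    and bd: "\<And>T. finite T \<Longrightarrow> T \<subseteq> E \<Longrightarrow> pairwise R T \<Longrightarrow> card T \<le> N"
  obtains T where "finite T" "T \<subseteq> E" "pairwise R T" "\<And>x. x \<in> E \<Longrightarrow> x \<in> T \<or> (\<exists>t\<in>T. \<not> R t x)"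
proof -
  define Q where "Q k \<longleftrightarrow> (\<exists>T. finite T \<and> T \<subseteq> E \<and> pairwise R T \<and> card T = k)" for k
  have "Q 0" unfolding Q_def by (intro exI[of _ "{}"]) auto
  moreover have "\<forall>k. Q k \<longrightarrow> k < Suc N" using bd by (auto simp: Q_def less_Suc_eq_le)
  ultimately have "\<exists>k. Q k \<and> (\<forall>l. Q l \<longrightarrow> l \<le> k)"
    by (rule ex_has_greatest_nat[of Q 0 "\<lambda>k. k"])
  then obtain k where k: "Q k" "\<And>l. Q l \<Longrightarrow> l \<le> k" by blast
  then obtain T where T: "finite T" "T \<subseteq> E" "pairwise R T" "card T = k" by (auto simp: Q_def)
  have "x \<in> T \<or> (\<exists>t\<in>T. \<not> R t x)" if "x \<in> E" for x
  proof (rule ccontr)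
    assume a: "\<not> ?thesis"
    then have "pairwise R (insert x T)" using T(3) sym by (auto simp: pairwise_insert)
    then have "Q (Suc k)" unfolding Q_def using T a that by (intro exI[of _ "insert x T"]) auto
    then show False using k(2) by fastforce
  qed
  then show ?thesis using that T by blast
qed

lemma packing_bound:
  fixes T :: "'a::euclidean_space set"
  assumes T: "finite T" "pairwise (\<lambda>x y. dist x y \<ge> d) T" and d: "d > 0"
    and Z: "Z \<in> lmeasurable" "\<And>t. t \<in> T \<Longrightarrow> ball t (d/2) \<subseteq> Z"
  shows "real (card T) * (unit_ball_vol DIM('a) * (d/2) ^ DIM('a)) \<le> measure lebesgue Z"
proof -
  have "real (card T) * (unit_ball_vol DIM('a) * (d/2) ^ DIM('a)) = (\<Sum>t\<in>T. measure lebesgue (ball t (d/2)))"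
    using d by (simp add: content_ball)
  also have "\<dots> = measure lebesgue (\<Union>t\<in>T. ball t (d/2))"
  proof (rule measure_UNION'[symmetric])
    show "pairwise (\<lambda>i j. disjnt (ball i (d/2)) (ball j (d/2))) T"
    proof (rule pairwiseI)
      fix x y assume "x \<in> T" "y \<in> T" "x \<noteq> y"
      then have "dist x y \<ge> d" using T by (auto simp: pairwise_def)
      then show "disjnt (ball x (d/2)) (ball y (d/2))"
        by (simp add: disjnt_def disjoint_ballI)
    qed
  qed (use T in auto)
  also have "\<dots> \<le> measure lebesgue Z"
    using Z T by (intro measure_mono_fmeasurable) (auto intro!: sets.finite_UN)
  finally show ?thesis .
qed

lemma maximal_separated_subset:
  fixes E :: "'a::euclidean_space set"
  assumes E: "bounded E" and d: "d > 0"
  obtains T where "finite T" "T \<subseteq> E" "pairwise (\<lambda>x y. dist x y \<ge> d) T" "E \<subseteq> (\<Union>t\<in>T. cball t d)"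
proof -
  obtain b where b: "\<And>x. x \<in> E \<Longrightarrow> norm x \<le> b" using E bounded_iff by metis
  let ?Z = "cball 0 (b + d) :: 'a set"
  let ?u = "unit_ball_vol DIM('a) * (d/2) ^ DIM('a)"
  have u: "?u > 0" using d by simp
  have "card T \<le> nat \<lfloor>measure lebesgue ?Z / ?u\<rfloor>"
    if T: "finite T" "T \<subseteq> E" "pairwise (\<lambda>x y. dist x y \<ge> d) T" for T
  proof -
    have "ball t (d/2) \<subseteq> ?Z" if "t \<in> T" for t
    proof
      fix y assume "y \<in> ball t (d/2)"
      then have "norm (y - t) < d / 2" by (simp add: dist_norm norm_minus_commute)
      moreover have "norm t \<le> b" using b T(2) that by blast
      moreover have "norm y \<le> norm t + norm (y - t)" by (metis add.commute diff_add_cancel norm_triangle_ineq)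
      ultimately show "y \<in> ?Z" using d by simp
    qed
    then have "real (card T) * ?u \<le> measure lebesgue ?Z"
      by (intro packing_bound[OF T(1,3) d lmeasurable_cball])
    then have "real (card T) \<le> measure lebesgue ?Z / ?u" using u by (simp only: pos_le_divide_eq)
    then show ?thesis by (simp add: le_nat_floor)
  qed
  then obtain T where T: "finite T" "T \<subseteq> E" "pairwise (\<lambda>x y. dist x y \<ge> d) T"
      "\<And>x. x \<in> E \<Longrightarrow> x \<in> T \<or> (\<exists>t\<in>T. \<not> dist t x \<ge> d)"
    by (rule maximal_pairwise_subset[of "\<lambda>x y. dist x y \<ge> d" E, rotated]) (auto simp: dist_commute)
  then have "E \<subseteq> (\<Union>t\<in>T. cball t d)" using d by fastforce
  then show ?thesis using that T by blast
qed

text \<open>The balls of radius d/2 about points \<open>t\<close> of \<open>S\<close> lie in 2S - z,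
  because the midpoint of \<open>t\<close> and \<open>z + (y - t)\<close> is (y + z)/2. This
  dilation costs one factor 2^n, the halved radius the other.\<close>

lemma convex_cover_by_balls:
  fixes S :: "'a::euclidean_space set"
  assumes S: "compact S" "convex S" and d: "d > 0" "cball z d \<subseteq> S"
  obtains T where "finite T" "S \<subseteq> (\<Union>t\<in>T. cball t d)"
    "real (card T) * (unit_ball_vol DIM('a) * d ^ DIM('a)) \<le> 4 ^ DIM('a) * measure lebesgue S"
proof -
  obtain T where T: "finite T" "T \<subseteq> S" "pairwise (\<lambda>x y. dist x y \<ge> d) T" "S \<subseteq> (\<Union>t\<in>T. cball t d)"
    using maximal_separated_subset[OF compact_imp_bounded[OF S(1)] d(1)] by blast
  let ?Z = "(\<lambda>y. 2 *\<^sub>R y + (- z)) ` S"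
  have "compact ?Z" by (intro compact_continuous_image continuous_intros S)
  then have Z: "?Z \<in> lmeasurable" by (rule lmeasurable_compact)
  have "ball t (d/2) \<subseteq> ?Z" if "t \<in> T" for t
  proof
    fix y assume y: "y \<in> ball t (d/2)"
    have "z + (y - t) \<in> S" using y d by (auto simp: subset_iff dist_norm norm_minus_commute)
    then have "(1/2) *\<^sub>R t + (1/2) *\<^sub>R (z + (y - t)) \<in> S"
      using S(2) T(2) that by (intro convexD) auto
    moreover have "y = 2 *\<^sub>R ((1/2) *\<^sub>R t + (1/2) *\<^sub>R (z + (y - t))) + (- z)"
      by (simp add: algebra_simps)
    ultimately show "y \<in> ?Z" by blast
  qed
  then have "real (card T) * (unit_ball_vol DIM('a) * (d/2) ^ DIM('a)) \<le> measure lebesgue ?Z"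
    using packing_bound[OF T(1,3) d(1) Z] by blast
  also have "measure lebesgue ?Z = 2 ^ DIM('a) * measure lebesgue S"
    using measure_lebesgue_affine[of 2 "-z" S] by simp
  finally have "real (card T) * (unit_ball_vol DIM('a) * d ^ DIM('a)) \<le> 2 ^ DIM('a) * (2 ^ DIM('a) * measure lebesgue S)"
    by (simp add: power_divide field_simps)
  also have "\<dots> = 4 ^ DIM('a) * measure lebesgue S"
    by (simp flip: power_mult_distrib mult.assoc)
  finally show ?thesis using that T by blast
qed

section \<open>Subadditivity of Hausdorff premeasures\<close>

lemma hausdorff_const_pos: "hausdorff_const s > 0"
  by (simp add: hausdorff_const_def Gamma_real_pos)

lemma hausdorff_pre_mono: "E \<subseteq> E' \<Longrightarrow> hausdorff_pre s \<delta> E \<le> hausdorff_pre s \<delta> E'"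
  unfolding hausdorff_pre_def by (rule INF_superset_mono) auto

lemma hausdorff_pre_UN_le:
  fixes E :: "nat \<Rightarrow> 'a::metric_space set"
  shows "hausdorff_pre s \<delta> (\<Union>i. E i) \<le> (\<Sum>i. hausdorff_pre s \<delta> (E i))"
proof (rule ennreal_le_epsilon)
  fix e :: real assume fin: "(\<Sum>i. hausdorff_pre s \<delta> (E i)) < top" and e: "0 < e"
  let ?cov = "\<lambda>E. {C :: nat \<Rightarrow> 'a set. E \<subseteq> (\<Union>i. C i) \<and> (\<forall>i. bounded (C i) \<and> diameter (C i) \<le> \<delta>)}"
  let ?g = "\<lambda>A::'a set. if A = {} then 0 else ennreal (hausdorff_const s * (diameter A / 2) ^ s)"
  have ex: "\<exists>C. C \<in> ?cov (E i) \<and> (\<Sum>k. ?g (C k)) \<le> hausdorff_pre s \<delta> (E i) + ennreal (e * (1/2) ^ Suc i)" for i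
  proof -
    have "hausdorff_pre s \<delta> (E i) < top"
      using fin ennreal_suminf_lessD by blast
    then obtain r where r: "0 \<le> r" "hausdorff_pre s \<delta> (E i) = ennreal r"
      by (cases "hausdorff_pre s \<delta> (E i)") auto
    have "0 < e * (1/2) ^ Suc i" using e by simp
    then have "hausdorff_pre s \<delta> (E i) < hausdorff_pre s \<delta> (E i) + ennreal (e * (1/2) ^ Suc i)"
      unfolding r(2) using r(1) by (subst ennreal_plus[symmetric]) (auto intro!: ennreal_lessI simp del: power_Suc)
    then have "\<exists>C\<in>?cov (E i). (\<Sum>k. ?g (C k)) < hausdorff_pre s \<delta> (E i) + ennreal (e * (1/2) ^ Suc i)"
      unfolding hausdorff_pre_def by (subst (asm) INF_less_iff) auto
    then show ?thesis by (meson less_imp_le)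
  qed
  define C where "C i = (SOME C. C \<in> ?cov (E i) \<and>
    (\<Sum>k. ?g (C k)) \<le> hausdorff_pre s \<delta> (E i) + ennreal (e * (1/2) ^ Suc i))" for i
  have C: "C i \<in> ?cov (E i)" "(\<Sum>k. ?g (C i k)) \<le> hausdorff_pre s \<delta> (E i) + ennreal (e * (1/2) ^ Suc i)" for i
    using someI_ex[OF ex[of i]] unfolding C_def by (simp_all only:)
  define B where "B n = (case prod_decode n of (i, k) \<Rightarrow> C i k)" for n
  have "(\<Union>i. E i) \<subseteq> (\<Union>n. B n)"
  proof clarify
    fix x i assume "x \<in> E i"
    then obtain k where "x \<in> C i k" using C(1)[of i] by blast
    then show "x \<in> (\<Union>n. B n)" by (intro UN_I[of "prod_encode (i, k)"]) (auto simp: B_def)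
  qed
  moreover have "bounded (B n) \<and> diameter (B n) \<le> \<delta>" for n
    using C(1) by (auto simp: B_def split: prod.split)
  ultimately have "B \<in> ?cov (\<Union>i. E i)" by blast
  then have "hausdorff_pre s \<delta> (\<Union>i. E i) \<le> (\<Sum>n. ?g (B n))"
    unfolding hausdorff_pre_def by (intro INF_lower2[of B]) auto
  also have "(\<Sum>n. ?g (B n)) = (\<Sum>i. \<Sum>k. ?g (C i k))"
  proof -
    have "(\<Sum>n. (\<lambda>(i,k). ?g (C i k)) (prod_decode n)) = (\<Sum>i. \<Sum>k. ?g (C i k))"
      by (rule suminf_ennreal_2dimen) simp
    then show ?thesis unfolding B_def case_prod_unfold .
  qed
  also have "\<dots> \<le> (\<Sum>i. hausdorff_pre s \<delta> (E i) + ennreal (e * (1/2) ^ Suc i))"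
    by (intro suminf_le C(2)) auto
  also have "\<dots> = (\<Sum>i. hausdorff_pre s \<delta> (E i)) + (\<Sum>i. ennreal (e * (1/2) ^ Suc i))"
    by (rule suminf_add[symmetric]) auto
  also have "(\<Sum>i. ennreal (e * (1/2) ^ Suc i)) = ennreal e"
    using power_half_series e by (intro suminf_ennreal_eq) (auto dest: sums_mult[of _ 1 e])
  finally show "hausdorff_pre s \<delta> (\<Union>i. E i) \<le> (\<Sum>i. hausdorff_pre s \<delta> (E i)) + ennreal e" .
qed

lemma hausdorff_pre_empty: "\<delta> > 0 \<Longrightarrow> hausdorff_pre s \<delta> {} = 0"
proof -
  assume "\<delta> > 0"
  then have "hausdorff_pre s \<delta> ({} :: 'a set) \<le> (\<Sum>i::nat. (if ({}::'a set) = {} then 0 else ennreal (hausdorff_const s * (diameter ({}::'a set) / 2) ^ s)))"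
    unfolding hausdorff_pre_def by (intro INF_lower) auto
  then show ?thesis by simp
qed

lemma hausdorff_pre_finite_UN_le:
  assumes "finite T" "\<delta> > 0"
  shows "hausdorff_pre s \<delta> (\<Union>t\<in>T. E t) \<le> (\<Sum>t\<in>T. hausdorff_pre s \<delta> (E t))"
proof -
  obtain f :: "nat \<Rightarrow> _" where f: "bij_betw f {..<card T} T"
    using ex_bij_betw_nat_finite[OF assms(1)] atLeast0LessThan by auto
  let ?E = "\<lambda>i. if i < card T then E (f i) else {}"
  have eq: "(\<Union>t\<in>T. E t) = (\<Union>i. ?E i)"
  proof -
    have "(\<Union>t\<in>T. E t) = (\<Union>i\<in>{..<card T}. E (f i))"
      by (metis (no_types) bij_betw_imp_surj_on[OF f] image_image)
    then show ?thesis by (auto split: if_splits)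
  qed
  have "hausdorff_pre s \<delta> (\<Union>i. ?E i) \<le> (\<Sum>i. hausdorff_pre s \<delta> (?E i))" by (rule hausdorff_pre_UN_le)
  also have "\<dots> = (\<Sum>i<card T. hausdorff_pre s \<delta> (?E i))"
    by (rule suminf_finite) (auto simp: hausdorff_pre_empty assms)
  also have "\<dots> = (\<Sum>i<card T. hausdorff_pre s \<delta> (E (f i)))" by simp
  also have "\<dots> = (\<Sum>t\<in>T. hausdorff_pre s \<delta> (E t))"
    using f by (rule sum.reindex_bij_betw)
  finally show ?thesis by (simp add: eq)
qed

lemma hausdorff_pre_cball_le:
  fixes t :: "'a::euclidean_space"
  assumes "d > 0" "2 * d \<le> \<delta>"
  shows "hausdorff_pre s \<delta> (cball t d) \<le> ennreal (hausdorff_const s * d ^ s)"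
proof -
  let ?C = "\<lambda>i::nat. if i = 0 then cball t d else {}"
  have "hausdorff_pre s \<delta> (cball t d) \<le> (\<Sum>i. (if ?C i = {} then 0 else ennreal (hausdorff_const s * (diameter (?C i) / 2) ^ s)))"
    unfolding hausdorff_pre_def using assms by (intro INF_lower) (auto split: if_splits)
  also have "\<dots> = (\<Sum>i\<in>{0}. (if ?C i = {} then 0 else ennreal (hausdorff_const s * (diameter (?C i) / 2) ^ s)))"
    by (rule suminf_finite) auto
  also have "\<dots> = ennreal (hausdorff_const s * d ^ s)" using assms by simp
  finally show ?thesis .
qed

section \<open>Sections of strongly convex perturbations\<close>

text \<open>For \<open>v z = u z + |z|\<^sup>2/2\<close> this is \<open>v z - v x - (p + x) \<bullet> (z - x)\<close>; its sublevel sets are the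
  sections of \<open>v\<close> at \<open>x\<close> with slope \<open>p + x\<close>.\<close>
definition bregman :: "('a::euclidean_space \<Rightarrow> real) \<Rightarrow> 'a \<Rightarrow> 'a \<Rightarrow> 'a \<Rightarrow> real" where
  "bregman u x p z = u z - u x - p \<bullet> (z - x) + (norm (z - x))\<^sup>2 / 2"

locale convex_on_unit_ball =
  fixes u :: "'a::euclidean_space \<Rightarrow> real" and \<rho> :: real
  assumes convex_u: "convex_on (ball 0 1) u" and \<rho>: "0 < \<rho>" "\<rho> < 1"
begin

abbreviation sub :: "'a \<Rightarrow> 'a set" where "sub x \<equiv> subgradient (ball 0 1) u x"

lemma cball_subset: "cball 0 \<rho> \<subseteq> ball 0 1"
  using \<rho> by auto

lemma cball_ballD: "y \<in> cball 0 \<rho> \<Longrightarrow> y \<in> ball 0 1"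
  using cball_subset by blast

section \<open>Subgradients over a smaller closed ball\<close>

lemma subD: "p \<in> sub x \<Longrightarrow> y \<in> ball 0 1 \<Longrightarrow> u y \<ge> u x + p \<bullet> (y - x)"
  by (auto simp: subgradient_def)

lemma continuous_u: "continuous_on (ball 0 1) u"
  using convex_u by (intro convex_on_continuous) auto

lemma continuous_u': "S \<subseteq> ball 0 1 \<Longrightarrow> continuous_on S u"
  using continuous_u continuous_on_subset by blast

lemma sub_nonempty:
  assumes x: "x \<in> ball 0 1"
  shows "sub x \<noteq> {}"
proof -
  let ?E = "epigraph (ball 0 1) u"
  have "\<exists>a b. (a, b) \<noteq> (0, 0) \<and> (\<forall>(y, t)\<in>?E. a \<bullet> x + b * u x \<le> a \<bullet> y + b * t)"
  proof -
    \<comment> \<open>The strict epigraph omits the point \<open>(x, u x)\<close>, so the two can be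
      separated; letting the extra height tend to 0 recovers the full epigraph.\<close>
    let ?S = "{(y, t). y \<in> ball 0 1 \<and> u y < t}"
    have S: "convex ?S"
    proof (rule convexI)
      fix v w :: "'a \<times> real" and c d :: real
      assume vw: "v \<in> ?S" "w \<in> ?S" and cd: "0 \<le> c" "0 \<le> d" "c + d = 1"
      obtain y1 t1 y2 t2 where [simp]: "v = (y1, t1)" "w = (y2, t2)" by (cases v, cases w)
      have h: "y1 \<in> ball 0 1" "u y1 < t1" "y2 \<in> ball 0 1" "u y2 < t2" "0 \<le> c" "0 \<le> d" "c + d = 1"
        using vw cd by auto
      have "c *\<^sub>R y1 + d *\<^sub>R y2 \<in> ball 0 1"
        using h convexD[OF convex_ball, of y1 0 1 y2 c d] by blast
      moreover have "u (c *\<^sub>R y1 + d *\<^sub>R y2) \<le> c * u y1 + d * u y2"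
        using convex_u h unfolding convex_on_def by blast
      moreover have "c * u y1 + d * u y2 < c * t1 + d * t2"
      proof (cases "c = 0")
        case False
        then have "c * u y1 < c * t1" using h by simp
        moreover have "d * u y2 \<le> d * t2" using h by (intro mult_left_mono) auto
        ultimately show ?thesis by linarith
      qed (use h in auto)
      ultimately show "c *\<^sub>R v + d *\<^sub>R w \<in> ?S" by auto
    qed
    have "(x, u x) \<notin> ?S" by auto
    moreover have "?S \<noteq> {}" using x by (auto intro!: exI[of _ x] exI[of _ "u x + 1"])
    ultimately obtain ab where ab: "ab \<noteq> 0" "\<forall>v\<in>?S. ab \<bullet> (x, u x) \<le> ab \<bullet> v"
      using separating_hyperplane_sets[of "{(x, u x)}" ?S] S
      by (metis (no_types, lifting) Int_insert_left_if0 Int_empty_left convex_singleton insert_not_empty inner_commute singletonI order.trans)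
    obtain a b where [simp]: "ab = (a, b)" by (cases ab)
    have "a \<bullet> x + b * u x \<le> a \<bullet> y + b * t" if "(y, t) \<in> ?E" for y t
    proof (rule field_le_epsilon)
      fix e :: real assume e: "e > 0"
      define d where "d = e / (\<bar>b\<bar> + 1)"
      have d: "d > 0" using e by (simp add: d_def add_nonneg_pos)
      have "(y, t + d) \<in> ?S" using that d by (auto simp: epigraph_def)
      then have "a \<bullet> x + b * u x \<le> a \<bullet> y + b * (t + d)" using ab by fastforce
      moreover have "b * d \<le> e"
      proof -
        have "b * d \<le> (\<bar>b\<bar> + 1) * d" using d by (intro mult_right_mono) auto
        also have "\<dots> = e" by (simp add: d_def add_nonneg_eq_0_iff)
        finally show ?thesis .
      qed
      ultimately show "a \<bullet> x + b * u x \<le> a \<bullet> y + b * t + e" by (simp add: algebra_simps)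
    qed
    then show ?thesis using ab by (intro exI[of _ a] exI[of _ b]) (auto simp: zero_prod_def)
  qed
  then obtain a b where ab0: "(a, b) \<noteq> (0, 0)" "\<forall>(y, t)\<in>?E. a \<bullet> x + b * u x \<le> a \<bullet> y + b * t"
    by blast
  have ab: "(a, b) \<noteq> (0, 0)"
    "\<And>y t. y \<in> ball 0 1 \<Longrightarrow> u y \<le> t \<Longrightarrow> a \<bullet> x + b * u x \<le> a \<bullet> y + b * t"
    using ab0 by (auto simp: epigraph_def)
  have "b \<ge> 0" using ab(2)[of x "u x + 1"] x by (simp add: algebra_simps)
  moreover have "b \<noteq> 0"
  proof
    assume b: "b = 0"
    then have a: "a \<noteq> 0" using ab by simp
    \<comment> \<open>A vertical hyperplane is crossed by moving from \<open>x\<close> against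
      \<open>a\<close>, here by half the distance to the sphere.\<close>
    define y where "y = x - ((1 - norm x) / 2 / norm a) *\<^sub>R a"
    have "norm y \<le> norm x + (1 - norm x) / 2"
      unfolding y_def using x a norm_triangle_ineq4[of x "((1 - norm x) / 2 / norm a) *\<^sub>R a"] by simp
    moreover have "norm x < 1" using x by simp
    ultimately have "norm y < 1" by argo
    then have "y \<in> ball 0 1" by simp
    then have "a \<bullet> x \<le> a \<bullet> y" using ab(2)[of y "u y"] b by simp
    moreover have "a \<bullet> y = a \<bullet> x - (1 - norm x) / 2 * norm a"
      using a by (simp add: y_def inner_diff_right dot_square_norm power2_eq_square)
    moreover have "(1 - norm x) / 2 * norm a > 0" using x a by simp
    ultimately show False by linarith
  qed
  ultimately have b: "b > 0" by simp
  have "- (1/b) *\<^sub>R a \<in> sub x"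
  proof -
    have "u x + (- (1/b) *\<^sub>R a) \<bullet> (y - x) \<le> u y" if "y \<in> ball 0 1" for y
      using ab(2)[OF that order_refl] b by (simp add: field_simps inner_diff_right)
    then show ?thesis by (auto simp: subgradient_def)
  qed
  then show ?thesis by blast
qed

text \<open>A step of length \<open>d\<close> from \<open>x\<close> in the direction of
  \<open>p\<close> raises \<open>u\<close> by at least \<open>d * norm p\<close>, while
  \<open>u\<close> is bounded on the ball of radius \<open>\<rho> + d\<close>.\<close>

lemma sub_bounded: "\<exists>L. \<forall>x\<in>cball 0 \<rho>. \<forall>p\<in>sub x. norm p \<le> L"
proof -
  define d where "d = (1 - \<rho>) / 2"
  have d: "d > 0" "\<rho> + d < 1" using \<rho> by (auto simp: d_def field_simps)
  have "compact (cball (0::'a) (\<rho> + d))" by simp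
  moreover have "continuous_on (cball 0 (\<rho> + d)) u" using d by (intro continuous_u') auto
  ultimately have "bounded (u ` cball 0 (\<rho> + d))" using compact_continuous_image compact_imp_bounded by blast
  then have "\<exists>M. \<forall>y\<in>cball 0 (\<rho> + d). \<bar>u y\<bar> \<le> M" by (auto simp: bounded_iff)
  then obtain M where M: "\<And>y. y \<in> cball 0 (\<rho> + d) \<Longrightarrow> \<bar>u y\<bar> \<le> M" by blast
  have "norm p \<le> 2 * M / d" if x: "x \<in> cball 0 \<rho>" and p: "p \<in> sub x" for x p
  proof (cases "p = 0")
    case True
    have "\<bar>u 0\<bar> \<le> M" using d \<rho> by (intro M) simp
    then have "M \<ge> 0" by linarith
    then show ?thesis using True d by simp
  next
    case False
    define y where "y = x + (d / norm p) *\<^sub>R p"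
    have "norm y \<le> norm x + d" unfolding y_def using norm_triangle_ineq[of x "(d / norm p) *\<^sub>R p"] False d by simp
    then have y: "y \<in> cball 0 (\<rho> + d)" using x by simp
    then have "u y \<ge> u x + p \<bullet> (y - x)" using subD[OF p, of y] d by simp
    moreover have "p \<bullet> (y - x) = d * norm p" using False by (simp add: y_def dot_square_norm power2_eq_square)
    moreover have "x \<in> cball 0 (\<rho> + d)" using x d by simp
    ultimately have "d * norm p \<le> 2 * M" using M[of x] M[of y] y by (simp add: abs_le_iff)
    then show ?thesis using d by (simp add: field_simps)
  qed
  then show ?thesis by blast
qed

definition graph :: "('a \<times> 'a) set" where
  "graph = {(x, p). x \<in> cball 0 \<rho> \<and> p \<in> sub x}"

text \<open>For each fixed \<open>y\<close> the subgradient inequality is closed in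
  \<open>(x, p)\<close>, and the slopes over the ball are bounded. Measurability of
  \<open>vimg\<close>, subgradients of maximal norm and the limits of pairs \<open>(x, p)\<close>
  all rest on this.\<close>

lemma compact_graph: "compact graph"
proof -
  obtain L where L: "\<And>x p. x \<in> cball 0 \<rho> \<Longrightarrow> p \<in> sub x \<Longrightarrow> norm p \<le> L" using sub_bounded by blast
  let ?K = "cball 0 \<rho> \<times> cball 0 L :: ('a \<times> 'a) set"
  have K: "compact ?K" by (intro compact_Times compact_cball)
  have "closed {z \<in> ?K. u (fst z) + snd z \<bullet> (y - fst z) \<le> u y}" for y
  proof (intro continuous_on_closed_Collect_le)
    show "continuous_on ?K (\<lambda>z. u (fst z) + snd z \<bullet> (y - fst z))"
      by (intro continuous_intros continuous_on_compose2[OF continuous_u]) (use cball_subset in auto)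
  qed (use K compact_imp_closed in auto)
  then have "closed (\<Inter>y\<in>ball 0 1. {z \<in> ?K. u (fst z) + snd z \<bullet> (y - fst z) \<le> u y})"
    by (intro closed_INT) auto
  then have "compact (?K \<inter> (\<Inter>y\<in>ball 0 1. {z \<in> ?K. u (fst z) + snd z \<bullet> (y - fst z) \<le> u y}))"
    by (rule compact_Int_closed[OF K])
  also have "?K \<inter> (\<Inter>y\<in>ball 0 1. {z \<in> ?K. u (fst z) + snd z \<bullet> (y - fst z) \<le> u y}) = graph"
    using L by (auto simp: graph_def subgradient_def)
  finally show ?thesis .
qed

text \<open>The subgradient image of \<open>K\<close> under \<open>v z = u z + |z|\<^sup>2/2\<close>.\<close>
definition vimg :: "'a set \<Rightarrow> 'a set" where
  "vimg K = {s. \<exists>y\<in>K. s - y \<in> sub y}"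

lemma vimg_mono: "K \<subseteq> K' \<Longrightarrow> vimg K \<subseteq> vimg K'"
  by (auto simp: vimg_def)

lemma compact_vimg:
  assumes "closed K" "K \<subseteq> cball 0 \<rho>"
  shows "compact (vimg K)"
proof -
  have "vimg K = (\<lambda>(x, p). x + p) ` (graph \<inter> K \<times> UNIV)"
    using assms by (force simp: vimg_def graph_def image_iff)
  moreover have "compact (graph \<inter> K \<times> UNIV)"
    using assms by (intro compact_Int_closed compact_graph closed_Times) auto
  ultimately show ?thesis
    by (auto simp: case_prod_unfold intro!: compact_continuous_image continuous_intros)
qed

lemma vimg_lmeasurable: "closed K \<Longrightarrow> K \<subseteq> cball 0 \<rho> \<Longrightarrow> vimg K \<in> lmeasurable"
  using compact_vimg lmeasurable_compact by blast

lemma sub_monotone: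
  assumes "x \<in> ball 0 1" "x' \<in> ball 0 1" "p \<in> sub x" "p' \<in> sub x'"
  shows "(p - p') \<bullet> (x - x') \<ge> 0"
  using subD[OF assms(3,2)] subD[OF assms(4,1)] by (simp add: inner_diff_left inner_diff_right)

text \<open>The quadratic term makes the subdifferential of \<open>v\<close> strongly monotone, so a
  slope determines its point. Overlaps of images can therefore be counted as overlaps of
  sets.\<close>

lemma vimg_unique:
  assumes "y \<in> ball 0 1" "y' \<in> ball 0 1" "s - y \<in> sub y" "s - y' \<in> sub y'"
  shows "y = y'"
proof -
  have "((s - y) - (s - y')) \<bullet> (y - y') \<ge> 0" using sub_monotone assms by blast
  moreover have "((s - y) - (s - y')) \<bullet> (y - y') = - ((y - y') \<bullet> (y - y'))"
    by (simp add: inner_diff_left inner_diff_right)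
  ultimately have "(y - y') \<bullet> (y - y') \<le> 0" by linarith
  then have "(y - y') \<bullet> (y - y') = 0" using inner_ge_zero[of "y - y'"] by linarith
  then show ?thesis by simp
qed

text \<open>Indexed by radius instead of height: the height is r^2/2, for which the quadratic term
  keeps the section inside \<open>cball x r\<close>.\<close>

definition sect :: "'a \<Rightarrow> 'a \<Rightarrow> real \<Rightarrow> 'a set" where
  "sect x p r = {z \<in> cball 0 \<rho>. bregman u x p z \<le> r\<^sup>2 / 2}"

text \<open>The symmetric polar of the section about \<open>x\<close>, scaled by r^2/4 and moved to
  the slope \<open>p + x\<close> of \<open>v\<close>. Using half of the height leaves room for
  contact points to stay below the top level of the section.\<close>

definition dual_sect :: "'a \<Rightarrow> 'a \<Rightarrow> real \<Rightarrow> 'a set" where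
  "dual_sect x p r = {s. \<forall>z\<in>sect x p r. \<bar>(s - (p + x)) \<bullet> (z - x)\<bar> \<le> r\<^sup>2 / 4}"

lemma bregman_self [simp]: "bregman u x p x = 0"
  by (simp add: bregman_def)

lemma bregman_ge: "p \<in> sub x \<Longrightarrow> z \<in> ball 0 1 \<Longrightarrow> bregman u x p z \<ge> (norm (z - x))\<^sup>2 / 2"
  using subD[of p x z] by (simp add: bregman_def)

lemma norm_sq_combination:
  fixes y z :: 'a
  assumes "0 \<le> t" "t \<le> 1"
  shows "(norm ((1 - t) *\<^sub>R y + t *\<^sub>R z))\<^sup>2 = (1 - t) * (norm y)\<^sup>2 + t * (norm z)\<^sup>2 - t * (1 - t) * (norm (z - y))\<^sup>2"
  unfolding power2_norm_eq_inner by (simp add: algebra_simps inner_commute)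

lemma u_combination:
  assumes "y \<in> ball 0 1" "z \<in> ball 0 1" "0 \<le> t" "t \<le> 1"
  shows "u ((1 - t) *\<^sub>R y + t *\<^sub>R z) \<le> (1 - t) * u y + t * u z"
  using convex_u assms unfolding convex_on_def by (metis add.commute diff_add_cancel diff_ge_0_iff_ge)

lemma bregman_combination:
  assumes "y \<in> ball 0 1" "z \<in> ball 0 1" "0 \<le> t" "t \<le> 1"
  shows "bregman u x p ((1 - t) *\<^sub>R y + t *\<^sub>R z) \<le> (1 - t) * bregman u x p y + t * bregman u x p z"
proof -
  have e: "(1 - t) *\<^sub>R y + t *\<^sub>R z - x = (1 - t) *\<^sub>R (y - x) + t *\<^sub>R (z - x)" by (simp add: algebra_simps)
  have n: "(norm ((1 - t) *\<^sub>R y + t *\<^sub>R z - x))\<^sup>2 \<le> (1 - t) * (norm (y - x))\<^sup>2 + t * (norm (z - x))\<^sup>2"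
    unfolding e using norm_sq_combination[OF assms(3,4), of "y - x" "z - x"] assms
    by (simp add: mult_nonneg_nonneg)
  have i: "p \<bullet> ((1 - t) *\<^sub>R y + t *\<^sub>R z - x) = (1 - t) * (p \<bullet> (y - x)) + t * (p \<bullet> (z - x))"
    unfolding e by (simp add: inner_add_right)
  have "(1 - t) * bregman u x p y + t * bregman u x p z = ((1 - t) * u y + t * u z) - u x
      - ((1 - t) * (p \<bullet> (y - x)) + t * (p \<bullet> (z - x))) + ((1 - t) * (norm (y - x))\<^sup>2 + t * (norm (z - x))\<^sup>2) / 2"
    by (simp add: bregman_def field_simps)
  moreover have "bregman u x p ((1 - t) *\<^sub>R y + t *\<^sub>R z) = u ((1 - t) *\<^sub>R y + t *\<^sub>R z) - u x
      - ((1 - t) * (p \<bullet> (y - x)) + t * (p \<bullet> (z - x))) + (norm ((1 - t) *\<^sub>R y + t *\<^sub>R z - x))\<^sup>2 / 2"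
    by (simp only: bregman_def i)
  moreover have "U - c - I + N / 2 \<le> U' - c - I + N' / 2" if "U \<le> U'" "N \<le> N'" for U U' c I N N' :: real
    using that by simp
  ultimately show ?thesis using u_combination[OF assms] n by presburger
qed

lemma continuous_bregman: "S \<subseteq> ball 0 1 \<Longrightarrow> continuous_on S (bregman u x p)"
  unfolding bregman_def[abs_def] by (intro continuous_intros continuous_u') auto

lemma compact_sect: "compact (sect x p r)"
proof -
  have "closed (sect x p r)" unfolding sect_def
    using cball_subset by (intro continuous_on_closed_Collect_le continuous_bregman continuous_intros) auto
  moreover have "sect x p r \<subseteq> cball 0 \<rho>" by (auto simp: sect_def)
  ultimately show ?thesis
    by (metis bounded_cball bounded_subset compact_eq_bounded_closed)
qed

lemma convex_sect: "convex (sect x p r)"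
proof (rule convexI)
  fix y z and c d :: real assume h: "y \<in> sect x p r" "z \<in> sect x p r" "0 \<le> c" "0 \<le> d" "c + d = 1"
  then have c: "c = 1 - d" by simp
  have "c *\<^sub>R y + d *\<^sub>R z \<in> cball 0 \<rho>" using h convexD[OF convex_cball, of y 0 \<rho> z c d] by (auto simp: sect_def)
  moreover have "bregman u x p (c *\<^sub>R y + d *\<^sub>R z) \<le> c * bregman u x p y + d * bregman u x p z"
    unfolding c using h by (intro bregman_combination cball_ballD) (auto simp: sect_def)
  moreover have "c * bregman u x p y + d * bregman u x p z \<le> r\<^sup>2 / 2"
    using h by (intro convex_bound_le) (auto simp: sect_def)
  ultimately show "c *\<^sub>R y + d *\<^sub>R z \<in> sect x p r" by (simp add: sect_def)
qed

lemma sect_subset_cball: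
  assumes "p \<in> sub x" "r \<ge> 0"
  shows "sect x p r \<subseteq> cball x r"
proof
  fix z assume "z \<in> sect x p r"
  then have z: "z \<in> cball 0 \<rho>" "bregman u x p z \<le> r\<^sup>2 / 2" by (auto simp: sect_def)
  have "(norm (z - x))\<^sup>2 / 2 \<le> r\<^sup>2 / 2"
    using bregman_ge[OF assms(1) cball_ballD[OF z(1)]] z(2) by linarith
  then have "(norm (z - x))\<^sup>2 \<le> r\<^sup>2" by simp
  then have "norm (z - x) \<le> r" using assms(2) by (rule power2_le_imp_le)
  then show "z \<in> cball x r" by (simp add: dist_norm norm_minus_commute)
qed

lemma self_in_sect: "x \<in> cball 0 \<rho> \<Longrightarrow> x \<in> sect x p r"
  by (simp add: sect_def)

lemma self_in_dual_sect: "p + x \<in> dual_sect x p r"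
  by (simp add: dual_sect_def)

lemma sect_contains_ball:
  assumes "norm x < \<rho>" "r > 0"
  shows "\<exists>e>0. cball x e \<subseteq> sect x p r"
proof -
  have "continuous_on (ball 0 \<rho>) (bregman u x p)" using \<rho> by (intro continuous_bregman) auto
  then have "open (ball 0 \<rho> \<inter> bregman u x p -` {..<r\<^sup>2 / 2})"
    by (intro continuous_open_preimage) auto
  also have "ball 0 \<rho> \<inter> bregman u x p -` {..<r\<^sup>2 / 2} = {z \<in> ball 0 \<rho>. bregman u x p z < r\<^sup>2 / 2}" by auto
  finally have "open {z \<in> ball 0 \<rho>. bregman u x p z < r\<^sup>2 / 2}" .
  moreover have "x \<in> {z \<in> ball 0 \<rho>. bregman u x p z < r\<^sup>2 / 2}" using assms by simp
  ultimately obtain e where "e > 0" "cball x e \<subseteq> {z \<in> ball 0 \<rho>. bregman u x p z < r\<^sup>2 / 2}"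
    using open_contains_cball by blast
  then show ?thesis by (intro exI[of _ e]) (auto simp: sect_def subset_iff)
qed

lemma interior_sect:
  assumes "norm x < \<rho>" "r > 0"
  shows "interior (sect x p r) \<noteq> {}"
  using sect_contains_ball[OF assms, of p] by (metis ball_subset_cball centre_in_ball dual_order.trans empty_iff interior_maximal open_ball subsetD)

lemma dual_sect_halfspaces:
  "dual_sect x p r = (\<Inter>z\<in>sect x p r. {s. (z - x) \<bullet> s \<le> r\<^sup>2 / 4 + (p + x) \<bullet> (z - x)} \<inter> {s. (z - x) \<bullet> s \<ge> - (r\<^sup>2 / 4) + (p + x) \<bullet> (z - x)})"
proof -
  have "\<bar>(s - (p + x)) \<bullet> (z - x)\<bar> \<le> r\<^sup>2 / 4 \<longleftrightarrow> (z - x) \<bullet> s \<le> r\<^sup>2 / 4 + (p + x) \<bullet> (z - x) \<and>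
      (z - x) \<bullet> s \<ge> - (r\<^sup>2 / 4) + (p + x) \<bullet> (z - x)" for s z
    unfolding abs_le_iff inner_diff_left[of s] inner_commute[of s] by linarith
  then show ?thesis by (auto simp: dual_sect_def)
qed

lemma convex_dual_sect: "convex (dual_sect x p r)"
  unfolding dual_sect_halfspaces by (intro convex_INT convex_Int convex_halfspace_le convex_halfspace_ge)

lemma compact_dual_sect:
  assumes "norm x < \<rho>" "r > 0"
  shows "compact (dual_sect x p r)"
proof -
  obtain e where e: "e > 0" "cball x e \<subseteq> sect x p r" using sect_contains_ball[OF assms] by blast
  have "norm (s - (p + x)) \<le> r\<^sup>2 / 4 / e" if "s \<in> dual_sect x p r" for s
  proof (cases "s = p + x")
    case False
    let ?v = "s - (p + x)"
    have "x + (e / norm ?v) *\<^sub>R ?v \<in> cball x e" using e False by (simp add: dist_norm)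
    then have "\<bar>?v \<bullet> (x + (e / norm ?v) *\<^sub>R ?v - x)\<bar> \<le> r\<^sup>2 / 4" using that e(2) unfolding dual_sect_def by blast
    moreover have "?v \<bullet> (x + (e / norm ?v) *\<^sub>R ?v - x) = e * norm ?v"
      using False by (simp only: add_diff_cancel_left' inner_scaleR_right dot_square_norm power2_eq_square) simp
    ultimately have "e * norm ?v \<le> r\<^sup>2 / 4" by linarith
    then show ?thesis using e by (simp add: field_simps)
  qed (use e in auto)
  then have "dual_sect x p r \<subseteq> cball (p + x) (r\<^sup>2 / 4 / e)"
    by (auto simp: dist_norm norm_minus_commute)
  moreover have "closed (dual_sect x p r)"
    unfolding dual_sect_halfspaces by (intro closed_INT closed_Int ballI closed_halfspace_le closed_halfspace_ge)
  ultimately show ?thesis by (metis bounded_cball bounded_subset compact_eq_bounded_closed)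
qed

text \<open>Minimise \<open>v z - s \<bullet> z\<close> over the section. Comparison with
  \<open>x\<close> puts the minimiser \<open>y\<close> at level at most r^2/4, half of the height,
  and \<open>y\<close> is also interior to the ball of radius \<open>\<rho>\<close>. So it is a
  local minimiser, and by convexity a global one.\<close>

lemma dual_sect_contact:
  assumes p: "p \<in> sub x" and r: "r > 0" "norm x + r < \<rho>" and s: "s \<in> dual_sect x p r"
  shows "\<exists>y\<in>sect x p r. s - y \<in> sub y"
proof -
  let ?g = "\<lambda>z. u z + (norm z)\<^sup>2 / 2 - s \<bullet> z"
  have xc: "x \<in> cball 0 \<rho>" using r by simp
  have subB: "sect x p r \<subseteq> ball 0 1" using cball_subset by (auto simp: sect_def)
  have "continuous_on (sect x p r) ?g" by (intro continuous_intros continuous_u' subB) auto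
  then obtain y where y: "y \<in> sect x p r" "\<And>z. z \<in> sect x p r \<Longrightarrow> ?g y \<le> ?g z"
    using continuous_attains_inf[OF compact_sect, of x p r ?g] self_in_sect[OF xc] by blast
  have gd: "?g z - ?g x = bregman u x p z - (s - (p + x)) \<bullet> (z - x)" for z
    by (simp add: bregman_def power2_norm_eq_inner inner_diff_left inner_diff_right inner_add_left inner_add_right inner_commute field_simps)
  have by4: "bregman u x p y \<le> r\<^sup>2 / 4"
  proof -
    have "bregman u x p y \<le> (s - (p + x)) \<bullet> (y - x)" using gd[of y] y(2)[OF self_in_sect[OF xc]] by linarith
    also have "\<dots> \<le> r\<^sup>2 / 4" using s y(1) by (auto simp: dual_sect_def abs_le_iff)
    finally show ?thesis .
  qed
  have yn: "norm y < \<rho>"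
  proof -
    have "norm (y - x) \<le> r" using sect_subset_cball[OF p, of r] y(1) r by (auto simp: dist_norm norm_minus_commute)
    moreover have "norm y \<le> norm x + norm (y - x)" by (metis add.commute diff_add_cancel norm_triangle_ineq)
    ultimately show ?thesis using r by linarith
  qed
  have yB: "y \<in> ball 0 1" using y subB by blast
  have "u z \<ge> u y + (s - y) \<bullet> (z - y)" if z: "z \<in> ball 0 1" for z
  proof (rule field_le_epsilon)
    fix e :: real assume e: "e > 0"
    let ?b = "\<bar>bregman u x p z\<bar> + 1" and ?d = "norm (z - y) + 1"
    \<comment> \<open>Small enough for the point at parameter \<open>t\<close> between
      \<open>y\<close> and \<open>z\<close> to stay below level r^2/2 and inside
      \<open>cball 0 \<rho>\<close>, and for the quadratic error to be at most
      \<open>e\<close>.\<close>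
    define t where "t = min (min 1 (r\<^sup>2 / 4 / ?b)) (min ((\<rho> - norm y) / ?d) (e / (?d * ?d)))"
    have dp: "?d > 0" "?b > 0" by (auto simp: add_nonneg_pos)
    have t0: "t > 0" using r yn e dp by (simp add: t_def)
    have t1: "t \<le> 1" by (simp add: t_def)
    have "t \<le> r\<^sup>2 / 4 / ?b" by (simp add: t_def)
    then have tb: "t * ?b \<le> r\<^sup>2 / 4" using dp(2) by (simp only: pos_le_divide_eq)
    have "t \<le> (\<rho> - norm y) / ?d" by (simp add: t_def)
    then have td: "t * ?d \<le> \<rho> - norm y" using dp(1) by (simp only: pos_le_divide_eq)
    have "t \<le> e / (?d * ?d)" by (simp add: t_def)
    then have te: "t * (?d * ?d) \<le> e" using mult_pos_pos[OF dp(1) dp(1)] by (simp only: pos_le_divide_eq)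
    let ?y = "(1 - t) *\<^sub>R y + t *\<^sub>R z"
    have ye: "?y = y + t *\<^sub>R (z - y)" by (simp add: algebra_simps)
    have "bregman u x p ?y \<le> (1 - t) * bregman u x p y + t * bregman u x p z"
      using yB z t0 t1 by (intro bregman_combination) auto
    also have "\<dots> \<le> 1 * (r\<^sup>2 / 4) + t * ?b"
    proof (rule add_mono)
      have "0 \<le> bregman u x p y" using bregman_ge[OF p yB] by (smt (verit) divide_nonneg_nonneg zero_le_power2)
      then show "(1 - t) * bregman u x p y \<le> 1 * (r\<^sup>2 / 4)" using t0 t1 by4 by (intro mult_mono) auto
      show "t * bregman u x p z \<le> t * ?b" using t0 by (intro mult_left_mono) auto
    qed
    finally have "bregman u x p ?y \<le> r\<^sup>2 / 2" using tb by linarith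
    moreover have "norm ?y \<le> \<rho>"
    proof -
      have "norm ?y \<le> norm y + t * norm (z - y)" unfolding ye using norm_triangle_ineq[of y "t *\<^sub>R (z - y)"] t0 by simp
      also have "t * norm (z - y) \<le> t * ?d" using t0 by simp
      finally show ?thesis using td by linarith
    qed
    ultimately have "?y \<in> sect x p r" by (simp add: sect_def)
    then have "?g y \<le> ?g ?y" by (rule y(2))
    moreover have "(norm ?y)\<^sup>2 / 2 = (norm y)\<^sup>2 / 2 + t * (y \<bullet> (z - y)) + t * t * (norm (z - y))\<^sup>2 / 2"
    proof -
      have "(norm (y + t *\<^sub>R w))\<^sup>2 / 2 = (norm y)\<^sup>2 / 2 + t * (y \<bullet> w) + t * t * (norm w)\<^sup>2 / 2" for w
        by (simp add: power2_norm_eq_inner inner_add_left inner_add_right inner_commute field_simps)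
      then show ?thesis unfolding ye .
    qed
    moreover have "s \<bullet> ?y = s \<bullet> y + t * (s \<bullet> (z - y))" unfolding ye by (simp add: inner_add_right)
    moreover have "u ?y \<le> (1 - t) * u y + t * u z" using yB z t0 t1 by (intro u_combination) auto
    ultimately have "t * ((s - y) \<bullet> (z - y)) \<le> t * (u z - u y + t * (norm (z - y))\<^sup>2 / 2)"
      by (simp add: inner_diff_left algebra_simps)
    then have "(s - y) \<bullet> (z - y) \<le> u z - u y + t * (norm (z - y))\<^sup>2 / 2" using t0 by (simp only: mult_le_cancel_left_pos)
    moreover have "t * (norm (z - y))\<^sup>2 / 2 \<le> e"
    proof -
      have "t * (norm (z - y))\<^sup>2 \<le> t * (?d * ?d)"
        using t0 unfolding power2_eq_square by (intro mult_left_mono mult_mono) auto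
      then have "t * (norm (z - y))\<^sup>2 \<le> e" using te by linarith
      moreover have "0 \<le> t * (norm (z - y))\<^sup>2" using t0 by simp
      ultimately show ?thesis by linarith
    qed
    ultimately show "u y + (s - y) \<bullet> (z - y) \<le> u z + e" by linarith
  qed
  then have "s - y \<in> sub y" by (simp add: subgradient_def)
  then show ?thesis using y(1) by blast
qed

text \<open>A common slope \<open>s\<close> of both polar bodies has one contact point
  \<open>y\<close>, lying in both sections. Up to terms of order r^2, the level of \<open>x2\<close>
  seen from \<open>x1\<close> is then \<open>(y - x2) \<bullet> (p1 + x1 - s)\<close>. The overlap
  is narrow in the direction \<open>y - x2\<close>, being part of the polar body at
  \<open>x2\<close>; since it fills a fixed part of the body at \<open>x1\<close>, that body cannot
  extend far in this direction either.\<close>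

lemma sections_comparable:
  assumes p1: "p1 \<in> sub x1" and p2: "p2 \<in> sub x2" and r: "r > 0" "norm x1 + r < \<rho>" "norm x2 + r < \<rho>"
    and k: "k > 0" "measure lebesgue (dual_sect x1 p1 r \<inter> dual_sect x2 p2 r) \<ge> k * measure lebesgue (dual_sect x1 p1 r)"
    and pos: "measure lebesgue (dual_sect x1 p1 r) > 0"
  shows "bregman u x1 p1 x2 \<le> r\<^sup>2 * (1 + 3 * 2 ^ DIM('a) / k)"
proof -
  let ?P = "dual_sect x1 p1 r" and ?O = "dual_sect x1 p1 r \<inter> dual_sect x2 p2 r"
  have n: "norm x1 < \<rho>" "norm x2 < \<rho>" using r by auto
  have cO: "compact ?O" using compact_dual_sect[OF n(1) r(1)] compact_dual_sect[OF n(2) r(1)] by (simp add: compact_Int)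
  have Opos: "measure lebesgue ?O > 0" using k pos by (meson less_le_trans mult_pos_pos)
  then obtain s where s: "s \<in> ?O" by (metis ex_in_conv less_irrefl measure_empty)
  obtain y1 where y1: "y1 \<in> sect x1 p1 r" "s - y1 \<in> sub y1" using dual_sect_contact[OF p1 r(1,2)] s by blast
  obtain y2 where y2: "y2 \<in> sect x2 p2 r" "s - y2 \<in> sub y2" using dual_sect_contact[OF p2 r(1,3)] s by blast
  have B: "y1 \<in> ball 0 1" "y2 \<in> ball 0 1" using y1 y2 by (intro cball_ballD; simp add: sect_def)+
  have "y1 = y2" using vimg_unique[OF B] y1 y2 by blast
  then obtain y where y: "y \<in> sect x1 p1 r" "y \<in> sect x2 p2 r" "y \<in> ball 0 1" using y1 y2 B by blast
  define a where "a = y - x2"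
  have ab: "\<bar>a \<bullet> (s' - (p2 + x2))\<bar> \<le> r\<^sup>2 / 4" if "s' \<in> ?O" for s'
    using that y(2) by (auto simp: dual_sect_def a_def inner_commute)
  \<comment> \<open>The thin set is the overlap, the large one the body at \<open>x1\<close>, and
    the far point its centre \<open>p1 + x1\<close>.\<close>
  have "\<bar>a \<bullet> (p1 + x1 - s)\<bar> * measure lebesgue ?O \<le> 6 * 2 ^ DIM('a) * (r\<^sup>2 / 2) * measure lebesgue ?P"
  proof (rule width_measure_le)
    show "a \<bullet> (s' - s'') \<le> r\<^sup>2 / 2" if "s' \<in> ?O" "s'' \<in> ?O" for s' s''
      using ab[OF that(1)] ab[OF that(2)] unfolding inner_diff_right abs_le_iff by linarith
  qed (use s r cO convex_dual_sect self_in_dual_sect lmeasurable_compact[OF compact_dual_sect[OF n(1) r(1)]] in auto)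
  also have "\<dots> \<le> 6 * 2 ^ DIM('a) * (r\<^sup>2 / 2) * (measure lebesgue ?O / k)"
    using k by (intro mult_left_mono) (simp_all add: field_simps)
  finally have "\<bar>a \<bullet> (p1 + x1 - s)\<bar> * measure lebesgue ?O \<le> (3 * 2 ^ DIM('a) * r\<^sup>2 / k) * measure lebesgue ?O"
    by (simp add: field_simps)
  then have w: "\<bar>a \<bullet> (p1 + x1 - s)\<bar> \<le> 3 * 2 ^ DIM('a) * r\<^sup>2 / k" using Opos by (simp only: mult_le_cancel_right_pos)
  have x2: "x2 \<in> ball 0 1" using n \<rho> by simp
  have "bregman u x1 p1 x2 - bregman u x1 p1 y = u x2 + (norm x2)\<^sup>2 / 2 - u y - (norm y)\<^sup>2 / 2 - (p1 + x1) \<bullet> (x2 - y)"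
    by (simp add: bregman_def power2_norm_eq_inner inner_diff_left inner_diff_right inner_add_left inner_add_right inner_commute field_simps)
  also have "\<dots> = - bregman u x2 p2 y + (p2 + x2) \<bullet> (x2 - y) - (p1 + x1) \<bullet> (x2 - y)"
    by (simp add: bregman_def power2_norm_eq_inner inner_diff_left inner_diff_right inner_add_left inner_add_right inner_commute field_simps)
  also have "\<dots> = - bregman u x2 p2 y + a \<bullet> (p1 + x1 - s) + a \<bullet> (s - (p2 + x2))"
    by (simp add: a_def inner_diff_left inner_diff_right inner_add_left inner_add_right inner_commute field_simps)
  finally have "bregman u x1 p1 x2 = bregman u x1 p1 y - bregman u x2 p2 y + a \<bullet> (p1 + x1 - s) + a \<bullet> (s - (p2 + x2))"
    by linarith
  moreover have "bregman u x1 p1 y \<le> r\<^sup>2 / 2" using y by (simp add: sect_def)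
  moreover have "bregman u x2 p2 y \<ge> 0" using bregman_ge[OF p2 y(3)] by (smt (verit) divide_nonneg_nonneg zero_le_power2)
  ultimately have "bregman u x1 p1 x2 \<le> r\<^sup>2 / 2 + 3 * 2 ^ DIM('a) * r\<^sup>2 / k + r\<^sup>2 / 4"
    using w ab[OF s] by linarith
  also have "r\<^sup>2 / 2 + X + r\<^sup>2 / 4 \<le> r\<^sup>2 + X" for X by simp
  also have "r\<^sup>2 + 3 * 2 ^ DIM('a) * r\<^sup>2 / k = r\<^sup>2 * (1 + 3 * 2 ^ DIM('a) / k)" by (simp add: algebra_simps)
  finally show ?thesis .
qed

end

section \<open>Volume of sections at points of contact\<close>

context convex_on_unit_ball
begin

text \<open>Only the end of the contact segment at the exact distance \<open>\<tau>\<close> is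
  recorded. This is a closed condition on \<open>(x, p)\<close>, and a longer contact segment
  implies it by convexity.\<close>

definition has_contact :: "real \<Rightarrow> 'a \<Rightarrow> 'a \<Rightarrow> bool" where
  "has_contact \<tau> x p \<longleftrightarrow> (\<exists>e. norm e = 1 \<and> x + \<tau> *\<^sub>R e \<in> cball 0 \<rho> \<and> u (x + \<tau> *\<^sub>R e) = u x + \<tau> * (p \<bullet> e))"

text \<open>Relative to the height r^2/2 of the section, the inscribed radius is
  \<open>2 * R\<close> times the height.\<close>

definition fat :: "real \<Rightarrow> real \<Rightarrow> 'a \<Rightarrow> 'a \<Rightarrow> bool" where
  "fat R r x p \<longleftrightarrow> (\<exists>y. cball y (R * r\<^sup>2) \<subseteq> sect x p r)"

text \<open>Where \<open>p\<close> has maximal norm, every other subgradient \<open>p + c\<close> satisfies \<open>|c|\<^sup>2 + 2 c \<bullet> p \<le> 0\<close>;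
  hence \<open>c \<bullet> y \<le> 1/2\<close> for every \<open>y\<close> in the ball of radius \<open>R\<close> about \<open>R\<^sup>2 p\<close>.\<close>
lemma fat_of_max_norm:
  assumes x: "norm x < \<rho>" and p: "p \<in> sub x" and mx: "\<And>p'. p' \<in> sub x \<Longrightarrow> norm p' \<le> norm p" and R: "R > 0"
  shows "\<exists>r0>0. \<forall>r. 0 < r \<and> r \<le> r0 \<longrightarrow> fat (R / 2) r x p"
proof (rule ccontr)
  assume con: "\<not> ?thesis"
  \<comment> \<open>\<open>D\<close> bounds the norm on the ball of rescaled displacements, with
    centre \<open>R\<^sup>2 *\<^sub>R p\<close> and radius \<open>R\<close>; \<open>\<delta>\<close>
    keeps the actual displacements inside \<open>cball 0 \<rho>\<close>.\<close>
  define D where "D = R\<^sup>2 * norm p + R"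
  have D: "D > 0" using R by (simp add: D_def add_nonneg_pos)
  define \<delta> where "\<delta> = min 1 ((\<rho> - norm x) / D)"
  have \<delta>: "\<delta> > 0" using D x by (simp add: \<delta>_def)
  have "\<exists>r. 0 < r \<and> r \<le> \<delta> / (real k + 1) \<and> \<not> fat (R / 2) r x p" for k
    using con \<delta> by (metis add_nonneg_pos divide_pos_pos of_nat_0_le_iff zero_less_one)
  then obtain r where r: "\<And>k. 0 < r k" "\<And>k. r k \<le> \<delta> / (real k + 1)" "\<And>k. \<not> fat (R / 2) (r k) x p" by metis
  define h where "h k = (r k)\<^sup>2 / 2" for k
  have h0: "h k > 0" for k using r(1)[of k] by (simp add: h_def)
  have hk: "h k \<le> \<delta> / (real k + 1)" for k
  proof -
    have "\<delta> / (real k + 1) \<le> \<delta> / 1" using \<delta> by (intro divide_left_mono) auto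
    moreover have "\<delta> \<le> 1" by (simp add: \<delta>_def)
    ultimately have "r k \<le> 1" using r(2)[of k] by linarith
    then have "(r k)\<^sup>2 \<le> r k * 1" unfolding power2_eq_square using r(1)[of k] by (intro mult_left_mono) auto
    then have "h k \<le> r k" using r(1)[of k] by (simp add: h_def)
    then show ?thesis using r(2)[of k] by linarith
  qed
  \<comment> \<open>In units of the height \<open>h k\<close> the radius
    \<open>R / 2 * (r k)\<^sup>2\<close> becomes \<open>R\<close>, so failure of fatness yields a
    bad displacement in one fixed ball for every \<open>k\<close>.\<close>
  have "\<exists>y. y \<in> cball (R\<^sup>2 *\<^sub>R p) R \<and> x + h k *\<^sub>R y \<notin> sect x p (r k)" for k
  proof -
    have "\<not> cball (x + h k *\<^sub>R (R\<^sup>2 *\<^sub>R p)) (R / 2 * (r k)\<^sup>2) \<subseteq> sect x p (r k)"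
      using r(3)[of k] by (auto simp: fat_def)
    then obtain z where z: "z \<in> cball (x + h k *\<^sub>R (R\<^sup>2 *\<^sub>R p)) (R / 2 * (r k)\<^sup>2)" "z \<notin> sect x p (r k)" by blast
    let ?y = "(1 / h k) *\<^sub>R (z - x)"
    have zy: "z = x + h k *\<^sub>R ?y" using h0[of k] by simp
    have "norm (z - (x + h k *\<^sub>R (R\<^sup>2 *\<^sub>R p))) \<le> h k * R"
      using z(1) by (simp add: dist_norm norm_minus_commute h_def mult.commute)
    also have "z - (x + h k *\<^sub>R (R\<^sup>2 *\<^sub>R p)) = h k *\<^sub>R (?y - R\<^sup>2 *\<^sub>R p)"
      using h0[of k] by (simp add: scaleR_diff_right)
    finally have "norm (?y - R\<^sup>2 *\<^sub>R p) \<le> R" using h0[of k] by simp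
    then have "?y \<in> cball (R\<^sup>2 *\<^sub>R p) R" by (simp add: dist_norm norm_minus_commute)
    then show ?thesis using z(2) zy by metis
  qed
  then obtain y where y: "\<And>k. y k \<in> cball (R\<^sup>2 *\<^sub>R p) R" "\<And>k. x + h k *\<^sub>R y k \<notin> sect x p (r k)" by metis
  have yD: "norm (y k) \<le> D" for k
  proof -
    have "norm (y k - R\<^sup>2 *\<^sub>R p) \<le> R" using y(1)[of k] by (simp add: dist_norm norm_minus_commute)
    moreover have "norm (y k) \<le> norm (R\<^sup>2 *\<^sub>R p) + norm (y k - R\<^sup>2 *\<^sub>R p)"
      by (metis add.commute diff_add_cancel norm_triangle_ineq)
    ultimately show ?thesis by (simp add: D_def)
  qed
  have h\<delta>: "h k \<le> \<delta>" for k
  proof -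
    have "\<delta> / (real k + 1) \<le> \<delta> / 1" using \<delta> by (intro divide_left_mono) auto
    then show ?thesis using hk[of k] by simp
  qed
  have zc: "x + h k *\<^sub>R y k \<in> cball 0 \<rho>" for k
  proof -
    have "norm (h k *\<^sub>R y k) \<le> \<delta> * D"
      using h0[of k] h\<delta>[of k] yD[of k] \<delta> by (auto intro!: mult_mono)
    also have "\<dots> \<le> (\<rho> - norm x) / D * D" using D by (intro mult_right_mono) (auto simp: \<delta>_def)
    also have "\<dots> = \<rho> - norm x" using D by simp
    finally show ?thesis using norm_triangle_ineq[of x "h k *\<^sub>R y k"] by simp
  qed
  have "\<exists>q. q \<in> sub (x + h k *\<^sub>R y k)" for k using sub_nonempty[OF cball_ballD[OF zc[of k]]] by blast
  then obtain q where q: "\<And>k. q k \<in> sub (x + h k *\<^sub>R y k)" by metis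
  \<comment> \<open>The point lies above the level of the section, whereas its slope
    \<open>q k\<close> limits the rise of \<open>u\<close> from \<open>x\<close>. In the limit this
    produces a subgradient at \<open>x\<close> exceeding \<open>p\<close> by at least 1 in the
    direction \<open>w\<close>.\<close>
  have key: "(q k - p) \<bullet> y k + h k * D\<^sup>2 / 2 \<ge> 1" for k
  proof -
    have "bregman u x p (x + h k *\<^sub>R y k) > h k"
      using y(2)[of k] zc[of k] by (simp add: sect_def h_def)
    moreover have "u x \<ge> u (x + h k *\<^sub>R y k) + q k \<bullet> (x - (x + h k *\<^sub>R y k))"
      using subD[OF q[of k], of x] x \<rho> by simp
    ultimately have "h k < h k * (q k \<bullet> y k) - h k * (p \<bullet> y k) + (h k * norm (y k))\<^sup>2 / 2"
      using h0[of k] by (simp add: bregman_def)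
    also have "\<dots> = h k * ((q k - p) \<bullet> y k + h k * (norm (y k))\<^sup>2 / 2)"
      by (simp add: inner_diff_left power2_eq_square algebra_simps)
    finally have "1 < (q k - p) \<bullet> y k + h k * (norm (y k))\<^sup>2 / 2" using h0[of k] by simp
    moreover have "h k * (norm (y k))\<^sup>2 / 2 \<le> h k * D\<^sup>2 / 2"
      using yD[of k] h0[of k] by (intro divide_right_mono mult_left_mono power_mono) auto
    ultimately show ?thesis by linarith
  qed
  let ?K = "graph \<times> cball (R\<^sup>2 *\<^sub>R p) R"
  have K: "seq_compact ?K"
    using compact_Times[OF compact_graph compact_cball] by (simp add: compact_eq_seq_compact_metric)
  have mem: "((x + h k *\<^sub>R y k, q k), y k) \<in> ?K" for k using zc[of k] q[of k] y(1)[of k] by (auto simp: graph_def)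
  obtain l \<phi> where l: "l \<in> ?K" and \<phi>: "strict_mono \<phi>"
    and lim: "((\<lambda>k. ((x + h k *\<^sub>R y k, q k), y k)) \<circ> \<phi>) \<longlonglongrightarrow> l"
    using seq_compactE[OF K, of "\<lambda>k. ((x + h k *\<^sub>R y k, q k), y k)"] mem by blast
  obtain z p' w where lw: "l = ((z, p'), w)" by (metis surj_pair)
  have lz: "(\<lambda>k. x + h (\<phi> k) *\<^sub>R y (\<phi> k)) \<longlonglongrightarrow> z"
    using tendsto_fst[OF tendsto_fst[OF lim]] by (simp add: lw o_def)
  have lp: "(\<lambda>k. q (\<phi> k)) \<longlonglongrightarrow> p'" using tendsto_snd[OF tendsto_fst[OF lim]] by (simp add: lw o_def)
  have ly: "(\<lambda>k. y (\<phi> k)) \<longlonglongrightarrow> w" using tendsto_snd[OF lim] by (simp add: lw o_def)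
  have "h \<longlonglongrightarrow> 0"
  proof (rule tendsto_sandwich[of "\<lambda>k. 0" _ _ "\<lambda>k. \<delta> / (real k + 1)"])
    have "(\<lambda>k. \<delta> * inverse (real (Suc k))) \<longlonglongrightarrow> \<delta> * 0"
      by (intro tendsto_mult tendsto_const LIMSEQ_inverse_real_of_nat)
    then show "(\<lambda>k. \<delta> / (real k + 1)) \<longlonglongrightarrow> 0" by (simp add: field_simps)
  qed (use h0 hk in \<open>auto intro!: always_eventually less_imp_le\<close>)
  then have lh: "(\<lambda>k. h (\<phi> k)) \<longlonglongrightarrow> 0" using LIMSEQ_subseq_LIMSEQ[OF _ \<phi>] by (simp add: o_def)
  have "(\<lambda>k. x + h (\<phi> k) *\<^sub>R y (\<phi> k)) \<longlonglongrightarrow> x + 0 *\<^sub>R w" by (intro tendsto_intros lh ly)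
  then have zx: "z = x" using lz LIMSEQ_unique by fastforce
  have "(\<lambda>k. (q (\<phi> k) - p) \<bullet> y (\<phi> k) + h (\<phi> k) * D\<^sup>2 / 2) \<longlonglongrightarrow> (p' - p) \<bullet> w + 0 * D\<^sup>2 / 2"
    by (intro tendsto_intros lp ly lh) auto
  then have ge: "(p' - p) \<bullet> w + 0 * D\<^sup>2 / 2 \<ge> 1" using key by (intro LIMSEQ_le_const) auto
  have p': "p' \<in> sub x" and w: "norm (w - R\<^sup>2 *\<^sub>R p) \<le> R"
    using l lw zx by (auto simp: graph_def dist_norm norm_minus_commute)
  define c where "c = p' - p"
  have "(norm (p + c))\<^sup>2 \<le> (norm p)\<^sup>2" using mx[OF p'] by (simp add: c_def power_mono)
  then have cp: "2 * (c \<bullet> p) \<le> - (norm c)\<^sup>2"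
    by (simp add: power2_norm_eq_inner inner_add_left inner_add_right inner_commute)
  have "c \<bullet> w = R\<^sup>2 * (c \<bullet> p) + c \<bullet> (w - R\<^sup>2 *\<^sub>R p)" by (simp add: inner_diff_right)
  also have "c \<bullet> (w - R\<^sup>2 *\<^sub>R p) \<le> norm c * R"
    using norm_cauchy_schwarz[of c "w - R\<^sup>2 *\<^sub>R p"] mult_left_mono[OF w, of "norm c"] by simp
  also have "R\<^sup>2 * (c \<bullet> p) \<le> R\<^sup>2 * (- (norm c)\<^sup>2 / 2)" using cp by (intro mult_left_mono) auto
  finally have "c \<bullet> w \<le> R\<^sup>2 * (- (norm c)\<^sup>2 / 2) + norm c * R" by simp
  \<comment> \<open>As a function of |c| the bound has maximum 1/2 for every \<open>R\<close>; the
    centre at R^2 p for radius \<open>R\<close> is chosen to achieve this.\<close>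
  also have "\<dots> \<le> 1 / 2"
  proof -
    have "0 \<le> (R * norm c - 1)\<^sup>2" by simp
    then show ?thesis by (simp add: power2_eq_square algebra_simps)
  qed
  finally show False using ge by (simp add: c_def)
qed

text \<open>The threshold \<open>r0\<close> is common to all points. Maximality of the norm is
  replaced by its consequence, fatness, because contact and fatness survive limits of
  \<open>(x, p)\<close> while maximality need not.\<close>

definition fat_contact_set :: "real \<Rightarrow> real \<Rightarrow> real \<Rightarrow> real \<Rightarrow> 'a set" where
  "fat_contact_set \<sigma> \<tau> R r0 =
     {x \<in> cball 0 \<sigma>. \<exists>p\<in>sub x. has_contact \<tau> x p \<and> (\<forall>r. 0 < r \<and> r \<le> r0 \<longrightarrow> fat R r x p)}"

text \<open>Contact and fatness at one scale each assert a witness, a direction or a centre, from a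
  compact set. Adjoining the witness gives a compact set of tuples, and projecting the witness away
  keeps it compact.\<close>

lemma compact_fat_contact_set:
  assumes \<sigma>: "\<sigma> \<le> \<rho>" and R: "R > 0"
  shows "compact (fat_contact_set \<sigma> \<tau> R r0)"
proof -
  have cg: "continuous_on graph (\<lambda>w. u (fst w))"
    by (intro continuous_on_compose2[OF continuous_u] continuous_intros) (use \<rho> in \<open>auto simp: graph_def\<close>)
  define G1 where "G1 = {w \<in> graph. has_contact \<tau> (fst w) (snd w)}"
  have "compact G1"
  proof -
    define K0 where "K0 = {w \<in> graph \<times> sphere 0 1. norm (fst (fst w) + \<tau> *\<^sub>R snd w) \<le> \<rho>}"
    have "compact (graph \<times> sphere (0::'a) 1)" by (intro compact_Times compact_graph compact_sphere)
    moreover have "closed K0" unfolding K0_def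
      by (intro continuous_on_closed_Collect_le continuous_intros compact_imp_closed calculation)
    moreover have "K0 \<subseteq> graph \<times> sphere 0 1" by (auto simp: K0_def)
    ultimately have K0: "compact K0" by (metis compact_Int_closed inf.absorb_iff2)
    let ?f = "\<lambda>w. u (fst (fst w) + \<tau> *\<^sub>R snd w) - u (fst (fst w)) - \<tau> * (snd (fst w) \<bullet> snd w)"
    have "continuous_on K0 ?f"
    proof (intro continuous_intros)
      show "continuous_on K0 (\<lambda>w. u (fst (fst w) + \<tau> *\<^sub>R snd w))"
        by (intro continuous_on_compose2[OF continuous_u] continuous_intros) (use \<rho> in \<open>auto simp: K0_def\<close>)
      show "continuous_on K0 (\<lambda>w. u (fst (fst w)))"
        by (intro continuous_on_compose2[OF cg] continuous_intros) (auto simp: K0_def)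
    qed
    then have "closed {w \<in> K0. ?f w = 0}"
      using K0 by (intro continuous_closed_preimage_constant compact_imp_closed)
    then have "compact (K0 \<inter> {w \<in> K0. ?f w = 0})" using K0 by (intro compact_Int_closed)
    then have "compact (fst ` (K0 \<inter> {w \<in> K0. ?f w = 0}))"
      by (intro compact_continuous_image continuous_intros)
    also have "fst ` (K0 \<inter> {w \<in> K0. ?f w = 0}) = G1"
    proof (intro equalityI subsetI)
      fix v assume "v \<in> G1"
      then obtain e where "norm e = 1" "fst v + \<tau> *\<^sub>R e \<in> cball 0 \<rho>"
        "u (fst v + \<tau> *\<^sub>R e) = u (fst v) + \<tau> * (snd v \<bullet> e)" "v \<in> graph"
        by (auto simp: G1_def has_contact_def)
      then have "(v, e) \<in> K0 \<inter> {w \<in> K0. ?f w = 0}" by (auto simp: K0_def)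
      then show "v \<in> fst ` (K0 \<inter> {w \<in> K0. ?f w = 0})" by (rule rev_image_eqI) simp
    qed (auto simp: G1_def K0_def has_contact_def)
    finally show ?thesis .
  qed
  define G2 where "G2 r = {w \<in> graph. fat R r (fst w) (snd w)}" for r
  have G2: "closed (G2 r)" if r: "r > 0" for r
  proof -
    \<comment> \<open>Inclusion of a whole ball about the centre becomes one closed condition for
      each displacement \<open>z\<close>.\<close>
    define W where "W z = {w \<in> graph \<times> cball 0 1. norm (snd w + z) \<le> \<rho>}" for z :: 'a
    define V where "V z = {w \<in> W z. bregman u (fst (fst w)) (snd (fst w)) (snd w + z) \<le> r\<^sup>2 / 2}" for z
    have K: "compact (graph \<times> cball (0::'a) 1)" by (intro compact_Times compact_graph compact_cball)
    have W: "closed (W z)" for z unfolding W_def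
      by (intro continuous_on_closed_Collect_le continuous_intros compact_imp_closed K)
    have V: "closed (V z)" for z unfolding V_def
    proof (intro continuous_on_closed_Collect_le W continuous_intros)
      show "continuous_on (W z) (\<lambda>w. bregman u (fst (fst w)) (snd (fst w)) (snd w + z))"
        unfolding bregman_def
      proof (intro continuous_intros)
        show "continuous_on (W z) (\<lambda>w. u (snd w + z))"
          by (intro continuous_on_compose2[OF continuous_u] continuous_intros) (use \<rho> in \<open>auto simp: W_def\<close>)
        show "continuous_on (W z) (\<lambda>w. u (fst (fst w)))"
          by (intro continuous_on_compose2[OF cg] continuous_intros) (auto simp: W_def)
      qed auto
    qed
    have "closed (\<Inter>z\<in>cball 0 (R * r\<^sup>2). V z)" using V by blast
    then have "compact ((graph \<times> cball (0::'a) 1) \<inter> (\<Inter>z\<in>cball 0 (R * r\<^sup>2). V z))"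
      using K by (intro compact_Int_closed)
    then have "compact (fst ` ((graph \<times> cball (0::'a) 1) \<inter> (\<Inter>z\<in>cball 0 (R * r\<^sup>2). V z)))"
      by (intro compact_continuous_image continuous_intros)
    also have "fst ` ((graph \<times> cball (0::'a) 1) \<inter> (\<Inter>z\<in>cball 0 (R * r\<^sup>2). V z)) = G2 r"
    proof (intro equalityI subsetI)
      fix v assume "v \<in> G2 r"
      then obtain y where y: "cball y (R * r\<^sup>2) \<subseteq> sect (fst v) (snd v) r" and v: "v \<in> graph"
        by (auto simp: G2_def fat_def)
      have yz: "y + z \<in> sect (fst v) (snd v) r" if "z \<in> cball 0 (R * r\<^sup>2)" for z
        using that y by (auto simp: subset_iff dist_norm)
      have "y \<in> cball 0 1" using yz[of 0] R \<rho> by (auto simp: sect_def)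
      moreover have "(v, y) \<in> V z" if "z \<in> cball 0 (R * r\<^sup>2)" for z
        using yz[OF that] v \<open>y \<in> cball 0 1\<close> by (auto simp: V_def W_def sect_def)
      ultimately have "(v, y) \<in> (graph \<times> cball (0::'a) 1) \<inter> (\<Inter>z\<in>cball 0 (R * r\<^sup>2). V z)" using v by blast
      then show "v \<in> fst ` ((graph \<times> cball (0::'a) 1) \<inter> (\<Inter>z\<in>cball 0 (R * r\<^sup>2). V z))" by (rule rev_image_eqI) simp
    next
      fix v assume "v \<in> fst ` ((graph \<times> cball (0::'a) 1) \<inter> (\<Inter>z\<in>cball 0 (R * r\<^sup>2). V z))"
      then obtain y where v: "v \<in> graph" and y: "\<And>z. z \<in> cball 0 (R * r\<^sup>2) \<Longrightarrow> (v, y) \<in> V z" by force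
      have "cball y (R * r\<^sup>2) \<subseteq> sect (fst v) (snd v) r"
      proof
        fix z assume "z \<in> cball y (R * r\<^sup>2)"
        then have "z - y \<in> cball 0 (R * r\<^sup>2)" by (simp add: dist_norm norm_minus_commute)
        from y[OF this] show "z \<in> sect (fst v) (snd v) r" by (simp add: V_def W_def sect_def)
      qed
      then show "v \<in> G2 r" using v by (auto simp: G2_def fat_def)
    qed
    finally show ?thesis by (rule compact_imp_closed)
  qed
  have "closed (\<Inter>r\<in>{r. 0 < r \<and> r \<le> r0}. G2 r)" using G2 by blast
  then have "compact (G1 \<inter> ((cball 0 \<sigma> \<times> UNIV) \<inter> (\<Inter>r\<in>{r. 0 < r \<and> r \<le> r0}. G2 r)))"
    using \<open>compact G1\<close> by (intro compact_Int_closed closed_Int closed_Times) auto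
  then have "compact (fst ` (G1 \<inter> ((cball 0 \<sigma> \<times> UNIV) \<inter> (\<Inter>r\<in>{r. 0 < r \<and> r \<le> r0}. G2 r))))"
    by (intro compact_continuous_image continuous_intros)
  also have "fst ` (G1 \<inter> ((cball 0 \<sigma> \<times> UNIV) \<inter> (\<Inter>r\<in>{r. 0 < r \<and> r \<le> r0}. G2 r))) = fat_contact_set \<sigma> \<tau> R r0"
  proof (intro equalityI subsetI)
    fix x assume "x \<in> fat_contact_set \<sigma> \<tau> R r0"
    then obtain p where p: "x \<in> cball 0 \<sigma>" "p \<in> sub x" "has_contact \<tau> x p" "\<And>r. 0 < r \<Longrightarrow> r \<le> r0 \<Longrightarrow> fat R r x p"
      by (auto simp: fat_contact_set_def)
    then have "(x, p) \<in> graph" using \<sigma> by (auto simp: graph_def)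
    then have "(x, p) \<in> G1 \<inter> ((cball 0 \<sigma> \<times> UNIV) \<inter> (\<Inter>r\<in>{r. 0 < r \<and> r \<le> r0}. G2 r))"
      using p by (auto simp: G1_def G2_def)
    then show "x \<in> fst ` (G1 \<inter> ((cball 0 \<sigma> \<times> UNIV) \<inter> (\<Inter>r\<in>{r. 0 < r \<and> r \<le> r0}. G2 r)))"
      by (rule rev_image_eqI) simp
  qed (auto simp: fat_contact_set_def G1_def G2_def graph_def)
  finally show ?thesis .
qed

end

section \<open>Volume bounds from det D^2 u >= 1\<close>

locale alexandrov_on_unit_ball = convex_on_unit_ball +
  assumes alexandrov: "alexandrov_det_ge_1 (ball 0 1) u"
begin

text \<open>On the copy of \<open>U\<close> shrunk by half towards \<open>z\<close>, all slopes of
  \<open>u\<close> lie in \<open>p\<close> plus \<open>2 * h\<close> times the polar of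
  \<open>U\<close> about \<open>z\<close>. So det D^2 u >= 1 bounds the volume of the copy by (2h)^n
  times that of the polar, and the polar product bound closes the estimate. The 32 is 2 * 2 *
  8.\<close>

lemma sublevel_measure_le:
  fixes h :: real
  assumes p: "p \<in> sub x" and x: "x \<in> ball 0 1" and U: "compact U" "convex U" "interior U \<noteq> {}" "U \<subseteq> ball 0 1"
    and h: "h > 0" "\<And>z. z \<in> U \<Longrightarrow> u z \<le> u x + p \<bullet> (z - x) + h"
  shows "(measure lebesgue U)\<^sup>2 \<le> (32 * real DIM('a) * h) ^ DIM('a)"
proof -
  let ?n = "DIM('a)"
  obtain x0 where x0: "x0 \<in> U" using U(3) interior_subset by blast
  obtain z where z: "z \<in> U" and le: "measure lebesgue U * measure lebesgue {s. \<forall>y\<in>U. s \<bullet> (y - z) \<le> 1} \<le> (8 * real ?n) ^ ?n"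
    and bd: "bounded {s. \<forall>y\<in>U. s \<bullet> (y - z) \<le> 1}"
    using polar_product_bounds(1)[OF U(1-3) x0] by auto
  let ?Q = "{s. \<forall>y\<in>U. s \<bullet> (y - z) \<le> 1}"
  have "convex ?Q"
  proof -
    have "?Q = (\<Inter>y\<in>U. {s. (y - z) \<bullet> s \<le> 1})" by (auto simp: inner_commute)
    then show ?thesis by (simp add: convex_INT convex_halfspace_le)
  qed
  then have Q: "?Q \<in> lmeasurable" using bd by (simp add: measurable_convex)
  let ?U = "(\<lambda>t. (1/2) *\<^sub>R t + (1/2) *\<^sub>R z) ` U"
  have cU: "compact ?U" by (intro compact_continuous_image continuous_intros U)
  have UU: "?U \<subseteq> U" using U(2) z by (auto intro!: convexD)
  let ?I = "(\<lambda>s. (2 * h) *\<^sub>R s + p) ` ?Q"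
  have sub: "subgradient_image (ball 0 1) u ?U \<subseteq> ?I"
  proof
    fix s assume "s \<in> subgradient_image (ball 0 1) u ?U"
    then obtain t where t: "t \<in> U" and s: "s \<in> sub ((1/2) *\<^sub>R t + (1/2) *\<^sub>R z)"
      by (auto simp: subgradient_image_def)
    let ?y = "(1/2) *\<^sub>R t + (1/2) *\<^sub>R z"
    have yU: "?y \<in> U" using UU t by blast
    have "(1 / (2 * h)) *\<^sub>R (s - p) \<in> ?Q"
    proof clarify
      fix t' assume t': "t' \<in> U"
      \<comment> \<open>The point \<open>?w\<close> is in \<open>U\<close> and differs from
        \<open>?y\<close> by half of \<open>t' - z\<close>; between the two, \<open>u\<close> minus
        the plane can grow by at most \<open>h\<close>.\<close>
      let ?w = "(1/2) *\<^sub>R t + (1/2) *\<^sub>R t'"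
      have wU: "?w \<in> U" using U(2) t t' by (intro convexD) auto
      have wy: "?w - ?y = (1/2) *\<^sub>R (t' - z)" by (simp add: algebra_simps)
      have "u ?w \<ge> u ?y + s \<bullet> (?w - ?y)" using subD[OF s] wU U(4) by blast
      moreover have "u ?w \<le> u x + p \<bullet> (?w - x) + h" using h(2)[OF wU] .
      moreover have "u ?y \<ge> u x + p \<bullet> (?y - x)" using subD[OF p] yU U(4) by blast
      moreover have "p \<bullet> (?w - x) - p \<bullet> (?y - x) = p \<bullet> (?w - ?y)" by (simp add: inner_diff_right inner_add_right)
      ultimately have "s \<bullet> (?w - ?y) - p \<bullet> (?w - ?y) \<le> h" by linarith
      then have "(s - p) \<bullet> (t' - z) \<le> 2 * h" unfolding wy by (simp add: inner_diff_left)
      then have "(1 / (2 * h)) * ((s - p) \<bullet> (t' - z)) \<le> 1" using h(1) by (simp add: field_simps)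
      then show "(1 / (2 * h)) *\<^sub>R (s - p) \<bullet> (t' - z) \<le> 1" by (simp only: inner_scaleR_left)
    qed
    moreover have "s = (2 * h) *\<^sub>R ((1 / (2 * h)) *\<^sub>R (s - p)) + p" using h(1) by simp
    ultimately show "s \<in> ?I" by blast
  qed
  have "?U \<in> sets borel" using cU by (rule borel_compact)
  moreover have "?U \<subseteq> ball 0 1" using UU U(4) by blast
  ultimately have "emeasure lebesgue ?U \<le> emeasure lebesgue (subgradient_image (ball 0 1) u ?U)"
    using alexandrov unfolding alexandrov_det_ge_1_def by blast
  also have "\<dots> \<le> emeasure lebesgue ?I"
  proof (rule emeasure_mono[OF sub])
    have "convex ?I"
      using convex_affinity[OF \<open>convex ?Q\<close>, of p "2 * h"] by (simp add: add.commute)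
    moreover have "bounded ?I"
      using bounded_translation[OF bounded_scaling[OF bd, of "2 * h"], of p] by (simp add: image_image add.commute)
    ultimately show "?I \<in> sets lebesgue" using measurable_convex by blast
  qed
  also have "\<dots> = ennreal ((2 * h) ^ ?n) * emeasure lebesgue ?Q"
    using emeasure_lebesgue_affine[of "2 * h" p ?Q] h(1) by simp
  also have "\<dots> = ennreal ((2 * h) ^ ?n * measure lebesgue ?Q)"
    using Q h(1) by (simp add: emeasure_eq_measure2 ennreal_mult)
  also have "emeasure lebesgue ?U = ennreal (measure lebesgue ?U)"
    using cU by (simp add: emeasure_eq_measure2 lmeasurable_compact)
  also have "measure lebesgue ?U = (1/2) ^ ?n * measure lebesgue U"
    using measure_lebesgue_affine[of "1/2" "(1/2) *\<^sub>R z" U] by simp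
  finally have *: "(1/2) ^ ?n * measure lebesgue U \<le> (2 * h) ^ ?n * measure lebesgue ?Q"
    using h(1) by (simp add: ennreal_le_iff)
  have "(measure lebesgue U)\<^sup>2 = 2 ^ ?n * ((1/2) ^ ?n * measure lebesgue U) * measure lebesgue U"
    by (simp add: power2_eq_square power_divide)
  also have "\<dots> \<le> 2 ^ ?n * ((2 * h) ^ ?n * measure lebesgue ?Q) * measure lebesgue U"
    using * by (intro mult_right_mono mult_left_mono) auto
  also have "\<dots> = (2 ^ ?n * (2 * h) ^ ?n) * (measure lebesgue U * measure lebesgue ?Q)" by simp
  also have "\<dots> \<le> (2 ^ ?n * (2 * h) ^ ?n) * (8 * real ?n) ^ ?n"
    using le h(1) by (intro mult_left_mono) auto
  also have "\<dots> = (2 * (2 * h) * (8 * real ?n)) ^ ?n" by (simp only: power_mult_distrib of_nat_power of_nat_mult of_nat_numeral)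
  also have "2 * (2 * h) * (8 * real ?n) = 32 * real ?n * h" by simp
  finally show ?thesis by simp
qed

text \<open>The 12 is the 6 of \<open>width_measure_le\<close> times the 2 of the width
  \<open>2 * r\<close>; the root is the volume bound for a sublevel set of height r^2/2.\<close>

definition sect_const :: real where
  "sect_const = 12 * 2 ^ DIM('a) * sqrt ((16 * real DIM('a)) ^ DIM('a))"

lemma sect_const_pos: "sect_const > 0"
  by (simp add: sect_const_def)

lemma sect_measure_le:
  assumes p: "p \<in> sub x" and r: "r > 0" "norm x + r < \<rho>" and \<tau>: "\<tau> > 0" "has_contact \<tau> x p"
  shows "\<tau> * measure lebesgue (sect x p r) \<le> sect_const * r ^ (DIM('a) + 1)"
proof -
  let ?n = "DIM('a)"
  define U where "U = {z \<in> cball 0 \<rho>. u z \<le> u x + p \<bullet> (z - x) + r\<^sup>2 / 2}"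
  have xc: "x \<in> cball 0 \<rho>" using r by simp
  have "closed U" unfolding U_def
    by (intro continuous_on_closed_Collect_le continuous_u' cball_subset continuous_intros) auto
  then have cU: "compact U" unfolding U_def
    by (metis (no_types, lifting) U_def bounded_cball bounded_subset compact_eq_bounded_closed mem_Collect_eq subsetI)
  have vU: "convex U"
  proof (rule convexI)
    fix y z and c d :: real assume h: "y \<in> U" "z \<in> U" "0 \<le> c" "0 \<le> d" "c + d = 1"
    then have c: "c = 1 - d" by simp
    have "c *\<^sub>R y + d *\<^sub>R z \<in> cball 0 \<rho>" using h convexD[OF convex_cball, of y 0 \<rho> z c d] by (auto simp: U_def)
    moreover have "u (c *\<^sub>R y + d *\<^sub>R z) \<le> c * u y + d * u z"
      unfolding c using h by (intro u_combination cball_ballD) (auto simp: U_def)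
    moreover have "c * u y + d * u z \<le> c * (u x + p \<bullet> (y - x) + r\<^sup>2 / 2) + d * (u x + p \<bullet> (z - x) + r\<^sup>2 / 2)"
      using h by (intro add_mono mult_left_mono) (auto simp: U_def)
    moreover have "c * (u x + p \<bullet> (y - x) + r\<^sup>2 / 2) + d * (u x + p \<bullet> (z - x) + r\<^sup>2 / 2)
        = u x + p \<bullet> (c *\<^sub>R y + d *\<^sub>R z - x) + r\<^sup>2 / 2"
      unfolding c by (simp add: inner_diff_right inner_add_right field_simps)
    ultimately show "c *\<^sub>R y + d *\<^sub>R z \<in> U" by (simp add: U_def)
  qed
  have sU: "sect x p r \<subseteq> U"
  proof
    fix z assume "z \<in> sect x p r"
    then have "z \<in> cball 0 \<rho>" "bregman u x p z \<le> r\<^sup>2 / 2" by (auto simp: sect_def)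
    moreover have "u z - u x - p \<bullet> (z - x) \<le> bregman u x p z" by (simp add: bregman_def)
    ultimately show "z \<in> U" by (simp add: U_def)
  qed
  have "norm x < \<rho>" using r by simp
  then have iU: "interior U \<noteq> {}" using interior_sect[of x r p] r interior_mono[OF sU] by blast
  have "(measure lebesgue U)\<^sup>2 \<le> (32 * real ?n * (r\<^sup>2 / 2)) ^ ?n"
  proof (rule sublevel_measure_le[OF p _ cU vU iU])
    show "U \<subseteq> ball 0 1" using cball_subset by (auto simp: U_def)
  qed (use r \<rho> in \<open>auto simp: U_def\<close>)
  also have "32 * real ?n * (r\<^sup>2 / 2) = (16 * real ?n) * r\<^sup>2" by simp
  also have "((16 * real ?n) * r\<^sup>2) ^ ?n = (16 * real ?n) ^ ?n * (r ^ ?n)\<^sup>2"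
    by (simp add: power_mult_distrib flip: power_mult) (simp add: mult.commute)
  finally have "sqrt ((measure lebesgue U)\<^sup>2) \<le> sqrt ((16 * real ?n) ^ ?n * (r ^ ?n)\<^sup>2)"
    by (rule real_sqrt_le_mono)
  then have mU: "measure lebesgue U \<le> sqrt ((16 * real ?n) ^ ?n) * r ^ ?n"
    using r by (simp add: real_sqrt_mult)
  obtain e where e: "norm e = 1" "x + \<tau> *\<^sub>R e \<in> cball 0 \<rho>" "u (x + \<tau> *\<^sub>R e) = u x + \<tau> * (p \<bullet> e)"
    using \<tau> by (auto simp: has_contact_def)
  have eU: "x + \<tau> *\<^sub>R e \<in> U" using e by (simp add: U_def)
  \<comment> \<open>Along the contact direction the section has width at most \<open>2 * r\<close>,
    while the far end of the contact, at distance \<open>\<tau>\<close>, still lies in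
    \<open>U\<close>, whose definition has no quadratic term.\<close>
  have "\<bar>e \<bullet> (x + \<tau> *\<^sub>R e - x)\<bar> * measure lebesgue (sect x p r) \<le> 6 * 2 ^ ?n * (2 * r) * measure lebesgue U"
  proof (rule width_measure_le[OF vU lmeasurable_compact[OF cU] compact_sect sU _ _ eU self_in_sect[OF xc]])
    fix s s' assume "s \<in> sect x p r" "s' \<in> sect x p r"
    then have "dist x s \<le> r" "dist x s' \<le> r" using sect_subset_cball[OF p, of r] r by auto
    then have "norm (s - s') \<le> 2 * r" using dist_triangle[of s s' x] by (simp add: dist_norm norm_minus_commute)
    moreover have "e \<bullet> (s - s') \<le> norm e * norm (s - s')" by (rule norm_cauchy_schwarz)
    ultimately show "e \<bullet> (s - s') \<le> 2 * r" using e by simp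
  qed (use r in auto)
  moreover have "e \<bullet> (x + \<tau> *\<^sub>R e - x) = \<tau>" using e by (simp add: dot_square_norm)
  ultimately have "\<tau> * measure lebesgue (sect x p r) \<le> 6 * 2 ^ ?n * (2 * r) * measure lebesgue U"
    using \<tau> by simp
  also have "\<dots> \<le> 6 * 2 ^ ?n * (2 * r) * (sqrt ((16 * real ?n) ^ ?n) * r ^ ?n)"
    using mU r by (intro mult_left_mono) auto
  also have "\<dots> = sect_const * r ^ (?n + 1)" by (simp add: sect_const_def)
  finally show ?thesis .
qed

definition dual_const :: real where
  "dual_const = (2 / DIM('a)^2) ^ DIM('a) / (4 ^ DIM('a) * sect_const)"

lemma dual_const_pos: "dual_const > 0"
  using sect_const_pos by (simp add: dual_const_def)

text \<open>The polar body has volume of order at least r^(2n) divided by that of the section, which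
  is at most of order r^(n+1)/\<open>\<tau>\<close>. The exponent 2n - (n+1) = n - 1 is the
  dimension in the theorem.\<close>

lemma dual_sect_measure_ge:
  assumes p: "p \<in> sub x" and r: "r > 0" "norm x + r < \<rho>" and \<tau>: "\<tau> > 0" "has_contact \<tau> x p"
  shows "measure lebesgue (dual_sect x p r) \<ge> dual_const * \<tau> * r ^ (DIM('a) - 1)"
proof -
  let ?n = "DIM('a)" and ?S = "sect x p r"
  let ?P = "{s. \<forall>y\<in>?S. \<bar>s \<bullet> (y - x)\<bar> \<le> 1}"
  have n: "norm x < \<rho>" "x \<in> cball 0 \<rho>" using r by auto
  have "dual_sect x p r = (\<lambda>s. (r\<^sup>2 / 4) *\<^sub>R s + (p + x)) ` ?P"
  proof (intro equalityI subsetI)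
    fix s assume s: "s \<in> dual_sect x p r"
    have "(4 / r\<^sup>2) *\<^sub>R (s - (p + x)) \<in> ?P"
    proof clarify
      fix y assume "y \<in> ?S"
      then have "\<bar>(s - (p + x)) \<bullet> (y - x)\<bar> \<le> r\<^sup>2 / 4" using s unfolding dual_sect_def by blast
      then show "\<bar>(4 / r\<^sup>2) *\<^sub>R (s - (p + x)) \<bullet> (y - x)\<bar> \<le> 1"
        unfolding inner_scaleR_left abs_mult using r by (simp add: field_simps)
    qed
    moreover have "s = (r\<^sup>2 / 4) *\<^sub>R ((4 / r\<^sup>2) *\<^sub>R (s - (p + x))) + (p + x)" using r by simp
    ultimately show "s \<in> (\<lambda>s. (r\<^sup>2 / 4) *\<^sub>R s + (p + x)) ` ?P" by blast
  next
    fix s assume "s \<in> (\<lambda>s. (r\<^sup>2 / 4) *\<^sub>R s + (p + x)) ` ?P"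
    then obtain s' where s': "s' \<in> ?P" "s = (r\<^sup>2 / 4) *\<^sub>R s' + (p + x)" by blast
    then show "s \<in> dual_sect x p r" using r
      by (auto simp: dual_sect_def abs_mult field_simps intro: order_trans[OF mult_left_mono, of _ 1])
  qed
  then have "measure lebesgue (dual_sect x p r) = (r\<^sup>2 / 4) ^ ?n * measure lebesgue ?P"
    using measure_lebesgue_affine[of "r\<^sup>2 / 4" "p + x" ?P] by simp
  moreover have "(2 / ?n^2) ^ ?n \<le> measure lebesgue ?S * measure lebesgue ?P"
    by (intro polar_product_bounds(2) compact_sect convex_sect interior_sect self_in_sect n r)
  ultimately have a: "(r\<^sup>2 / 4) ^ ?n * (2 / ?n^2) ^ ?n \<le> measure lebesgue ?S * measure lebesgue (dual_sect x p r)"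
    using mult_left_mono[of "(2 / ?n^2) ^ ?n" "measure lebesgue ?S * measure lebesgue ?P" "(r\<^sup>2 / 4) ^ ?n"] r
    by (simp add: mult_ac)
  have "\<tau> * ((r\<^sup>2 / 4) ^ ?n * (2 / ?n^2) ^ ?n) \<le> (\<tau> * measure lebesgue ?S) * measure lebesgue (dual_sect x p r)"
    using mult_left_mono[OF a, of \<tau>] \<tau> by (simp add: mult_ac)
  also have "\<dots> \<le> (sect_const * r ^ (?n + 1)) * measure lebesgue (dual_sect x p r)"
    using sect_measure_le[OF assms] by (intro mult_right_mono) auto
  finally have b: "\<tau> * ((r\<^sup>2 / 4) ^ ?n * (2 / ?n^2) ^ ?n) \<le> (sect_const * r ^ (?n + 1)) * measure lebesgue (dual_sect x p r)" .
  have "(r\<^sup>2 / 4) ^ ?n = r ^ (?n + 1) * r ^ (?n - 1) / 4 ^ ?n"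
  proof -
    have "?n + 1 + (?n - 1) = 2 * ?n" using DIM_positive[where 'a='a] by linarith
    then show ?thesis by (simp only: power_divide power_mult[symmetric] power_add[symmetric])
  qed
  then have "\<tau> * ((r\<^sup>2 / 4) ^ ?n * (2 / ?n^2) ^ ?n) = (sect_const * r ^ (?n + 1)) * (dual_const * \<tau> * r ^ (?n - 1))"
    using sect_const_pos by (simp add: dual_const_def)
  with b have "(sect_const * r ^ (?n + 1)) * (dual_const * \<tau> * r ^ (?n - 1)) \<le> (sect_const * r ^ (?n + 1)) * measure lebesgue (dual_sect x p r)"
    by (simp only:)
  moreover have "sect_const * r ^ (?n + 1) > 0" using sect_const_pos r by simp
  ultimately show ?thesis by (simp only: mult_le_cancel_left_pos)
qed

lemma dual_sect_subset_vimg: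
  assumes p: "p \<in> sub x" and r: "r > 0" "norm x + r < \<rho>"
  shows "dual_sect x p r \<subseteq> vimg (cball x r)"
  using dual_sect_contact[OF assms] sect_subset_cball[OF p, of r] r unfolding vimg_def by fastforce

end

section \<open>Covering the singular set\<close>

lemma sum_const_ennreal: "a \<ge> 0 \<Longrightarrow> (\<Sum>y\<in>Y. ennreal a) = ennreal (real (card Y) * a)"
  by (simp add: ennreal_of_nat_eq_real_of_nat ennreal_mult)

text \<open>Closed dyadic shells around \<open>C\<close>; neighbours share a boundary, hence the two
  indices. Compact pieces are wanted because the passage from neighbourhoods to a set requires the
  set to be closed.\<close>

lemma annuli_cover:
  fixes F C :: "'a::euclidean_space set"
  assumes F: "compact F" and C: "closed C"
  obtains A :: "nat \<Rightarrow> 'a set" where "\<And>k. compact (A k)" "\<And>k. A k \<subseteq> F - C" "F - C \<subseteq> (\<Union>k. A k)"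
    "\<And>y. \<exists>m. {k. y \<in> A k} \<subseteq> {m, Suc m}"
proof (cases "C = {}")
  \<comment> \<open>\<open>infdist\<close> to the empty set is 0, so the shells would miss
    everything; here \<open>F\<close> itself is the only nonempty piece.\<close>
  case True
  show ?thesis
  proof (rule that[of "\<lambda>k. if k = 0 then F else {}"])
    show "\<exists>m. {k. y \<in> (if k = 0 then F else {})} \<subseteq> {m, Suc m}" for y
      by (intro exI[of _ 0]) (auto split: if_splits)
  qed (use F True in \<open>auto split: if_splits\<close>)
next
  case False
  define g where "g x = min 1 (infdist x C)" for x
  have g: "continuous_on UNIV g" unfolding g_def by (intro continuous_intros)
  have g0: "g x \<le> 0 \<longleftrightarrow> x \<in> C" for x
  proof -
    have "g x \<le> 0 \<longleftrightarrow> infdist x C = 0"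
      using infdist_nonneg[of x C] by (simp add: g_def min_le_iff_disj order_antisym_conv)
    then show ?thesis using in_closed_iff_infdist_zero[OF C False] by simp
  qed
  define A where "A k = {x \<in> F. (1/2) ^ Suc k \<le> g x} \<inter> {x \<in> F. g x \<le> (1/2) ^ k}" for k :: nat
  show ?thesis
  proof (rule that[of A])
    fix k
    have "closed (A k)" unfolding A_def
      by (intro closed_Int continuous_on_closed_Collect_le continuous_on_subset[OF g] continuous_intros compact_imp_closed F) auto
    moreover have "A k = F \<inter> A k" by (auto simp: A_def)
    ultimately show "compact (A k)" using F by (metis compact_Int_closed)
    have "g x > 0" if "x \<in> A k" for x
      using that by (auto simp: A_def intro: less_le_trans[of 0 "(1/2) ^ Suc k"])
    then show "A k \<subseteq> F - C" using g0 by (force simp: A_def)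
  next
    show "F - C \<subseteq> (\<Union>k. A k)"
    proof
      fix x assume x: "x \<in> F - C"
      then have gx: "g x > 0" using g0 by force
      obtain n where "(1/2) ^ n < g x" using real_arch_pow_inv[OF gx, of "1/2"] by auto
      then have ex: "\<exists>n. (1/2) ^ n \<le> g x" by (meson less_imp_le)
      define n where "n = (LEAST n. (1/2) ^ n \<le> g x)"
      have n: "(1/2) ^ n \<le> g x" unfolding n_def using ex by (rule LeastI_ex)
      show "x \<in> (\<Union>k. A k)"
      proof (cases n)
        case 0
        then have "g x = 1" using n by (simp add: g_def)
        then have "x \<in> A 0" using x by (simp add: A_def)
        then show ?thesis by blast
      next
        case (Suc m)
        then have "\<not> (1/2) ^ m \<le> g x" unfolding n_def by (metis lessI not_less_Least)
        then have "x \<in> A m" using x n Suc by (simp add: A_def)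
        then show ?thesis by blast
      qed
    qed
    fix y
    show "\<exists>m. {k. y \<in> A k} \<subseteq> {m, Suc m}"
    proof (cases "\<exists>k. y \<in> A k")
      case True
      define m where "m = (LEAST k. y \<in> A k)"
      have m: "y \<in> A m" unfolding m_def using True by (rule LeastI_ex)
      have "k \<in> {m, Suc m}" if k: "y \<in> A k" for k
      proof (rule ccontr)
        assume "k \<notin> {m, Suc m}"
        moreover have "m \<le> k" unfolding m_def using k by (rule Least_le)
        ultimately have "Suc m < k" by auto
        then have "(1/2::real) ^ k < (1/2) ^ Suc m" by (intro power_strict_decreasing) auto
        moreover have "(1/2) ^ Suc m \<le> g y" "g y \<le> (1/2) ^ k" using m k unfolding A_def by blast+
        ultimately show False by linarith
      qed
      then show ?thesis by blast
    qed auto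
  qed
qed

context alexandrov_on_unit_ball
begin

lemma dual_sect_measure_le_vimg:
  assumes p: "p \<in> sub x" and r: "r > 0" "norm x0 + 2 * r \<le> \<rho>" "norm x + r < \<rho>" and x: "x \<in> cball x0 r"
  shows "dual_sect x p r \<subseteq> vimg (cball x0 (2 * r))" "vimg (cball x0 (2 * r)) \<in> lmeasurable"
proof -
  have "cball x r \<subseteq> cball x0 (2 * r)"
  proof
    fix z assume "z \<in> cball x r"
    then show "z \<in> cball x0 (2 * r)" using x dist_triangle[of x0 z x] by simp
  qed
  then show "dual_sect x p r \<subseteq> vimg (cball x0 (2 * r))"
    using dual_sect_subset_vimg[OF p r(1,3)] vimg_mono by blast
  have "cball x0 (2 * r) \<subseteq> cball 0 \<rho>" using r by (simp add: cball_subset_cball_iff)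
  then show "vimg (cball x0 (2 * r)) \<in> lmeasurable" by (intro vimg_lmeasurable) auto
qed

text \<open>Choose a maximal set of points whose polar bodies pairwise overlap little. Each body has
  measure at least \<open>c * q\<close>, where \<open>q\<close> is r^(n-1), and all lie in a set of
  measure at most \<open>M * q\<close>, so there are at most \<open>N\<close>. The body of any other
  point overlaps one of them in a fixed proportion, and \<open>sections_comparable\<close> puts that
  point into the enlarged section.\<close>

lemma local_section_cover:
  assumes \<tau>: "\<tau> > 0" and M: "M > 0"
  obtains N :: nat and L where "L > 0" "\<forall>E pf x0 r. 0 < r \<longrightarrow> norm x0 + 2 * r \<le> \<rho> \<longrightarrow>
      (\<forall>x\<in>E. norm x + r < \<rho> \<and> pf x \<in> sub x \<and> has_contact \<tau> x (pf x)) \<longrightarrow>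
      measure lebesgue (vimg (cball x0 (2 * r))) \<le> M * r ^ (DIM('a) - 1) \<longrightarrow>
      (\<exists>X. finite X \<and> X \<subseteq> E \<and> card X \<le> N \<and> E \<inter> cball x0 r \<subseteq> (\<Union>x\<in>X. sect x (pf x) (L * r)))"
proof -
  define c where "c = dual_const * \<tau>"
  have c: "c > 0" using dual_const_pos \<tau> by (simp add: c_def)
  define N where "N = nat \<lfloor>2 * M / c\<rfloor>"
  have N: "2 * M / c < real N + 1" unfolding N_def using M c by simp
  \<comment> \<open>With this \<open>k\<close>, each of \<open>N + 1\<close> bodies loses at most
    half of \<open>c * q\<close> to overlaps with the others.\<close>
  define k where "k = c / (2 * (real N + 1))"
  have k: "k > 0" using c by (simp add: k_def)
  define K where "K = 1 + 3 * 2 ^ DIM('a) / (k / M)"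
  have K: "K > 0" using k M by (simp add: K_def add_pos_pos)
  \<comment> \<open>The section of radius \<open>L * r\<close> has height
    \<open>K * r\<^sup>2\<close>, the level that \<open>sections_comparable\<close>
    provides.\<close>
  define L where "L = sqrt (2 * K)"
  have L: "L > 0" "L\<^sup>2 = 2 * K" using K by (auto simp: L_def)
  have "\<exists>X. finite X \<and> X \<subseteq> E \<and> card X \<le> N \<and> E \<inter> cball x0 r \<subseteq> (\<Union>x\<in>X. sect x (pf x) (L * r))"
    if r: "0 < r" "norm x0 + 2 * r \<le> \<rho>"
      and E: "\<forall>x\<in>E. norm x + r < \<rho> \<and> pf x \<in> sub x \<and> has_contact \<tau> x (pf x)"
      and m: "measure lebesgue (vimg (cball x0 (2 * r))) \<le> M * r ^ (DIM('a) - 1)" for E pf x0 r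
  proof -
    define q where "q = r ^ (DIM('a) - 1)"
    have q: "q > 0" using r by (simp add: q_def)
    let ?V = "vimg (cball x0 (2 * r))"
    define P where "P x = dual_sect x (pf x) r" for x
    have PV: "P x \<subseteq> ?V" "?V \<in> lmeasurable" if "x \<in> E \<inter> cball x0 r" for x
      using dual_sect_measure_le_vimg[of "pf x" x r x0] that E r by (auto simp: P_def)
    have PL: "P x \<in> lmeasurable" if "x \<in> E" for x
    proof -
      have "norm x < \<rho>" using E that r by force
      then show ?thesis unfolding P_def using r by (intro lmeasurable_compact compact_dual_sect)
    qed
    have Pc: "c * q \<le> measure lebesgue (P x)" if "x \<in> E" for x
      using dual_sect_measure_ge[of "pf x" x r \<tau>] that E r \<tau> by (simp add: P_def c_def q_def)
    let ?R = "\<lambda>x y. measure lebesgue (P x \<inter> P y) < k * q"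
    have bd: "card T \<le> N" if T: "finite T" "T \<subseteq> E \<inter> cball x0 r" "pairwise ?R T" for T
    proof (rule ccontr)
      assume "\<not> card T \<le> N"
      then have "Suc N \<le> card T" by simp
      then obtain T' where T': "T' \<subseteq> T" "card T' = Suc N" "finite T'" by (metis obtain_subset_with_card_n)
      then obtain x1 where x1: "x1 \<in> T'" by (metis card.empty ex_in_conv nat.distinct(1))
      have "real (card T') * ((c * q) / 2) \<le> measure lebesgue ?V"
      proof (rule card_le_of_small_overlaps[where k = "k * q" and P = P])
        show "?V \<in> lmeasurable" using PV(2) x1 T' T by blast
        show "P x \<in> lmeasurable" "P x \<subseteq> ?V" "c * q \<le> measure lebesgue (P x)" if "x \<in> T'" for x
          using PV PL Pc that T' T by blast+
        show "measure lebesgue (P x \<inter> P y) \<le> k * q" if "x \<in> T'" "y \<in> T'" "x \<noteq> y" for x y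
          using T(3) T'(1) that unfolding pairwise_def by (meson less_imp_le subsetD)
        show "real (card T') * (k * q) \<le> (c * q) / 2" using T'(2) c q by (simp add: k_def field_simps)
      qed (use T' k q in auto)
      also have "\<dots> \<le> M * q" using m by (simp add: q_def)
      finally have "((real N + 1) * c) * q \<le> (2 * M) * q" using T'(2) by (simp add: algebra_simps)
      then have "(real N + 1) * c \<le> 2 * M" using q by (simp only: mult_le_cancel_right_pos)
      then show False using N c by (simp add: field_simps)
    qed
    obtain X where X: "finite X" "X \<subseteq> E \<inter> cball x0 r" "pairwise ?R X"
        "\<And>x. x \<in> E \<inter> cball x0 r \<Longrightarrow> x \<in> X \<or> (\<exists>t\<in>X. \<not> ?R t x)"
      by (rule maximal_pairwise_subset[of ?R "E \<inter> cball x0 r" N]) (use bd in \<open>auto simp: Int_commute\<close>)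
    have "E \<inter> cball x0 r \<subseteq> (\<Union>x\<in>X. sect x (pf x) (L * r))"
    proof
      fix y assume y: "y \<in> E \<inter> cball x0 r"
      then have yc: "y \<in> cball 0 \<rho>" using E r by force
      from X(4)[OF y] show "y \<in> (\<Union>x\<in>X. sect x (pf x) (L * r))"
      proof
        assume "y \<in> X"
        then show ?thesis using self_in_sect[OF yc] by blast
      next
        assume "\<exists>t\<in>X. \<not> ?R t y"
        then obtain t where t: "t \<in> X" "measure lebesgue (P t \<inter> P y) \<ge> k * q" by force
        have tE: "t \<in> E \<inter> cball x0 r" using t X by blast
        have "measure lebesgue (P t) \<le> measure lebesgue ?V"
          using PV[OF tE] PL[of t] tE by (intro measure_mono_fmeasurable) auto
        then have Pt: "measure lebesgue (P t) \<le> M * q" using m by (simp add: q_def)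
        have "k / M * measure lebesgue (P t) \<le> k / M * (M * q)"
          using Pt k M by (intro mult_left_mono) auto
        then have ov: "k / M * measure lebesgue (P t) \<le> measure lebesgue (P t \<inter> P y)" using t(2) M by simp
        have pos: "measure lebesgue (P t) > 0"
          using Pc[of t] tE c q by (meson IntD1 less_le_trans mult_pos_pos)
        have "bregman u t (pf t) y \<le> r\<^sup>2 * K"
          unfolding K_def using E tE y r k M ov pos
          by (intro sections_comparable[where ?p2.0 = "pf y"]) (auto simp: P_def)
        then have "y \<in> sect t (pf t) (L * r)" using yc by (simp add: sect_def power_mult_distrib L mult.commute)
        then show ?thesis using t by blast
      qed
    qed
    then show ?thesis using X bd[OF X(1-3)] by blast
  qed
  then show ?thesis by (intro that[OF L(1)] allI impI)
qed

section \<open>Cost of covering, compared with mass\<close>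

definition fat_const :: real where
  "fat_const = hausdorff_const (DIM('a) - 1) * 4 ^ DIM('a) * sect_const / unit_ball_vol DIM('a)"

lemma fat_const_pos: "fat_const > 0"
  using hausdorff_const_pos sect_const_pos by (simp add: fat_const_def)

lemma hausdorff_pre_fat_sect_le:
  assumes p: "p \<in> sub x" and r: "r > 0" "norm x + r < \<rho>" and \<tau>: "\<tau> > 0" "has_contact \<tau> x p"
    and R: "R > 0" "fat R r x p" and \<delta>: "2 * r \<le> \<delta>"
  shows "hausdorff_pre (DIM('a) - 1) \<delta> (sect x p r) \<le> ennreal (fat_const / (\<tau> * R) * r ^ (DIM('a) - 1))"
proof -
  let ?n = "DIM('a)" and ?S = "sect x p r"
  define d where "d = R * r\<^sup>2"
  have d: "d > 0" using R r by (simp add: d_def)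
  obtain y where y: "cball y d \<subseteq> ?S" using R by (auto simp: fat_def d_def)
  then have "cball y d \<subseteq> cball x r" using sect_subset_cball[OF p, of r] r by auto
  \<comment> \<open>The inscribed ball lies in \<open>cball x r\<close>, so \<open>d\<close> is at
    most \<open>r\<close> and the covering balls have diameter at most
    \<open>\<delta>\<close>.\<close>
  then have dr: "d \<le> r" using d by (simp add: cball_subset_cball_iff) (smt (verit) zero_le_dist)
  obtain T where T: "finite T" "?S \<subseteq> (\<Union>t\<in>T. cball t d)"
    "real (card T) * (unit_ball_vol ?n * d ^ ?n) \<le> 4 ^ ?n * measure lebesgue ?S"
    using convex_cover_by_balls[OF compact_sect convex_sect d y] by blast
  have "hausdorff_pre (?n - 1) \<delta> ?S \<le> hausdorff_pre (?n - 1) \<delta> (\<Union>t\<in>T. cball t d)"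
    using T(2) by (rule hausdorff_pre_mono)
  also have "\<dots> \<le> (\<Sum>t\<in>T. hausdorff_pre (?n - 1) \<delta> (cball t d))"
    using T(1) \<delta> r by (intro hausdorff_pre_finite_UN_le) auto
  also have "\<dots> \<le> (\<Sum>t\<in>T. ennreal (hausdorff_const (?n - 1) * d ^ (?n - 1)))"
    using d dr \<delta> by (intro sum_mono hausdorff_pre_cball_le) auto
  also have "\<dots> = ennreal (real (card T) * (hausdorff_const (?n - 1) * d ^ (?n - 1)))"
    using d hausdorff_const_pos[of "?n - 1"] by (intro sum_const_ennreal) simp
  also have "\<dots> \<le> ennreal (fat_const / (\<tau> * R) * r ^ (?n - 1))"
  proof (rule ennreal_leI)
    let ?H = "hausdorff_const (?n - 1)" and ?w = "unit_ball_vol (real ?n)"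
    have w: "?w > 0" by simp
    have dn: "d ^ ?n = d * d ^ (?n - 1)"
      using power_minus_mult[OF DIM_positive[where 'a='a], of d] by (simp add: mult.commute)
    have rn: "r ^ (?n + 1) = r\<^sup>2 * r ^ (?n - 1)"
      using power_minus_mult[OF DIM_positive[where 'a='a], of r] by (simp add: power2_eq_square mult_ac)
    have "\<tau> * (real (card T) * (?w * d ^ ?n)) \<le> 4 ^ ?n * (\<tau> * measure lebesgue ?S)"
      using mult_left_mono[OF T(3), of \<tau>] \<tau> by (simp add: mult_ac)
    also have "\<dots> \<le> 4 ^ ?n * (sect_const * r ^ (?n + 1))"
      using sect_measure_le[OF p r \<tau>] by (intro mult_left_mono) auto
    finally have "r\<^sup>2 * (\<tau> * R * ?w * (real (card T) * d ^ (?n - 1))) \<le> r\<^sup>2 * (4 ^ ?n * sect_const * r ^ (?n - 1))"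
      unfolding dn rn by (simp add: d_def mult_ac)
    then have "\<tau> * R * ?w * (real (card T) * d ^ (?n - 1)) \<le> 4 ^ ?n * sect_const * r ^ (?n - 1)"
      using r by (simp add: mult_le_cancel_left)
    then have "real (card T) * d ^ (?n - 1) \<le> 4 ^ ?n * sect_const * r ^ (?n - 1) / (\<tau> * R * ?w)"
      using \<tau> R w by (simp add: pos_le_divide_eq mult_ac)
    then have "?H * (real (card T) * d ^ (?n - 1)) \<le> ?H * (4 ^ ?n * sect_const * r ^ (?n - 1) / (\<tau> * R * ?w))"
      using hausdorff_const_pos[of "?n - 1"] by (intro mult_left_mono) auto
    then show "real (card T) * (?H * d ^ (?n - 1)) \<le> fat_const / (\<tau> * R) * r ^ (?n - 1)"
      by (simp add: fat_const_def mult_ac)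
  qed
  finally show ?thesis .
qed

definition nbhd :: "real \<Rightarrow> 'a set \<Rightarrow> 'a set" where
  "nbhd \<beta> E = {y \<in> cball 0 \<rho>. infdist y E \<le> \<beta>}"

lemma vimg_nbhd_lmeasurable: "vimg (nbhd \<beta> E) \<in> lmeasurable"
proof (rule vimg_lmeasurable)
  show "closed (nbhd \<beta> E)" unfolding nbhd_def
    by (intro continuous_on_closed_Collect_le continuous_intros) auto
qed (auto simp: nbhd_def)

text \<open>A slope belongs to one point \<open>y\<close>, so it is counted once for each centre
  within \<open>2 * r\<close> of \<open>y\<close>. Such centres are \<open>r\<close>-separated, and
  comparing balls of radius r/2 with one of radius 5r/2 allows at most 5^n of them.\<close>

lemma sum_vimg_cball_le:
  assumes X: "finite X" "pairwise (\<lambda>x y. dist x y \<ge> r) X" "X \<subseteq> E" and r: "r > 0" "2 * r \<le> \<beta>"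
    and \<rho>X: "\<And>x. x \<in> X \<Longrightarrow> cball x (2 * r) \<subseteq> cball 0 \<rho>"
  shows "(\<Sum>x\<in>X. measure lebesgue (vimg (cball x (2 * r)))) \<le> 5 ^ DIM('a) * measure lebesgue (vimg (nbhd \<beta> E))"
proof (rule sum_measure_le_overlap[OF X(1)])
  show "vimg (cball x (2 * r)) \<in> lmeasurable" if "x \<in> X" for x
    using \<rho>X[OF that] by (intro vimg_lmeasurable) auto
  show "vimg (cball x (2 * r)) \<subseteq> vimg (nbhd \<beta> E)" if "x \<in> X" for x
  proof (rule vimg_mono, rule)
    fix y assume y: "y \<in> cball x (2 * r)"
    have "infdist y E \<le> dist y x" using X(3) that by (intro infdist_le) auto
    then show "y \<in> nbhd \<beta> E" using y r \<rho>X[OF that] by (auto simp: nbhd_def dist_commute)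
  qed
  show "vimg (nbhd \<beta> E) \<in> lmeasurable" by (rule vimg_nbhd_lmeasurable)
  fix s assume "s \<in> vimg (nbhd \<beta> E)"
  then obtain y where y: "y \<in> cball 0 \<rho>" "s - y \<in> sub y" by (auto simp: vimg_def nbhd_def)
  let ?T = "{x \<in> X. s \<in> vimg (cball x (2 * r))}"
  have T: "dist x y \<le> 2 * r" if x: "x \<in> ?T" for x
  proof -
    obtain y' where y': "y' \<in> cball x (2 * r)" "s - y' \<in> sub y'" using x by (auto simp: vimg_def)
    have "y' = y"
      using x \<rho>X[of x] y'(1) by (intro vimg_unique[OF cball_ballD cball_ballD y'(2) y(2)] y(1)) auto
    then show ?thesis using y' by simp
  qed
  have "real (card ?T) * (unit_ball_vol DIM('a) * (r/2) ^ DIM('a)) \<le> measure lebesgue (cball y (5 * (r/2)))"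
  proof (rule packing_bound)
    show "pairwise (\<lambda>x y. dist x y \<ge> r) ?T" using X(2) by (rule pairwise_subset) auto
    show "ball t (r/2) \<subseteq> cball y (5 * (r/2))" if "t \<in> ?T" for t
    proof
      fix z assume z: "z \<in> ball t (r/2)"
      have "dist y z \<le> dist y t + dist t z" by (rule dist_triangle)
      then show "z \<in> cball y (5 * (r/2))" using z T[OF that] by (simp add: dist_commute)
    qed
  qed (use X r in auto)
  also have "\<dots> = 5 ^ DIM('a) * (unit_ball_vol DIM('a) * (r/2) ^ DIM('a))"
    using r by (simp add: content_cball power_mult_distrib power_divide)
  finally have "real (card ?T) * (unit_ball_vol DIM('a) * (r/2) ^ DIM('a)) \<le> 5 ^ DIM('a) * (unit_ball_vol DIM('a) * (r/2) ^ DIM('a))" .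
  moreover have "unit_ball_vol DIM('a) * (r/2) ^ DIM('a) > 0" using r by simp
  ultimately show "real (card ?T) \<le> 5 ^ DIM('a)" by (simp only: mult_le_cancel_right_pos)
qed

text \<open>In each ball of a separated cover the cost is at most \<open>\<eta>'\<close> times the
  mass of the doubled ball: for large mass the ball itself is used, for small mass at most
  \<open>N\<close> fat sections. Summing costs a factor 5^n, built into \<open>\<eta>'\<close>.
  \<open>R\<close> is fixed before \<open>r0\<close>, \<open>E\<close>, \<open>\<delta>\<close> and
  \<open>\<beta>\<close>, as the later exhaustion requires.\<close>

lemma hausdorff_pre_le_vimg_nbhd:
  assumes \<sigma>: "0 \<le> \<sigma>" "\<sigma> < \<rho>" and \<tau>: "\<tau> > 0" and \<eta>: "\<eta> > 0"
  obtains R where "R > 0" "\<forall>r0 E \<delta> \<beta>. r0 > 0 \<longrightarrow> E \<subseteq> fat_contact_set \<sigma> \<tau> R r0 \<longrightarrow> \<delta> > 0 \<longrightarrow> \<beta> > 0 \<longrightarrow>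
     hausdorff_pre (DIM('a) - 1) \<delta> E \<le> ennreal (\<eta> * measure lebesgue (vimg (nbhd \<beta> E)))"
proof -
  let ?s = "DIM('a) - 1"
  define \<eta>' where "\<eta>' = \<eta> / 5 ^ DIM('a)"
  have \<eta>': "\<eta>' > 0" using \<eta> by (simp add: \<eta>'_def)
  \<comment> \<open>Above mass \<open>M * r ^ ?s\<close>, covering by the ball itself costs at most
    \<open>\<eta>'\<close> times the mass.\<close>
  define M where "M = hausdorff_const ?s / \<eta>'"
  have M: "M > 0" using hausdorff_const_pos \<eta>' by (simp add: M_def)
  obtain N :: nat and L where L: "L > 0" and NL: "\<forall>E pf x0 r. 0 < r \<longrightarrow> norm x0 + 2 * r \<le> \<rho> \<longrightarrow>
      (\<forall>x\<in>E. norm x + r < \<rho> \<and> pf x \<in> sub x \<and> has_contact \<tau> x (pf x)) \<longrightarrow>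
      measure lebesgue (vimg (cball x0 (2 * r))) \<le> M * r ^ ?s \<longrightarrow>
      (\<exists>X. finite X \<and> X \<subseteq> E \<and> card X \<le> N \<and> E \<inter> cball x0 r \<subseteq> (\<Union>x\<in>X. sect x (pf x) (L * r)))"
    by (rule local_section_cover[OF \<tau> M])
  define c where "c = dual_const * \<tau>"
  have c: "c > 0" using dual_const_pos \<tau> by (simp add: c_def)
  define Q where "Q = real N * (fat_const / \<tau> * L ^ ?s)"
  have Q: "Q \<ge> 0" using fat_const_pos \<tau> L by (simp add: Q_def)
  \<comment> \<open>Makes the cost \<open>Q / R * r ^ ?s\<close> of the sections at most
    \<open>\<eta>'\<close> times the least possible mass \<open>c * r ^ ?s\<close>. The added 1
    keeps \<open>R\<close> positive if \<open>Q\<close> vanishes.\<close>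
  define R where "R = Q / (c * \<eta>') + 1"
  have R: "R > 0" using Q c \<eta>' by (simp add: R_def add_nonneg_pos)
  have QR: "Q / R \<le> \<eta>' * c"
  proof -
    have "Q = (Q / (c * \<eta>')) * (c * \<eta>')" using c \<eta>' by simp
    also have "\<dots> \<le> R * (c * \<eta>')" using c \<eta>' by (intro mult_right_mono) (auto simp: R_def)
    finally show ?thesis using R by (simp add: field_simps)
  qed
  have "hausdorff_pre ?s \<delta> E \<le> ennreal (\<eta> * measure lebesgue (vimg (nbhd \<beta> E)))"
    if r0: "r0 > 0" and E: "E \<subseteq> fat_contact_set \<sigma> \<tau> R r0" and \<delta>: "\<delta> > 0" and \<beta>: "\<beta> > 0" for r0 E \<delta> \<beta>
  proof -
    define g where "g = \<rho> - \<sigma>"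
    have g: "g > 0" using \<sigma> by (simp add: g_def)
    \<comment> \<open>The entries keep the doubled balls in the neighbourhood, the balls and then
      the sections of diameter at most \<open>\<delta>\<close>, the sections at fat scales, and the
      balls and sections within radius \<open>\<rho>\<close>.\<close>
    define r where "r = Min {\<beta> / 2, \<delta> / 2, \<delta> / (2 * L), r0 / L, g / 3, g / (2 * L)}"
    have r: "r > 0" using \<beta> \<delta> L r0 g by (simp add: r_def)
    have "r \<le> \<beta> / 2" "r \<le> \<delta> / 2" "r \<le> \<delta> / (2 * L)" "r \<le> r0 / L" "r \<le> g / 3" "r \<le> g / (2 * L)"
      unfolding r_def by (intro Min_le; simp)+
    then have rb: "2 * r \<le> \<beta>" "2 * r \<le> \<delta>" "2 * (L * r) \<le> \<delta>" "L * r \<le> r0" "3 * r \<le> g" "2 * (L * r) \<le> g"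
      using L by (auto simp: field_simps)
    then have rg: "2 * r < g" "L * r < g" using r g mult_pos_pos[OF L r] by linarith+
    have "\<forall>x\<in>E. \<exists>p. p \<in> sub x \<and> has_contact \<tau> x p \<and> (\<forall>r. 0 < r \<and> r \<le> r0 \<longrightarrow> fat R r x p)"
      using E by (auto simp: fat_contact_set_def)
    then obtain pf where pf0: "\<forall>x\<in>E. pf x \<in> sub x \<and> has_contact \<tau> x (pf x) \<and> (\<forall>r. 0 < r \<and> r \<le> r0 \<longrightarrow> fat R r x (pf x))"
      using bchoice[of E "\<lambda>x p. p \<in> sub x \<and> has_contact \<tau> x p \<and> (\<forall>r. 0 < r \<and> r \<le> r0 \<longrightarrow> fat R r x p)"] by blast
    then have pf: "pf x \<in> sub x" "has_contact \<tau> x (pf x)" "fat R (L * r) x (pf x)" if "x \<in> E" for x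
      using that rb(4) mult_pos_pos[OF L r] by auto
    have nE: "norm x \<le> \<sigma>" if "x \<in> E" for x using E that by (auto simp: fat_contact_set_def)
    have "bounded E" using nE by (auto simp: bounded_iff)
    then obtain X where X: "finite X" "X \<subseteq> E" "pairwise (\<lambda>x y. dist x y \<ge> r) X" "E \<subseteq> (\<Union>t\<in>X. cball t r)"
      using maximal_separated_subset[OF _ r] by blast
    define m where "m x = measure lebesgue (vimg (cball x (2 * r)))" for x
    have m0: "m x \<ge> 0" for x by (simp add: m_def)
    have local: "hausdorff_pre ?s \<delta> (E \<inter> cball x r) \<le> ennreal (\<eta>' * m x)" if x: "x \<in> X" for x
    proof (cases "m x \<le> M * r ^ ?s")
      case False
      have "hausdorff_pre ?s \<delta> (E \<inter> cball x r) \<le> hausdorff_pre ?s \<delta> (cball x r)"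
        by (rule hausdorff_pre_mono) auto
      also have "\<dots> \<le> ennreal (hausdorff_const ?s * r ^ ?s)" using r rb by (intro hausdorff_pre_cball_le) auto
      also have "\<dots> \<le> ennreal (\<eta>' * m x)"
      proof (rule ennreal_leI)
        have "hausdorff_const ?s * r ^ ?s = \<eta>' * (M * r ^ ?s)" using \<eta>' by (simp add: M_def)
        also have "\<dots> \<le> \<eta>' * m x" using False \<eta>' by (intro mult_left_mono) auto
        finally show "hausdorff_const ?s * r ^ ?s \<le> \<eta>' * m x" .
      qed
      finally show ?thesis .
    next
      case True
      have xE: "x \<in> E" using x X by blast
      have nx: "norm x + 2 * r \<le> \<rho>" "norm x + r < \<rho>" using nE[OF xE] rg r by (auto simp: g_def)
      have "norm y + r < \<rho> \<and> pf y \<in> sub y \<and> has_contact \<tau> y (pf y)" if "y \<in> E" for y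
        using nE[OF that] pf that rg r by (auto simp: g_def)
      then have Ey: "\<forall>y\<in>E. norm y + r < \<rho> \<and> pf y \<in> sub y \<and> has_contact \<tau> y (pf y)" by blast
      obtain Y where Y: "finite Y" "Y \<subseteq> E" "card Y \<le> N" "E \<inter> cball x r \<subseteq> (\<Union>y\<in>Y. sect y (pf y) (L * r))"
        using mp[OF mp[OF mp[OF mp[OF spec[OF spec[OF spec[OF spec[OF NL, of E], of pf], of x], of r] r] nx(1)] Ey] True[unfolded m_def]]
        by (elim exE conjE)
      have "hausdorff_pre ?s \<delta> (E \<inter> cball x r) \<le> hausdorff_pre ?s \<delta> (\<Union>y\<in>Y. sect y (pf y) (L * r))"
        using Y(4) by (rule hausdorff_pre_mono)
      also have "\<dots> \<le> (\<Sum>y\<in>Y. hausdorff_pre ?s \<delta> (sect y (pf y) (L * r)))"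
        using Y(1) \<delta> by (rule hausdorff_pre_finite_UN_le)
      also have "\<dots> \<le> (\<Sum>y\<in>Y. ennreal (fat_const / (\<tau> * R) * (L * r) ^ ?s))"
      proof (rule sum_mono)
        fix y assume "y \<in> Y"
        then have y: "y \<in> E" using Y by blast
        then show "hausdorff_pre ?s \<delta> (sect y (pf y) (L * r)) \<le> ennreal (fat_const / (\<tau> * R) * (L * r) ^ ?s)"
          using pf nE[OF y] rg rb L r R \<tau> by (intro hausdorff_pre_fat_sect_le) (auto simp: g_def)
      qed
      also have "\<dots> = ennreal (real (card Y) * (fat_const / (\<tau> * R) * (L * r) ^ ?s))"
        using fat_const_pos \<tau> R L r by (intro sum_const_ennreal) simp
      also have "\<dots> \<le> ennreal (\<eta>' * m x)"
      proof (rule ennreal_leI)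
        have "real (card Y) * (fat_const / (\<tau> * R) * (L * r) ^ ?s) \<le> real N * (fat_const / (\<tau> * R) * (L * r) ^ ?s)"
          using Y(3) fat_const_pos \<tau> R L r by (intro mult_right_mono) auto
        also have "\<dots> = Q / R * r ^ ?s" by (simp add: Q_def power_mult_distrib)
        also have "\<dots> \<le> \<eta>' * c * r ^ ?s" using QR r by (intro mult_right_mono) auto
        also have "\<dots> = \<eta>' * (c * r ^ ?s)" by simp
        \<comment> \<open>The centre is itself a contact point, so its polar body already supplies
          this mass.\<close>
        also have "\<dots> \<le> \<eta>' * m x"
        proof (rule mult_left_mono)
          have xr: "x \<in> cball x r" using r by simp
          have "c * r ^ ?s \<le> measure lebesgue (dual_sect x (pf x) r)"
            using dual_sect_measure_ge[OF pf(1)[OF xE] r nx(2) \<tau> pf(2)[OF xE]] by (simp add: c_def)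
          also have "\<dots> \<le> m x" unfolding m_def
            using dual_sect_measure_le_vimg[OF pf(1)[OF xE] r nx xr] compact_dual_sect[of x r "pf x"] nx r
            by (intro measure_mono_fmeasurable) (auto intro!: fmeasurableD lmeasurable_compact)
          finally show "c * r ^ ?s \<le> m x" .
        qed (use \<eta>' in auto)
        finally show "real (card Y) * (fat_const / (\<tau> * R) * (L * r) ^ ?s) \<le> \<eta>' * m x" .
      qed
      finally show ?thesis .
    qed
    have "hausdorff_pre ?s \<delta> E \<le> hausdorff_pre ?s \<delta> (\<Union>x\<in>X. E \<inter> cball x r)"
      using X(4) by (intro hausdorff_pre_mono) blast
    also have "\<dots> \<le> (\<Sum>x\<in>X. hausdorff_pre ?s \<delta> (E \<inter> cball x r))"
      using X(1) \<delta> by (rule hausdorff_pre_finite_UN_le)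
    also have "\<dots> \<le> (\<Sum>x\<in>X. ennreal (\<eta>' * m x))" using local by (rule sum_mono)
    also have "\<dots> = ennreal (\<eta>' * (\<Sum>x\<in>X. m x))"
      using \<eta>' m0 by (simp add: sum_distrib_left)
    also have "\<dots> \<le> ennreal (\<eta> * measure lebesgue (vimg (nbhd \<beta> E)))"
    proof (rule ennreal_leI)
      have "(\<Sum>x\<in>X. m x) \<le> 5 ^ DIM('a) * measure lebesgue (vimg (nbhd \<beta> E))"
        unfolding m_def
      proof (rule sum_vimg_cball_le[OF X(1,3,2) r rb(1)])
        fix x assume "x \<in> X"
        then have "norm x + 2 * r \<le> \<rho>" using nE[of x] X rg by (auto simp: g_def)
        then show "cball x (2 * r) \<subseteq> cball 0 \<rho>" by (simp add: cball_subset_cball_iff)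
      qed
      then have "\<eta>' * (\<Sum>x\<in>X. m x) \<le> \<eta>' * (5 ^ DIM('a) * measure lebesgue (vimg (nbhd \<beta> E)))"
        using \<eta>' by (intro mult_left_mono) auto
      then show "\<eta>' * (\<Sum>x\<in>X. m x) \<le> \<eta> * measure lebesgue (vimg (nbhd \<beta> E))" by (simp add: \<eta>'_def)
    qed
    finally show ?thesis .
  qed
  then show ?thesis by (intro that[OF R] allI impI)
qed

text \<open>A slope in the images of all neighbourhoods has the same point each time, at distance 0
  from \<open>E\<close>. So the images decrease to \<open>vimg E\<close>, and continuity from above
  applies.\<close>

lemma vimg_nbhd_tendsto:
  assumes E: "closed E" "E \<noteq> {}" "E \<subseteq> cball 0 \<rho>"
  shows "(\<lambda>k. measure lebesgue (vimg (nbhd (1 / real (Suc k)) E))) \<longlonglongrightarrow> measure lebesgue (vimg E)"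
proof -
  let ?A = "\<lambda>k. vimg (nbhd (1 / real (Suc k)) E)"
  have "(\<Inter>k. ?A k) = vimg E"
  proof (intro equalityI subsetI)
    fix s assume s: "s \<in> (\<Inter>k. ?A k)"
    then have "s \<in> ?A 0" by blast
    then obtain y where y: "y \<in> cball 0 \<rho>" "s - y \<in> sub y" by (auto simp: vimg_def nbhd_def)
    have "infdist y E \<le> 1 / real (Suc k)" for k
    proof -
      have "s \<in> ?A k" using s by blast
      then obtain y' where y': "y' \<in> cball 0 \<rho>" "infdist y' E \<le> 1 / real (Suc k)" "s - y' \<in> sub y'"
        by (auto simp: vimg_def nbhd_def)
      have "y' = y" by (rule vimg_unique[OF cball_ballD[OF y'(1)] cball_ballD[OF y(1)] y'(3) y(2)])
      then show ?thesis using y' by simp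
    qed
    moreover have "(\<lambda>k. 1 / real (Suc k)) \<longlonglongrightarrow> 0"
      using LIMSEQ_inverse_real_of_nat by (simp add: inverse_eq_divide)
    ultimately have "infdist y E \<le> 0" by (intro LIMSEQ_le_const) auto
    then have "y \<in> E" using E infdist_nonneg[of y E] by (simp add: in_closed_iff_infdist_zero)
    then show "s \<in> vimg E" using y by (auto simp: vimg_def)
  next
    fix s assume "s \<in> vimg E"
    moreover have "E \<subseteq> nbhd (1 / real (Suc k)) E" for k using E by (auto simp: nbhd_def)
    ultimately show "s \<in> (\<Inter>k. ?A k)" using vimg_mono by blast
  qed
  moreover have "(\<lambda>k. measure lebesgue (?A k)) \<longlonglongrightarrow> measure lebesgue (\<Inter>k. ?A k)"
  proof (rule Lim_measure_decseq)
    show "range ?A \<subseteq> sets lebesgue" using vimg_nbhd_lmeasurable by blast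
    show "decseq ?A"
    proof (rule decseq_SucI)
      fix k
      have "1 / real (Suc (Suc k)) \<le> 1 / real (Suc k)" by (simp add: field_simps)
      then show "?A (Suc k) \<le> ?A k" by (intro vimg_mono) (auto simp: nbhd_def)
    qed
    show "emeasure lebesgue (?A k) \<noteq> \<infinity>" for k
      unfolding infinity_ennreal_def by (rule fmeasurableD2[OF vimg_nbhd_lmeasurable])
  qed
  ultimately show ?thesis by simp
qed

section \<open>Exhaustion of the contact points by compact pieces\<close>

definition flat_set :: "real \<Rightarrow> real \<Rightarrow> 'a set" where
  "flat_set \<sigma> \<tau> = {x \<in> cball 0 \<sigma>. \<exists>p\<in>sub x. (\<forall>p'\<in>sub x. norm p' \<le> norm p) \<and> has_contact \<tau> x p}"

text \<open>Every point of \<open>flat_set\<close> is fat below some scale, so the increasing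
  compact sets \<open>F j\<close> exhaust it. Their successive differences are cut into compact
  shells, each costing at most \<open>\<eta>\<close> times its own mass. A slope is counted for at
  most two shells, hence the factor 2.\<close>

lemma hausdorff_pre_flat_set_le:
  assumes \<sigma>: "0 \<le> \<sigma>" "\<sigma> < \<rho>" and \<tau>: "\<tau> > 0" and \<eta>: "\<eta> > 0" and \<delta>: "\<delta> > 0"
  shows "hausdorff_pre (DIM('a) - 1) \<delta> (flat_set \<sigma> \<tau>) \<le> ennreal (2 * \<eta> * measure lebesgue (vimg (cball 0 \<rho>)))"
proof -
  let ?s = "DIM('a) - 1" and ?Z = "vimg (cball 0 \<rho>)"
  obtain R where R: "R > 0" and RE: "\<forall>r0 E \<delta> \<beta>. r0 > 0 \<longrightarrow> E \<subseteq> fat_contact_set \<sigma> \<tau> R r0 \<longrightarrow> \<delta> > 0 \<longrightarrow> \<beta> > 0 \<longrightarrow>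
     hausdorff_pre ?s \<delta> E \<le> ennreal (\<eta> * measure lebesgue (vimg (nbhd \<beta> E)))"
    by (rule hausdorff_pre_le_vimg_nbhd[OF \<sigma> \<tau> \<eta>])
  define F where "F j = fat_contact_set \<sigma> \<tau> R (1 / real (Suc j))" for j
  have F\<rho>: "F j \<subseteq> cball 0 \<rho>" for j using \<sigma> by (auto simp: F_def fat_contact_set_def)
  have cF: "compact (F j)" for j unfolding F_def using \<sigma> R by (intro compact_fat_contact_set) auto
  have monoF: "F i \<subseteq> F j" if "i \<le> j" for i j
  proof -
    have "1 / real (Suc j) \<le> 1 / real (Suc i)" using that by (simp add: frac_le)
    then show ?thesis unfolding F_def fat_contact_set_def by (auto intro: order_trans)
  qed
  have est: "hausdorff_pre ?s \<delta> E \<le> ennreal (\<eta> * measure lebesgue (vimg E))" if E: "compact E" "E \<subseteq> F j" for E j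
  proof (cases "E = {}")
    \<comment> \<open>The neighbourhoods of the empty set are the whole ball, since
      \<open>infdist\<close> to it is 0, so the limit below would fail.\<close>
    case True
    then show ?thesis using \<delta> by (simp add: hausdorff_pre_empty)
  next
    case False
    have "(\<lambda>k. ennreal (\<eta> * measure lebesgue (vimg (nbhd (1 / real (Suc k)) E)))) \<longlonglongrightarrow> ennreal (\<eta> * measure lebesgue (vimg E))"
      using False E F\<rho> by (intro tendsto_ennrealI tendsto_mult tendsto_const vimg_nbhd_tendsto compact_imp_closed) blast+
    moreover have "hausdorff_pre ?s \<delta> E \<le> ennreal (\<eta> * measure lebesgue (vimg (nbhd (1 / real (Suc k)) E)))" for k
      using E \<delta> by (intro RE[rule_format, of "1 / real (Suc j)"]) (auto simp: F_def)
    ultimately show ?thesis by (intro LIMSEQ_le_const) auto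
  qed
  define C where "C j = (if j = 0 then {} else F (j - 1))" for j :: nat
  have cC: "closed (C j)" for j using cF compact_imp_closed by (auto simp: C_def)
  define good where "good j A \<longleftrightarrow> (\<forall>k. compact (A k)) \<and> (\<forall>k. A k \<subseteq> F j - C j) \<and> F j - C j \<subseteq> (\<Union>k. A k) \<and>
    (\<forall>y. \<exists>m. {k. y \<in> A k} \<subseteq> {m, Suc m})" for j and A :: "nat \<Rightarrow> 'a set"
  have "\<exists>A. good j A" for j
  proof -
    obtain A :: "nat \<Rightarrow> 'a set" where "\<And>k. compact (A k)" "\<And>k. A k \<subseteq> F j - C j" "F j - C j \<subseteq> (\<Union>k. A k)"
      "\<And>y. \<exists>m. {k. y \<in> A k} \<subseteq> {m, Suc m}" using annuli_cover[OF cF cC] by blast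
    then show ?thesis by (intro exI[of _ A]) (simp add: good_def)
  qed
  then obtain A where "\<And>j. good j (A j)" by metis
  then have A: "\<And>j k. compact (A j k)" "\<And>j k. A j k \<subseteq> F j - C j"
    "\<And>j. F j - C j \<subseteq> (\<Union>k. A j k)" "\<And>j y. \<exists>m. {k. y \<in> A j k} \<subseteq> {m, Suc m}" by (auto simp: good_def)
  define E where "E i = A (fst (prod_decode i)) (snd (prod_decode i))" for i
  have juniq: "j = j'" if "y \<in> F j - C j" "y \<in> F j' - C j'" for j j' y
  proof (rule ccontr)
    have *: "False" if "y \<in> F a - C a" "y \<in> F b - C b" "a < b" for a b
    proof -
      have "F a \<subseteq> C b" using that(3) monoF[of a "b - 1"] by (auto simp: C_def)
      then show False using that by blast
    qed
    assume "j \<noteq> j'"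
    then show False using *[of j j'] *[of j' j] that by linarith
  qed
  have cover: "flat_set \<sigma> \<tau> \<subseteq> (\<Union>i. E i)"
  proof
    fix x assume x: "x \<in> flat_set \<sigma> \<tau>"
    then obtain p where p: "p \<in> sub x" "\<And>p'. p' \<in> sub x \<Longrightarrow> norm p' \<le> norm p" "has_contact \<tau> x p" and nx: "norm x \<le> \<sigma>"
      by (auto simp: flat_set_def)
    \<comment> \<open>\<open>2 * R\<close>, because \<open>fat_of_max_norm\<close> yields fatness
      with half of its parameter.\<close>
    obtain r0 where r0: "r0 > 0" "\<And>r. 0 < r \<Longrightarrow> r \<le> r0 \<Longrightarrow> fat R r x p"
      using fat_of_max_norm[of x p "2 * R"] p nx \<sigma> R by auto
    obtain j where j: "1 / real (Suc j) < r0" using r0(1) nat_approx_posE by blast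
    have "x \<in> F j" unfolding F_def fat_contact_set_def using p nx r0 j by (auto intro!: bexI[of _ p])
    then have ex: "\<exists>j. x \<in> F j" by blast
    define i where "i = (LEAST j. x \<in> F j)"
    have "x \<in> F i" unfolding i_def using ex by (rule LeastI_ex)
    moreover have "x \<notin> C i"
    proof (cases i)
      case (Suc l)
      then have "l < (LEAST j. x \<in> F j)" by (simp add: i_def)
      then have "x \<notin> F l" by (rule not_less_Least)
      then show ?thesis using Suc by (simp add: C_def)
    qed (simp add: C_def)
    ultimately obtain k where "x \<in> A i k" using A(3)[of i] by blast
    then have "x \<in> E (prod_encode (i, k))" by (simp add: E_def)
    then show "x \<in> (\<Union>i. E i)" by blast
  qed
  have E\<rho>: "E i \<subseteq> cball 0 \<rho>" for i using A(2) F\<rho> by (force simp: E_def)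
  have cE: "compact (E i)" for i using A(1) by (simp add: E_def)
  have VE: "vimg (E i) \<in> lmeasurable" for i
    using cE E\<rho> compact_imp_closed by (intro vimg_lmeasurable) auto
  have sums: "(\<Sum>i\<in>{..<m}. measure lebesgue (vimg (E i))) \<le> 2 * measure lebesgue ?Z" for m
  proof (rule sum_measure_le_overlap)
    show "?Z \<in> lmeasurable" by (intro vimg_lmeasurable) auto
    show "vimg (E i) \<subseteq> ?Z" for i using E\<rho> by (rule vimg_mono)
    fix s assume "s \<in> ?Z"
    then obtain y where y: "y \<in> cball 0 \<rho>" "s - y \<in> sub y" by (auto simp: vimg_def)
    have yE: "y \<in> E i" if s: "s \<in> vimg (E i)" for i
    proof -
      obtain y' where y': "y' \<in> E i" "s - y' \<in> sub y'" using s by (auto simp: vimg_def)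
      have "y' = y" using y' E\<rho>[of i] by (intro vimg_unique[OF cball_ballD cball_ballD y'(2) y(2)] y) auto
      then show ?thesis using y' by simp
    qed
    \<comment> \<open>A point lies in one difference only, and there in at most two neighbouring
      shells.\<close>
    have "\<exists>a b. {i. y \<in> E i} \<subseteq> {a, b}"
    proof (cases "\<exists>i. y \<in> E i")
      case True
      then obtain i where i: "y \<in> E i" by blast
      define j where "j = fst (prod_decode i)"
      have j: "y \<in> F j - C j" using i A(2) by (auto simp: E_def j_def)
      obtain l where l: "{k. y \<in> A j k} \<subseteq> {l, Suc l}" using A(4) by blast
      have "i' \<in> {prod_encode (j, l), prod_encode (j, Suc l)}" if i': "y \<in> E i'" for i'
      proof -
        obtain a b where ab: "prod_decode i' = (a, b)" by (cases "prod_decode i'")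
        then have yab: "y \<in> A a b" using i' by (simp add: E_def)
        then have "a = j" using A(2) j by (intro juniq[of y]) auto
        then have "b \<in> {l, Suc l}" using yab l by blast
        moreover have "i' = prod_encode (a, b)" using ab by (metis prod_decode_inverse)
        ultimately show ?thesis using \<open>a = j\<close> by auto
      qed
      then show ?thesis by blast
    qed auto
    then obtain a b where "{i. y \<in> E i} \<subseteq> {a, b}" by blast
    then have "{i \<in> {..<m}. s \<in> vimg (E i)} \<subseteq> {a, b}" using yE by blast
    then have "card {i \<in> {..<m}. s \<in> vimg (E i)} \<le> card {a, b}" by (intro card_mono) auto
    also have "\<dots> \<le> 2" by (simp add: card_insert_if)
    finally show "real (card {i \<in> {..<m}. s \<in> vimg (E i)}) \<le> 2" by simp
  qed (use VE in auto)
  have "hausdorff_pre ?s \<delta> (flat_set \<sigma> \<tau>) \<le> hausdorff_pre ?s \<delta> (\<Union>i. E i)"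
    using cover by (rule hausdorff_pre_mono)
  also have "\<dots> \<le> (\<Sum>i. hausdorff_pre ?s \<delta> (E i))" by (rule hausdorff_pre_UN_le)
  also have "\<dots> \<le> (\<Sum>i. ennreal (\<eta> * measure lebesgue (vimg (E i))))"
  proof (intro suminf_le summableI)
    fix i show "hausdorff_pre ?s \<delta> (E i) \<le> ennreal (\<eta> * measure lebesgue (vimg (E i)))"
      using cE A(2) by (intro est[of _ "fst (prod_decode i)"]) (auto simp: E_def)
  qed
  also have "\<dots> \<le> ennreal (2 * \<eta> * measure lebesgue ?Z)"
  proof (rule suminf_le_const[OF summableI])
    fix m
    have "(\<Sum>i<m. ennreal (\<eta> * measure lebesgue (vimg (E i)))) = ennreal (\<eta> * (\<Sum>i<m. measure lebesgue (vimg (E i))))"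
      using \<eta> by (simp add: sum_distrib_left)
    also have "\<dots> \<le> ennreal (\<eta> * (2 * measure lebesgue ?Z))"
      using \<eta> sums[of m] by (intro ennreal_leI mult_left_mono) auto
    finally show "(\<Sum>i<m. ennreal (\<eta> * measure lebesgue (vimg (E i)))) \<le> ennreal (2 * \<eta> * measure lebesgue ?Z)"
      by (simp add: mult_ac)
  qed
  finally show ?thesis .
qed

lemma hausdorff_pre_flat_set:
  assumes \<sigma>: "0 \<le> \<sigma>" "\<sigma> < \<rho>" and \<tau>: "\<tau> > 0" and \<delta>: "\<delta> > 0"
  shows "hausdorff_pre (DIM('a) - 1) \<delta> (flat_set \<sigma> \<tau>) = 0"
proof -
  let ?Z = "measure lebesgue (vimg (cball 0 \<rho>))"
  have "hausdorff_pre (DIM('a) - 1) \<delta> (flat_set \<sigma> \<tau>) \<le> 0 + ennreal e" if e: "e > 0" for e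
  proof -
    define \<eta> where "\<eta> = e / (2 * (?Z + 1))"
    have Z: "?Z \<ge> 0" by simp
    have \<eta>: "\<eta> > 0" using e Z by (simp add: \<eta>_def add_nonneg_pos)
    have "2 * \<eta> * ?Z \<le> 2 * \<eta> * (?Z + 1)" using \<eta> by (intro mult_left_mono) auto
    also have "\<dots> = e"
    proof -
      have *: "2 * (e / (2 * t)) * t = e" if "t > 0" for t :: real using that by simp
      show ?thesis unfolding \<eta>_def using Z by (intro *) linarith
    qed
    finally have "ennreal (2 * \<eta> * ?Z) \<le> ennreal e" by (rule ennreal_leI)
    with hausdorff_pre_flat_set_le[OF \<sigma> \<tau> \<eta> \<delta>] show ?thesis
      unfolding add_0 by (rule order_trans)
  qed
  then have "hausdorff_pre (DIM('a) - 1) \<delta> (flat_set \<sigma> \<tau>) \<le> 0" by (rule ennreal_le_epsilon)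
  then show ?thesis by simp
qed

section \<open>From contact at a distance to the whole unit ball\<close>

lemma max_norm_subgradient:
  assumes "x \<in> cball 0 \<rho>"
  obtains p where "p \<in> sub x" "\<And>p'. p' \<in> sub x \<Longrightarrow> norm p' \<le> norm p"
proof -
  have "compact (snd ` (graph \<inter> {x} \<times> UNIV))"
    by (intro compact_continuous_image continuous_intros compact_Int_closed compact_graph closed_Times closed_singleton closed_UNIV)
  also have "snd ` (graph \<inter> {x} \<times> UNIV) = sub x" using assms by (force simp: graph_def image_iff)
  finally have "compact (sub x)" .
  moreover have "sub x \<noteq> {}" using sub_nonempty[OF cball_ballD[OF assms]] .
  ultimately show ?thesis
    using continuous_attains_sup[of "sub x" norm] that continuous_on_norm_id by blast
qed

text \<open>Between \<open>x\<close> and \<open>y\<close> the function is below the chord and above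
  the supporting plane, which agree there; so the contact may be shortened to length
  \<open>\<tau>\<close>.\<close>

lemma has_contactI:
  assumes x: "norm x + \<tau> \<le> \<rho>" and p: "p \<in> sub x" and y: "y \<in> ball 0 1" "u y = u x + p \<bullet> (y - x)"
    and \<tau>: "0 < \<tau>" "\<tau> \<le> norm (y - x)"
  shows "has_contact \<tau> x p"
proof -
  define t where "t = \<tau> / norm (y - x)"
  have ny: "norm (y - x) > 0" using \<tau> by linarith
  have t: "0 \<le> t" "t \<le> 1" using \<tau> ny by (auto simp: t_def)
  define e where "e = (1 / norm (y - x)) *\<^sub>R (y - x)"
  have e: "norm e = 1" using ny by (simp add: e_def)
  have te: "\<tau> *\<^sub>R e = t *\<^sub>R (y - x)" by (simp add: t_def e_def)
  have xB: "x \<in> ball 0 1" using x \<tau> \<rho> by simp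
  have z: "x + \<tau> *\<^sub>R e = (1 - t) *\<^sub>R x + t *\<^sub>R y" unfolding te by (simp add: algebra_simps)
  have zc: "x + \<tau> *\<^sub>R e \<in> cball 0 \<rho>"
    using norm_triangle_ineq[of x "\<tau> *\<^sub>R e"] x \<tau> e by simp
  have "u (x + \<tau> *\<^sub>R e) \<le> (1 - t) * u x + t * u y" unfolding z by (intro u_combination xB y t)
  also have "\<dots> = u x + t * (p \<bullet> (y - x))" unfolding y(2) by (simp add: algebra_simps)
  also have "t * (p \<bullet> (y - x)) = p \<bullet> (\<tau> *\<^sub>R e)" unfolding te by simp
  finally have "u (x + \<tau> *\<^sub>R e) \<le> u x + \<tau> * (p \<bullet> e)" by simp
  moreover have "u (x + \<tau> *\<^sub>R e) \<ge> u x + \<tau> * (p \<bullet> e)" using subD[OF p cball_ballD[OF zc]] by simp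
  ultimately show ?thesis using e zc by (auto simp: has_contact_def)
qed

end

theorem theorem1p1:
  fixes u :: "'a::euclidean_space \<Rightarrow> real"
  assumes "convex_on (ball 0 1) u"
    and "alexandrov_det_ge_1 (ball 0 1) u"
  shows "hausdorff_measure (DIM('a) - 1)
           {x \<in> ball 0 1. \<not> strictly_convex_at (ball 0 1) u x} = 0"
proof -
  let ?s = "DIM('a) - 1" and ?\<Sigma> = "{x \<in> ball 0 1. \<not> strictly_convex_at (ball 0 1) u x}"
  \<comment> \<open>The sum of \<open>\<sigma> k\<close> and \<open>\<tau> k\<close> is
    \<open>\<rho> k\<close>, so a contact of length \<open>\<tau> k\<close> starting in the ball of
    radius \<open>\<sigma> k\<close> ends within radius \<open>\<rho> k\<close>. The shift by 2
    keeps \<open>\<sigma> 0\<close> nonnegative and \<open>\<rho> 0\<close> positive.\<close>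
  define \<rho> where "\<rho> k = 1 - 1 / real (k + 2)" for k :: nat
  define \<tau> where "\<tau> k = 1 / real (k + 2)" for k :: nat
  define \<sigma> where "\<sigma> k = 1 - 2 / real (k + 2)" for k :: nat
  have loc: "alexandrov_on_unit_ball u (\<rho> k)" for k
    using assms by unfold_locales (auto simp: \<rho>_def)
  have \<sigma>: "0 \<le> \<sigma> k" "\<sigma> k < \<rho> k" and \<tau>: "\<tau> k > 0" and \<sigma>\<tau>: "\<sigma> k + \<tau> k = \<rho> k" for k
    by (auto simp: \<sigma>_def \<rho>_def \<tau>_def field_simps)
  define S where "S k = alexandrov_on_unit_ball.flat_set u (\<rho> k) (\<sigma> k) (\<tau> k)" for k
  have cover: "?\<Sigma> \<subseteq> (\<Union>k. S k)"
  proof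
    fix x assume x: "x \<in> ?\<Sigma>"
    then have nx: "norm x < 1" by simp
    obtain k0 where k0: "1 / real (Suc k0) < (1 - norm x) / 2" using nx nat_approx_posE[of "(1 - norm x) / 2"] by auto
    have large: "norm x \<le> \<sigma> k" if "k0 \<le> k" for k
    proof -
      have "1 / real (k + 2) \<le> 1 / real (Suc k0)" using that by (intro divide_left_mono) auto
      then have "1 / real (k + 2) < (1 - norm x) / 2" using k0 by (rule order.strict_trans1)
      moreover have "2 * a \<le> b" if "a < b / 2" for a b :: real using that by simp
      ultimately have "2 * (1 / real (k + 2)) \<le> 1 - norm x" by blast
      then show ?thesis by (simp add: \<sigma>_def)
    qed
    interpret k0: alexandrov_on_unit_ball u "\<rho> k0" by (rule loc)
    have "x \<in> cball 0 (\<rho> k0)" using large[of k0] \<sigma>[of k0] by simp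
    then obtain p where p: "p \<in> subgradient (ball 0 1) u x"
      "\<And>p'. p' \<in> subgradient (ball 0 1) u x \<Longrightarrow> norm p' \<le> norm p" using k0.max_norm_subgradient by blast
    have "{y \<in> ball 0 1. u y = u x + p \<bullet> (y - x)} \<noteq> {x}"
      using x p(1) unfolding strictly_convex_at_def by blast
    then obtain y where y: "y \<in> ball 0 1" "u y = u x + p \<bullet> (y - x)" "y \<noteq> x" using nx by fastforce
    obtain k1 where k1: "1 / real (Suc k1) < norm (y - x)" using y(3) nat_approx_posE[of "norm (y - x)"] by auto
    \<comment> \<open>Large \<open>k\<close> brings \<open>x\<close> within radius
      \<open>\<sigma> k\<close> and \<open>\<tau> k\<close> below the distance to \<open>y\<close>.
      Subgradients refer to the whole unit ball and not to \<open>\<rho> k\<close>, so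
      \<open>p\<close> remains one of maximal norm.\<close>
    define k where "k = max k0 k1"
    interpret k: alexandrov_on_unit_ball u "\<rho> k" by (rule loc)
    have "1 / real (k + 2) \<le> 1 / real (Suc k1)" by (intro divide_left_mono) (auto simp: k_def)
    then have "\<tau> k \<le> norm (y - x)" using k1 by (simp add: \<tau>_def)
    moreover have nk: "norm x \<le> \<sigma> k" by (rule large) (simp add: k_def)
    ultimately have "k.has_contact (\<tau> k) x p" using \<sigma>\<tau>[of k] \<tau>[of k] p y by (intro k.has_contactI) auto
    then have "x \<in> S k" unfolding S_def k.flat_set_def using nk p by auto
    then show "x \<in> (\<Union>k. S k)" by blast
  qed
  have "hausdorff_pre ?s \<delta> ?\<Sigma> = 0" if \<delta>: "\<delta> > 0" for \<delta>
  proof -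
    have "hausdorff_pre ?s \<delta> (S k) = 0" for k
      unfolding S_def by (rule alexandrov_on_unit_ball.hausdorff_pre_flat_set[OF loc \<sigma> \<tau> \<delta>])
    then have "(\<Sum>k. hausdorff_pre ?s \<delta> (S k)) = 0" by simp
    then have "hausdorff_pre ?s \<delta> (\<Union>k. S k) = 0" using hausdorff_pre_UN_le[of ?s \<delta> S] by simp
    then show ?thesis using hausdorff_pre_mono[OF cover, of ?s \<delta>] by simp
  qed
  then show ?thesis by (simp add: hausdorff_measure_def)
qed

end
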